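(* Let $S(\lambda)=\sum_{k=0}^\infty a_k\lambda^k$ be an entire function on $\mathbb C$ such that $a_k>0$ for all $k\in\mathbb N$. For every $\lambda_1>8e$ there exists $C>0$ such that, for $V=\oplus_{n\ge0}V^{(n)}\in\Gamma_s(\mathcal Z)$ and $\Psi\in\Gamma_s(\mathcal Z)$, the inequality $$\big\|F_V^{Wick}\Psi\big\|\le 2\,\|\Gamma(\sqrt\varepsilon)V\|\,\|\Psi\|+C\Big(\sum_{n=0}^\infty\frac{(\lambda_1\varepsilon)^n}{a_{n+2}}\|V^{(n)}\|^2_{\otimes_s^n\mathcal Z}\Big)^{\frac12}\Big\|\sqrt{S(\tfrac N\varepsilon)}\,\Psi\Big\|$$ holds whenever the right-hand side is finite.
   Context: $\mathcal Z$ is a separable complex Hilbert space, $\langle\cdot,\cdot\rangle$ antilinear in the left argument, with an antilinear map $\mathfrak c$ satisfying $\mathfrak c\circ\mathfrak c=1$, $|\mathfrak c(z)|=|z|$; $\bar z=\mathfrak c(z)$, $\mathcal Z_0=\{z:\bar z=z\}$. $\Gamma_s(\mathcal Z)=\bigoplus_{n\ge0}\otimes_s^n\mathcal Z$ (symmetric Fock space), $\Omega=(1,0,\dots)$, $\mathcal S_n$ the orthogonal projection onto $\otimes_s^n\mathcal Z$. $\varepsilon\in(0,1]$ is a parameter; $a^*(f)\psi=\sqrt{\varepsilon(n+1)}\,\mathcal S_{n+1}(f\otimes\psi)$ for $\psi\in\otimes_s^n\mathcal Z$, $a(f)$ its adjoint, $\Phi_s(f)=\frac1{\sqrt2}(a^*(f)+a(f))$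 (self-adjoint), $W(f)=e^{i\Phi_s(f)}$. $\Gamma(r)$ ($r>0$) multiplies $\otimes_s^n\mathcal Z$ by $r^n$; $N$ multiplies $\otimes_s^n\mathcal Z$ by $\varepsilon n$. For $V=\oplus_nV^{(n)}\in\Gamma_s(\mathcal Z)$, $F_V(z)=\sum_{n\ge0}\langle\frac{(z+\bar z)^{\otimes n}}{\sqrt{n!}},V^{(n)}\rangle$, $z\in\mathcal Z$, and $F_V^{Wick}$ is the closure of the linear operator defined on $\mathrm{span}\{W(\varphi)\Omega:\varphi\in\mathcal Z_0\}$ by $F_V^{Wick}W(\varphi)\Omega=W(\varphi)\Gamma(\sqrt\varepsilon)V$. *)

theory Defs
  imports "HOL-Analysis.Analysis" "HOL-Library.Multiset"
begin

section \<open>Complex Hilbert spaces\<close>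

text \<open>The inner product is antilinear in the left argument; norm, metric and topology are
  those of the underlying real Hilbert space, whose inner product is the real part.\<close>

class complex_hilbert = real_inner + complete_space +
  fixes scaleC :: "complex \<Rightarrow> 'a \<Rightarrow> 'a" (infixr "*\<^sub>C" 75)
    and cinner :: "'a \<Rightarrow> 'a \<Rightarrow> complex"
  assumes scaleC_add_right: "\<alpha> *\<^sub>C (x + y) = \<alpha> *\<^sub>C x + \<alpha> *\<^sub>C y"
    and scaleC_add_left: "(\<alpha> + \<beta>) *\<^sub>C x = \<alpha> *\<^sub>C x + \<beta> *\<^sub>C x"
    and scaleC_scaleC: "\<alpha> *\<^sub>C \<beta> *\<^sub>C x = (\<alpha> * \<beta>) *\<^sub>C x"
    and scaleR_scaleC: "r *\<^sub>R x = complex_of_real r *\<^sub>C x"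
    and cinner_commute: "cinner x y = cnj (cinner y x)"
    and cinner_add_right: "cinner x (y + z) = cinner x y + cinner x z"
    and cinner_scaleC_right: "cinner x (\<alpha> *\<^sub>C y) = \<alpha> * cinner x y"
    and inner_cinner: "inner x y = Re (cinner x y)"

subclass (in complex_hilbert) banach ..

lemma cinner_add_left: "cinner (x + y) z = cinner x z + cinner y (z::'a::complex_hilbert)"
  by (metis cinner_add_right cinner_commute complex_cnj_add)

lemma cinner_scaleC_left: "cinner (\<alpha> *\<^sub>C x) y = cnj \<alpha> * cinner x (y::'a::complex_hilbert)"
  by (metis cinner_scaleC_right cinner_commute complex_cnj_mult)

lemma cinner_zero_right [simp]: "cinner (x::'a::complex_hilbert) 0 = 0"
  using cinner_add_right[of x 0 0] by simp

lemma cinner_zero_left [simp]: "cinner 0 (x::'a::complex_hilbert) = 0"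
  using cinner_add_left[of 0 0 x] by simp

lemma cinner_diff_right: "cinner (x::'a::complex_hilbert) (y - z) = cinner x y - cinner x z"
  using cinner_add_right[of x "y - z" z] by simp

lemma cinner_sum_right: "cinner (x::'a::complex_hilbert) (\<Sum>i\<in>I. f i) = (\<Sum>i\<in>I. cinner x (f i))"
  by (induction I rule: infinite_finite_induct) (simp_all add: cinner_add_right)

lemma cinner_sum_left: "cinner (\<Sum>i\<in>I. f i) (x::'a::complex_hilbert) = (\<Sum>i\<in>I. cinner (f i) x)"
  by (induction I rule: infinite_finite_induct) (simp_all add: cinner_add_left)

lemma cinner_self: "cinner x x = complex_of_real ((norm (x::'a::complex_hilbert))\<^sup>2)"
proof (rule complex_eqI)
  show "Re (cinner x x) = Re (complex_of_real ((norm x)\<^sup>2))"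
    by (simp add: power2_norm_eq_inner inner_cinner)
  have "Im (cinner x x) = - Im (cinner x x)"
    using cinner_commute[of x x] by (metis cnj.simps(2))
  then show "Im (cinner x x) = Im (complex_of_real ((norm x)\<^sup>2))" by simp
qed

lemma cnj_mult_self: "cnj z * z = complex_of_real ((cmod z)\<^sup>2)"
  by (simp only: complex_norm_square mult.commute)

lemma norm_scaleC: "norm (\<alpha> *\<^sub>C (x::'a::complex_hilbert)) = cmod \<alpha> * norm x"
proof -
  have "complex_of_real ((norm (\<alpha> *\<^sub>C x))\<^sup>2) = (cnj \<alpha> * \<alpha>) * cinner x x"
    by (simp only: cinner_self[symmetric] cinner_scaleC_left cinner_scaleC_right mult_ac)
  also have "\<dots> = complex_of_real ((cmod \<alpha> * norm x)\<^sup>2)"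
    by (simp add: cnj_mult_self cinner_self power_mult_distrib)
  finally have "(norm (\<alpha> *\<^sub>C x))\<^sup>2 = (cmod \<alpha> * norm x)\<^sup>2" by (simp only: of_real_eq_iff)
  then show ?thesis by (simp add: power2_eq_iff_nonneg)
qed

lemma norm_cinner_le: "cmod (cinner x y) \<le> norm x * norm (y::'a::complex_hilbert)"
proof -
  define u where "u = cnj (sgn (cinner x y))"
  have "u * cinner x y = complex_of_real ((cmod (cinner x y))\<^sup>2 / cmod (cinner x y))"
    unfolding u_def by (simp add: sgn_eq cnj_mult_self)
  then have "complex_of_real (cmod (cinner x y)) = u * cinner x y"
    by (simp add: power2_eq_square)
  also have "\<dots> = cinner x (u *\<^sub>C y)" by (simp add: cinner_scaleC_right)
  finally have "cmod (cinner x y) = inner x (u *\<^sub>C y)"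
    by (metis Re_complex_of_real inner_cinner)
  also have "\<dots> \<le> norm x * norm (u *\<^sub>C y)" by (rule norm_cauchy_schwarz)
  also have "\<dots> \<le> norm x * norm y"
    by (intro mult_left_mono) (auto simp: norm_scaleC u_def norm_sgn)
  finally show ?thesis .
qed

lemma bounded_linear_cinner_right: "bounded_linear (cinner (x::'a::complex_hilbert))"
proof (rule bounded_linear_intro[where K="norm x"])
  show "norm (cinner x y) \<le> norm y * norm x" for y
    using norm_cinner_le[of x y] by (simp add: mult.commute)
qed (auto simp: cinner_add_right scaleR_scaleC cinner_scaleC_right scaleR_conv_of_real)

lemma bounded_linear_scaleC: "bounded_linear (\<lambda>x::'a::complex_hilbert. \<alpha> *\<^sub>C x)"
  by (rule bounded_linear_intro[where K="cmod \<alpha>"])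
    (auto simp: scaleC_add_right scaleR_scaleC scaleC_scaleC norm_scaleC mult.commute)

subsection \<open>Orthonormal bases\<close>

definition orthonormal :: "'a::complex_hilbert set \<Rightarrow> bool" where
  "orthonormal B \<longleftrightarrow> (\<forall>x\<in>B. \<forall>y\<in>B. cinner x y = (if x = y then 1 else 0))"

definition orthonormal_basis :: "'a::complex_hilbert set \<Rightarrow> bool" where
  "orthonormal_basis B \<longleftrightarrow> orthonormal B \<and> (\<forall>x. (\<forall>b\<in>B. cinner b x = 0) \<longrightarrow> x = 0)"

lemma ex_orthonormal_basis: "\<exists>B::'a::complex_hilbert set. orthonormal_basis B"
proof -
  have "\<exists>M\<in>{B::'a set. orthonormal B}. \<forall>X\<in>{B. orthonormal B}. M \<subseteq> X \<longrightarrow> X = M"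
  proof (rule subset_Zorn_nonempty)
    show "{B::'a set. orthonormal B} \<noteq> {}"
      by (auto simp: orthonormal_def intro!: exI[of _ "{}"])
    fix C :: "'a set set"
    assume C: "C \<noteq> {}" "subset.chain {B. orthonormal B} C"
    have "cinner x y = (if x = y then 1 else 0)" if xy: "x \<in> \<Union>C" "y \<in> \<Union>C" for x y
    proof -
      obtain X Y where XY: "X \<in> C" "x \<in> X" "Y \<in> C" "y \<in> Y" using xy by blast
      have "X \<subseteq> Y \<or> Y \<subseteq> X" and "orthonormal X" "orthonormal Y"
        using C(2) XY by (auto simp: subset_chain_def)
      then show ?thesis using XY unfolding orthonormal_def by blast
    qed
    then show "\<Union>C \<in> {B. orthonormal B}" by (simp add: orthonormal_def)
  qed
  then obtain B :: "'a set" where B: "orthonormal B"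
    and max: "\<And>X. orthonormal X \<Longrightarrow> B \<subseteq> X \<Longrightarrow> X = B" by auto
  have "x = 0" if x: "\<forall>b\<in>B. cinner b x = 0" for x
  proof (rule ccontr)
    assume "x \<noteq> 0"
    define u where "u = complex_of_real (inverse (norm x)) *\<^sub>C x"
    have bu: "cinner b u = 0" and ub: "cinner u b = 0" if "b \<in> B" for b
      using x that cinner_commute[of u b] by (auto simp: u_def cinner_scaleC_right)
    have uu: "cinner u u = 1"
      using \<open>x \<noteq> 0\<close> by (simp add: cinner_self u_def norm_scaleC norm_inverse)
    have "orthonormal (insert u B)"
      unfolding orthonormal_def
    proof (intro ballI)
      fix a b assume "a \<in> insert u B" "b \<in> insert u B"
      then show "cinner a b = (if a = b then 1 else 0)"
        using B bu ub uu unfolding orthonormal_def by (metis insertE)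
    qed
    then have "u \<in> B" using max[of "insert u B"] by blast
    then show False using bu[of u] uu by simp
  qed
  with B show ?thesis by (auto simp: orthonormal_basis_def)
qed

lemma bessel_finite:
  assumes "orthonormal B" "finite F" "F \<subseteq> B"
  shows "(norm (\<Sum>b\<in>F. c b *\<^sub>C b))\<^sup>2 = (\<Sum>b\<in>F. (cmod (c b))\<^sup>2)"
proof -
  have on: "cinner b b' = (if b = b' then 1 else 0)" if "b \<in> F" "b' \<in> F" for b b'
    using assms that unfolding orthonormal_def by blast
  have "complex_of_real ((norm (\<Sum>b\<in>F. c b *\<^sub>C b))\<^sup>2)
      = (\<Sum>b\<in>F. \<Sum>b'\<in>F. cnj (c b) * (c b' * cinner b b'))"
    by (simp only: cinner_self[symmetric] cinner_sum_left cinner_scaleC_left)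
      (simp add: cinner_sum_right cinner_scaleC_right sum_distrib_left)
  also have "\<dots> = (\<Sum>b\<in>F. \<Sum>b'\<in>F. if b = b' then cnj (c b) * c b' else 0)"
    by (intro sum.cong refl) (simp add: on)
  also have "\<dots> = (\<Sum>b\<in>F. cnj (c b) * c b)" using assms(2) by (simp add: sum.delta)
  also have "\<dots> = complex_of_real (\<Sum>b\<in>F. (cmod (c b))\<^sup>2)"
    by (simp add: cnj_mult_self)
  finally show ?thesis by (simp only: of_real_eq_iff)
qed

lemma bessel:
  assumes "orthonormal B" "finite F" "F \<subseteq> B"
  shows "(\<Sum>b\<in>F. (cmod (cinner b x))\<^sup>2) \<le> (norm x)\<^sup>2"
proof -
  define y where "y = (\<Sum>b\<in>F. cinner b x *\<^sub>C b)"
  have ny: "(norm y)\<^sup>2 = (\<Sum>b\<in>F. (cmod (cinner b x))\<^sup>2)"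
    unfolding y_def by (rule bessel_finite[OF assms])
  have "cinner y x = (\<Sum>b\<in>F. cnj (cinner b x) * cinner b x)"
    by (simp add: y_def cinner_sum_left cinner_scaleC_left)
  also have "\<dots> = complex_of_real ((norm y)\<^sup>2)"
    by (simp add: cnj_mult_self ny)
  finally have "inner y x = (norm y)\<^sup>2" by (simp add: inner_cinner)
  moreover have "inner y x \<le> norm y * norm x" by (rule norm_cauchy_schwarz)
  ultimately have "norm y * norm y \<le> norm y * norm x" by (simp add: power2_eq_square)
  then have "norm y \<le> norm x" by (cases "norm y = 0") auto
  then show ?thesis unfolding ny[symmetric] by (intro power_mono) auto
qed

lemma bessel_summable:
  assumes "orthonormal B"
  shows "(\<lambda>b. (cmod (cinner b x))\<^sup>2) summable_on B"
  by (rule nonneg_bdd_above_summable_on)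
    (use bessel[OF assms] in \<open>auto intro!: bdd_aboveI2[where M="(norm x)\<^sup>2"]\<close>)

lemma summable_on_basis:
  assumes B: "orthonormal B" and c: "(\<lambda>b. (cmod (c b))\<^sup>2) summable_on B"
  shows "(\<lambda>b. c b *\<^sub>C b) summable_on (B::'a::complex_hilbert set)"
proof -
  define f where "f b = c b *\<^sub>C b" for b
  let ?g = "\<lambda>b. (cmod (c b))\<^sup>2"
  have "\<exists>P. eventually P (finite_subsets_at_top B) \<and>
              (\<forall>F F'. P F \<and> P F' \<longrightarrow> dist (sum f F) (sum f F') < e)" if e: "e > 0" for e
  proof -
    have "(sum ?g \<longlongrightarrow> infsum ?g B) (finite_subsets_at_top B)"
      using c has_sum_def has_sum_infsum by blast
    then have "\<forall>\<^sub>F F in finite_subsets_at_top B. dist (sum ?g F) (infsum ?g B) < (e/2)\<^sup>2"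
      using e by (intro tendstoD) auto
    then obtain F0 where F0: "finite F0" "F0 \<subseteq> B"
      and F0d: "\<And>F. finite F \<Longrightarrow> F0 \<subseteq> F \<Longrightarrow> F \<subseteq> B \<Longrightarrow> dist (sum ?g F) (infsum ?g B) < (e/2)\<^sup>2"
      by (auto simp: eventually_finite_subsets_at_top)
    define P where "P F \<longleftrightarrow> finite F \<and> F0 \<subseteq> F \<and> F \<subseteq> B" for F
    have "eventually P (finite_subsets_at_top B)"
      unfolding eventually_finite_subsets_at_top using F0 by (auto simp: P_def intro!: exI[of _ F0])
    moreover have near: "dist (sum f F) (sum f F0) < e/2" if "P F" for F
    proof -
      have F: "finite F" "F0 \<subseteq> F" "F \<subseteq> B" using that by (auto simp: P_def)
      have "(dist (sum f F) (sum f F0))\<^sup>2 = (norm (sum f (F - F0)))\<^sup>2"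
        using F F0 by (simp add: dist_norm sum_diff)
      also have "\<dots> = sum ?g (F - F0)"
        unfolding f_def using F by (intro bessel_finite[OF B]) auto
      also have "\<dots> = sum ?g F - sum ?g F0" using F F0 by (simp add: sum_diff)
      also have "\<dots> \<le> infsum ?g B - sum ?g F0"
        using finite_sum_le_infsum[OF c F(1) F(3)] by simp
      also have "\<dots> < (e/2)\<^sup>2" using F0d[OF F0(1) order.refl F0(2)] by (simp add: dist_real_def)
      finally show ?thesis using e by (meson half_gt_zero_iff less_imp_le power_less_imp_less_base)
    qed
    have "dist (sum f F) (sum f F') < e" if "P F" "P F'" for F F'
      using near[OF that(1)] near[OF that(2)] dist_triangle2[of "sum f F" "sum f F'" "sum f F0"]
      by simp
    ultimately show ?thesis by blast
  qed
  then have "cauchy_filter (filtermap (sum f) (finite_subsets_at_top B))"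
    by (simp add: cauchy_filter_metric_filtermap)
  moreover have "complete (UNIV::'a set)"
    by (meson Cauchy_convergent UNIV_I complete_def convergent_def)
  ultimately obtain L' where "(sum f \<longlongrightarrow> L') (finite_subsets_at_top B)"
    using complete_uniform[where S=UNIV] by (force simp add: filterlim_def)
  then show ?thesis
    unfolding summable_on_def has_sum_def f_def by blast
qed

lemma basis_expansion:
  assumes B: "orthonormal_basis B"
  shows "((\<lambda>b. cinner b x *\<^sub>C b) has_sum (x::'a::complex_hilbert)) B"
proof -
  have on: "orthonormal B" using B by (simp add: orthonormal_basis_def)
  obtain y where y: "((\<lambda>b. cinner b x *\<^sub>C b) has_sum y) B"
    using summable_on_basis[OF on bessel_summable[OF on]] by (auto simp: summable_on_def)
  have "cinner b (x - y) = 0" if b: "b \<in> B" for b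
  proof -
    have "((\<lambda>b'. cinner b (cinner b' x *\<^sub>C b')) has_sum cinner b y) B"
      by (rule has_sum_bounded_linear[OF bounded_linear_cinner_right y])
    moreover have "((\<lambda>b'. cinner b (cinner b' x *\<^sub>C b')) has_sum cinner b x) B"
      by (rule has_sum_finite_neutralI[where B="{b}"])
        (use b on in \<open>auto simp: cinner_scaleC_right orthonormal_def\<close>)
    ultimately have "cinner b y = cinner b x" by (rule has_sum_unique)
    then show ?thesis by (simp add: cinner_diff_right)
  qed
  then have "x - y = 0" using B unfolding orthonormal_basis_def by blast
  with y show ?thesis by simp
qed

lemma parseval:
  assumes B: "orthonormal_basis B"
  shows "((\<lambda>b. cnj (cinner b x) * cinner b y) has_sum cinner x (y::'a::complex_hilbert)) B"
proof -
  have "((\<lambda>b. cinner x (cinner b y *\<^sub>C b)) has_sum cinner x y) B"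
    by (rule has_sum_bounded_linear[OF bounded_linear_cinner_right basis_expansion[OF B]])
  then show ?thesis
    by (simp add: cinner_scaleC_right cinner_commute[of x] mult.commute)
qed

section \<open>The full Fock space\<close>

subsection \<open>Square-summable functions\<close>

definition sqs :: "('i \<Rightarrow> complex) \<Rightarrow> bool" where
  "sqs f \<longleftrightarrow> (\<lambda>i. (cmod (f i))\<^sup>2) summable_on UNIV"

lemma sqs_add: "sqs f \<Longrightarrow> sqs g \<Longrightarrow> sqs (\<lambda>i. f i + g i)"
  unfolding sqs_def
proof (rule summable_on_comparison_test)
  assume "(\<lambda>i. (cmod (f i))\<^sup>2) summable_on UNIV" "(\<lambda>i. (cmod (g i))\<^sup>2) summable_on UNIV"
  then show "(\<lambda>i. 2 * (cmod (f i))\<^sup>2 + 2 * (cmod (g i))\<^sup>2) summable_on UNIV"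
    by (intro summable_on_add summable_on_cmult_right)
  show "(cmod (f i + g i))\<^sup>2 \<le> 2 * (cmod (f i))\<^sup>2 + 2 * (cmod (g i))\<^sup>2" for i
  proof -
    have "(cmod (f i + g i))\<^sup>2 \<le> (cmod (f i) + cmod (g i))\<^sup>2"
      by (intro power_mono norm_triangle_ineq) auto
    also have "\<dots> \<le> 2 * (cmod (f i))\<^sup>2 + 2 * (cmod (g i))\<^sup>2"
      using zero_le_power2[of "cmod (f i) - cmod (g i)"] by (simp add: power2_eq_square algebra_simps)
    finally show ?thesis .
  qed
qed auto

lemma sqs_cmult: "sqs f \<Longrightarrow> sqs (\<lambda>i. c * f i)"
  unfolding sqs_def by (simp add: norm_mult power_mult_distrib summable_on_cmult_right)

lemma sqs_uminus: "sqs f \<Longrightarrow> sqs (\<lambda>i. - f i)"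
  unfolding sqs_def by simp

lemma sqs_diff: "sqs f \<Longrightarrow> sqs g \<Longrightarrow> sqs (\<lambda>i. f i - g i)"
  using sqs_add[of f "\<lambda>i. - g i"] sqs_uminus[of g] by simp

lemma sqs_zero: "sqs (\<lambda>i. 0)"
  unfolding sqs_def by simp

lemma sqs_prod_summable:
  assumes "sqs f" "sqs g"
  shows "(\<lambda>i. cnj (f i) * g i) summable_on UNIV"
proof -
  have "(\<lambda>i. norm (cnj (f i) * g i)) summable_on UNIV"
    by (rule abs_summable_product) (use assms in \<open>simp_all add: sqs_def norm_mult power2_eq_square\<close>)
  then show ?thesis by (rule abs_summable_summable)
qed

subsection \<open>Hilbert tensor powers\<close>

text \<open>With respect to an orthonormal basis \<open>B\<close> of the one-particle space, the Hilbert tensor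
  power of order \<open>n\<close> is realised as the square-summable functions on \<open>B\<^sup>n\<close> (lists of length
  \<open>n\<close> over \<open>B\<close>), and the full Fock space as the square-summable functions on all lists over
  \<open>B\<close>.  The facts \<open>cinner_tens\<close> and \<open>tens_total\<close> below show that this is the
  Hilbert direct sum of the Hilbert tensor powers, independently of \<open>B\<close>; everything
  after them is phrased in terms of elementary tensors.\<close>

definition fock_basis :: "'a::complex_hilbert set" where
  "fock_basis = (SOME B. orthonormal_basis B)"

lemma fock_basis: "orthonormal_basis fock_basis"
  unfolding fock_basis_def by (rule someI_ex[OF ex_orthonormal_basis])

lemma orthonormal_fock_basis: "orthonormal fock_basis"
  using fock_basis unfolding orthonormal_basis_def by blast

typedef (overloaded) 'a fock =
  "{\<psi> :: 'a::complex_hilbert list \<Rightarrow> complex. sqs \<psi> \<and> (\<forall>xs. \<not> set xs \<subseteq> fock_basis \<longrightarrow> \<psi> xs = 0)}"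
  morphisms fock_coeff Abs_fock
  by (rule exI[of _ "\<lambda>_. 0"]) (simp add: sqs_zero)

setup_lifting type_definition_fock

lemma fock_eqI: "(\<And>xs. fock_coeff \<psi> xs = fock_coeff \<phi> xs) \<Longrightarrow> \<psi> = \<phi>"
  by (metis ext fock_coeff_inject)

lemma sqs_fock_coeff: "sqs (fock_coeff \<psi>)"
  using fock_coeff[of \<psi>] by simp

lemma fock_coeff_outside: "\<not> set xs \<subseteq> fock_basis \<Longrightarrow> fock_coeff \<psi> xs = 0"
  using fock_coeff[of \<psi>] by simp

instantiation fock :: (complex_hilbert) real_vector
begin
lift_definition zero_fock :: "'a fock" is "\<lambda>_. 0" by (simp add: sqs_zero)
lift_definition plus_fock :: "'a fock \<Rightarrow> 'a fock \<Rightarrow> 'a fock" is "\<lambda>\<psi> \<phi> xs. \<psi> xs + \<phi> xs"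
  by (simp add: sqs_add)
lift_definition minus_fock :: "'a fock \<Rightarrow> 'a fock \<Rightarrow> 'a fock" is "\<lambda>\<psi> \<phi> xs. \<psi> xs - \<phi> xs"
  by (simp add: sqs_diff)
lift_definition uminus_fock :: "'a fock \<Rightarrow> 'a fock" is "\<lambda>\<psi> xs. - \<psi> xs"
  by (simp add: sqs_uminus)
lift_definition scaleR_fock :: "real \<Rightarrow> 'a fock \<Rightarrow> 'a fock" is
  "\<lambda>r \<psi> xs. complex_of_real r * \<psi> xs"
  by (simp add: sqs_cmult)
instance
  by standard (transfer, simp add: fun_eq_iff algebra_simps)+
end

instantiation fock :: (complex_hilbert) real_inner
begin
definition cinner_fock0 :: "'a fock \<Rightarrow> 'a fock \<Rightarrow> complex" where
  "cinner_fock0 \<psi> \<phi> = (\<Sum>\<^sub>\<infinity>xs. cnj (fock_coeff \<psi> xs) * fock_coeff \<phi> xs)"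
definition inner_fock :: "'a fock \<Rightarrow> 'a fock \<Rightarrow> real" where
  "inner_fock \<psi> \<phi> = Re (cinner_fock0 \<psi> \<phi>)"
definition norm_fock :: "'a fock \<Rightarrow> real" where
  "norm_fock \<psi> = sqrt (inner \<psi> \<psi>)"
definition sgn_fock :: "'a fock \<Rightarrow> 'a fock" where
  "sgn_fock \<psi> = \<psi> /\<^sub>R norm \<psi>"
definition dist_fock :: "'a fock \<Rightarrow> 'a fock \<Rightarrow> real" where
  "dist_fock \<psi> \<phi> = norm (\<psi> - \<phi>)"
definition uniformity_fock :: "('a fock \<times> 'a fock) filter" where
  "uniformity_fock = (INF e\<in>{0<..}. principal {(x, y). dist x y < e})"
definition open_fock :: "'a fock set \<Rightarrow> bool" where
  "open_fock U = (\<forall>x\<in>U. eventually (\<lambda>(x', y). x' = x \<longrightarrow> y \<in> U) uniformity)"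

lemma cinner_fock0_has_sum:
  "((\<lambda>xs. cnj (fock_coeff \<psi> xs) * fock_coeff \<phi> xs) has_sum cinner_fock0 \<psi> \<phi>) UNIV"
  unfolding cinner_fock0_def
  by (rule has_sum_infsum) (rule sqs_prod_summable[OF sqs_fock_coeff sqs_fock_coeff])

lemma inner_fock_has_sum: "((\<lambda>xs. (cmod (fock_coeff \<psi> xs))\<^sup>2) has_sum inner \<psi> \<psi>) UNIV"
  using has_sum_Re[OF cinner_fock0_has_sum[of \<psi> \<psi>]]
  by (simp only: cnj_mult_self inner_fock_def Re_complex_of_real)

lemma cinner_fock0_commute: "cinner_fock0 \<psi> \<phi> = cnj (cinner_fock0 \<phi> \<psi>)"
  unfolding cinner_fock0_def infsum_cnj[symmetric] by (simp add: mult.commute)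

lemma cinner_fock0_add: "cinner_fock0 \<psi> (\<phi> + \<theta>) = cinner_fock0 \<psi> \<phi> + cinner_fock0 \<psi> \<theta>"
proof (rule has_sum_unique[OF cinner_fock0_has_sum])
  show "((\<lambda>xs. cnj (fock_coeff \<psi> xs) * fock_coeff (\<phi> + \<theta>) xs)
      has_sum cinner_fock0 \<psi> \<phi> + cinner_fock0 \<psi> \<theta>) UNIV"
    using has_sum_add[OF cinner_fock0_has_sum[of \<psi> \<phi>] cinner_fock0_has_sum[of \<psi> \<theta>]]
    by (simp add: plus_fock.rep_eq algebra_simps)
qed

lemma cinner_fock0_scaleR: "cinner_fock0 \<psi> (r *\<^sub>R \<phi>) = of_real r * cinner_fock0 \<psi> \<phi>"
  unfolding cinner_fock0_def infsum_cmult_right'[symmetric]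
  by (simp add: scaleR_fock.rep_eq mult.left_commute)

instance
proof
  fix x y z :: "'a fock" and r :: real
  show "dist x y = norm (x - y)" by (rule dist_fock_def)
  show "sgn x = x /\<^sub>R norm x" by (rule sgn_fock_def)
  show "uniformity = (INF e\<in>{0<..}. principal {(x::'a fock, y). dist x y < e})"
    by (rule uniformity_fock_def)
  show "open U = (\<forall>x\<in>U. \<forall>\<^sub>F (x', y) in uniformity. x' = x \<longrightarrow> y \<in> U)" for U :: "'a fock set"
    by (rule open_fock_def)
  show comm: "inner x y = inner y x" for x y :: "'a fock"
    by (simp add: inner_fock_def cinner_fock0_commute[of x y])
  show "inner (x + y) z = inner x z + inner y z"
    by (simp only: comm[of _ z]) (simp add: inner_fock_def cinner_fock0_add)
  show "inner (r *\<^sub>R x) y = r * inner x y"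
    by (simp only: comm[of _ y]) (simp add: inner_fock_def cinner_fock0_scaleR)
  show "0 \<le> inner x x" by (rule has_sum_nonneg[OF inner_fock_has_sum]) auto
  show "inner x x = 0 \<longleftrightarrow> x = 0"
  proof
    assume "inner x x = 0"
    then have "((\<lambda>xs. (cmod (fock_coeff x xs))\<^sup>2) has_sum 0) UNIV"
      using inner_fock_has_sum[of x] by simp
    then have "(cmod (fock_coeff x xs))\<^sup>2 = 0" for xs
      by (rule nonneg_has_sum_le_0D[OF _ order.refl]) auto
    then show "x = 0" by (intro fock_eqI) (simp add: zero_fock.rep_eq)
  next
    assume "x = 0"
    then show "inner x x = 0" by (simp add: inner_fock_def cinner_fock0_def zero_fock.rep_eq)
  qed
  show "norm x = sqrt (inner x x)" by (rule norm_fock_def)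
qed
end

lemma norm_fock_has_sum: "((\<lambda>xs. (cmod (fock_coeff \<psi> xs))\<^sup>2) has_sum (norm \<psi>)\<^sup>2) UNIV"
  using inner_fock_has_sum[of \<psi>] by (simp add: power2_norm_eq_inner)

lemma fock_coeff_sum_le: "finite F \<Longrightarrow> (\<Sum>xs\<in>F. (cmod (fock_coeff \<psi> xs))\<^sup>2) \<le> (norm \<psi>)\<^sup>2"
  by (rule finite_sum_le_has_sum[OF norm_fock_has_sum]) auto

lemma fock_coeff_le: "cmod (fock_coeff \<psi> xs) \<le> norm \<psi>"
  using fock_coeff_sum_le[of "{xs}" \<psi>] by (simp add: power2_le_iff_abs_le)

instance fock :: (complex_hilbert) complete_space
proof
  fix X :: "nat \<Rightarrow> 'a fock"
  assume X: "Cauchy X"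
  have co: "Cauchy (\<lambda>n. fock_coeff (X n) xs)" for xs
  proof (rule CauchyI)
    fix e :: real assume "0 < e"
    then obtain M where M: "\<And>m n. m \<ge> M \<Longrightarrow> n \<ge> M \<Longrightarrow> norm (X m - X n) < e"
      using X CauchyD by blast
    have "norm (fock_coeff (X m) xs - fock_coeff (X n) xs) < e" if "m \<ge> M" "n \<ge> M" for m n
      using fock_coeff_le[of "X m - X n" xs] M[OF that] by (simp add: minus_fock.rep_eq)
    then show "\<exists>M. \<forall>m\<ge>M. \<forall>n\<ge>M. norm (fock_coeff (X m) xs - fock_coeff (X n) xs) < e" by blast
  qed
  define g where "g xs = lim (\<lambda>n. fock_coeff (X n) xs)" for xs
  have g: "(\<lambda>n. fock_coeff (X n) xs) \<longlonglongrightarrow> g xs" for xs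
    unfolding g_def using co[of xs] Cauchy_convergent_iff convergent_LIMSEQ_iff by blast
  have bd: "(\<Sum>xs\<in>F. (cmod (fock_coeff (X m) xs - g xs))\<^sup>2) \<le> e\<^sup>2"
    if F: "finite F" and M: "\<And>m n. m \<ge> M \<Longrightarrow> n \<ge> M \<Longrightarrow> norm (X m - X n) < e" and m: "m \<ge> M" for F M m e
  proof (rule tendsto_upperbound)
    show "(\<lambda>n. \<Sum>xs\<in>F. (cmod (fock_coeff (X m) xs - fock_coeff (X n) xs))\<^sup>2)
        \<longlonglongrightarrow> (\<Sum>xs\<in>F. (cmod (fock_coeff (X m) xs - g xs))\<^sup>2)"
      by (intro tendsto_intros g)
    show "\<forall>\<^sub>F n in sequentially. (\<Sum>xs\<in>F. (cmod (fock_coeff (X m) xs - fock_coeff (X n) xs))\<^sup>2) \<le> e\<^sup>2"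
      unfolding eventually_sequentially
    proof (intro exI allI impI)
      fix n assume n: "M \<le> n"
      have "(\<Sum>xs\<in>F. (cmod (fock_coeff (X m) xs - fock_coeff (X n) xs))\<^sup>2) \<le> (norm (X m - X n))\<^sup>2"
        using fock_coeff_sum_le[OF F, of "X m - X n"] by (simp add: minus_fock.rep_eq)
      also have "\<dots> \<le> e\<^sup>2" using M[OF m n] by (intro power_mono) auto
      finally show "(\<Sum>xs\<in>F. (cmod (fock_coeff (X m) xs - fock_coeff (X n) xs))\<^sup>2) \<le> e\<^sup>2" .
    qed
  qed simp
  have sq: "sqs (\<lambda>xs. fock_coeff (X m) xs - g xs)"
    if M: "\<And>m n. m \<ge> M \<Longrightarrow> n \<ge> M \<Longrightarrow> norm (X m - X n) < e" and m: "m \<ge> M" for M m e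
    unfolding sqs_def
    by (rule nonneg_bdd_above_summable_on) (use bd[OF _ M m] in \<open>auto intro!: bdd_aboveI2[where M="e\<^sup>2"]\<close>)
  obtain M1 where M1: "\<And>m n. m \<ge> M1 \<Longrightarrow> n \<ge> M1 \<Longrightarrow> norm (X m - X n) < 1"
    using X CauchyD[of X 1] by auto
  have "sqs g"
    using sqs_diff[OF sqs_fock_coeff[of "X M1"] sq[of M1 1 M1, OF M1]] by simp
  moreover have "g xs = 0" if "\<not> set xs \<subseteq> fock_basis" for xs
    using g[of xs] fock_coeff_outside[OF that] by (simp add: LIMSEQ_const_iff)
  ultimately have L: "fock_coeff (Abs_fock g) = g" by (intro Abs_fock_inverse) simp
  have "X \<longlonglongrightarrow> Abs_fock g"
  proof (rule LIMSEQ_I)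
    fix r :: real assume r: "0 < r"
    then obtain M where M: "\<And>m n. m \<ge> M \<Longrightarrow> n \<ge> M \<Longrightarrow> norm (X m - X n) < r/2"
      using X CauchyD[of X "r/2"] by auto
    have "norm (X m - Abs_fock g) < r" if m: "m \<ge> M" for m
    proof -
      have "(norm (X m - Abs_fock g))\<^sup>2 \<le> (r/2)\<^sup>2"
        by (rule has_sum_le_finite_sums[OF norm_fock_has_sum])
          (use bd[OF _ M m] in \<open>simp add: minus_fock.rep_eq L\<close>)
      then have "norm (X m - Abs_fock g) \<le> r/2" using r by (simp add: power2_le_iff_abs_le)
      then show ?thesis using r by simp
    qed
    then show "\<exists>no. \<forall>n\<ge>no. norm (X n - Abs_fock g) < r" by blast
  qed
  then show "convergent X" by (rule convergentI)
qed

instantiation fock :: (complex_hilbert) complex_hilbert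
begin
lift_definition scaleC_fock :: "complex \<Rightarrow> 'a fock \<Rightarrow> 'a fock" is "\<lambda>\<alpha> \<psi> xs. \<alpha> * \<psi> xs"
  by (simp add: sqs_cmult)
definition cinner_fock :: "'a fock \<Rightarrow> 'a fock \<Rightarrow> complex" where
  "cinner_fock = cinner_fock0"
instance
proof
  fix x y z :: "'a fock" and \<alpha> \<beta> :: complex and r :: real
  show "\<alpha> *\<^sub>C (x + y) = \<alpha> *\<^sub>C x + \<alpha> *\<^sub>C y" by transfer (simp add: fun_eq_iff algebra_simps)
  show "(\<alpha> + \<beta>) *\<^sub>C x = \<alpha> *\<^sub>C x + \<beta> *\<^sub>C x" by transfer (simp add: fun_eq_iff algebra_simps)
  show "\<alpha> *\<^sub>C \<beta> *\<^sub>C x = (\<alpha> * \<beta>) *\<^sub>C x" by transfer (simp add: fun_eq_iff algebra_simps)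
  show "r *\<^sub>R x = complex_of_real r *\<^sub>C x" by transfer simp
  show "cinner x y = cnj (cinner y x)" unfolding cinner_fock_def by (rule cinner_fock0_commute)
  show "cinner x (y + z) = cinner x y + cinner x z"
    unfolding cinner_fock_def by (rule cinner_fock0_add)
  show "cinner x (\<alpha> *\<^sub>C y) = \<alpha> * cinner x y"
    unfolding cinner_fock_def cinner_fock0_def infsum_cmult_right'[symmetric]
    by (simp add: scaleC_fock.rep_eq mult.left_commute)
  show "inner x y = Re (cinner x y)" by (simp add: cinner_fock_def inner_fock_def)
qed
end

lemma cinner_fock_has_sum:
  "((\<lambda>xs. cnj (fock_coeff \<psi> xs) * fock_coeff \<phi> xs) has_sum cinner \<psi> \<phi>) UNIV"
  unfolding cinner_fock_def by (rule cinner_fock0_has_sum)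

text \<open>\<open>tensor f \<psi>\<close> is \<open>f \<otimes> \<psi>\<close>: its coefficient at \<open>b \<otimes> e\<close> is \<open>\<langle>b, f\<rangle> \<langle>e, \<psi>\<rangle>\<close>.\<close>

lift_definition tensor :: "'a::complex_hilbert \<Rightarrow> 'a fock \<Rightarrow> 'a fock" is
  "\<lambda>f \<psi> xs. case xs of [] \<Rightarrow> 0 | b # ys \<Rightarrow> if b \<in> fock_basis then cinner b f * \<psi> ys else 0"
proof -
  fix f :: 'a and \<psi> :: "'a list \<Rightarrow> complex"
  assume \<psi>: "sqs \<psi> \<and> (\<forall>xs. \<not> set xs \<subseteq> fock_basis \<longrightarrow> \<psi> xs = 0)"
  let ?h = "\<lambda>xs. case xs of [] \<Rightarrow> 0 | b # ys \<Rightarrow> if b \<in> fock_basis then cinner b f * \<psi> ys else 0"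
  have 1: "(\<lambda>xs. (cmod (?h xs))\<^sup>2) summable_on (\<lambda>(b, ys). b # ys) ` (fock_basis \<times> UNIV)"
  proof (subst summable_on_reindex)
    have "(\<lambda>(b::'a, ys). (cmod (cinner b f))\<^sup>2 * (cmod (\<psi> ys))\<^sup>2) summable_on fock_basis \<times> UNIV"
    proof (rule summable_on_SigmaI)
      show "((\<lambda>ys. case (b, ys) of (b, ys) \<Rightarrow> (cmod (cinner b f))\<^sup>2 * (cmod (\<psi> ys))\<^sup>2) has_sum
          (cmod (cinner b f))\<^sup>2 * (\<Sum>\<^sub>\<infinity>ys. (cmod (\<psi> ys))\<^sup>2)) UNIV" for b
        using \<psi> by (auto simp: sqs_def intro!: has_sum_cmult_right has_sum_infsum)
      show "(\<lambda>b. (cmod (cinner b f))\<^sup>2 * (\<Sum>\<^sub>\<infinity>ys. (cmod (\<psi> ys))\<^sup>2)) summable_on fock_basis"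
        by (intro summable_on_cmult_left bessel_summable orthonormal_fock_basis)
    qed auto
    then show "((\<lambda>xs. (cmod (?h xs))\<^sup>2) \<circ> (\<lambda>(b, ys). b # ys)) summable_on fock_basis \<times> UNIV"
      by (rule summable_on_cong[THEN iffD1, rotated]) (auto simp: norm_mult power_mult_distrib)
  qed (auto simp: inj_on_def)
  have "sqs ?h"
    unfolding sqs_def
    by (rule summable_on_cong_neutral[THEN iffD1, OF _ _ _ 1]) (auto split: list.splits)
  then show "sqs ?h \<and> (\<forall>xs. \<not> set xs \<subseteq> fock_basis \<longrightarrow> ?h xs = 0)"
    using \<psi> by (auto split: list.splits)
qed

lift_definition fock_vacuum :: "'a::complex_hilbert fock" is "\<lambda>xs. if xs = [] then 1 else 0"
proof -
  have "(\<lambda>xs::'a list. (cmod (if xs = [] then 1 else 0))\<^sup>2) summable_on UNIV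
      \<longleftrightarrow> (\<lambda>xs::'a list. (cmod (if xs = [] then 1 else 0))\<^sup>2) summable_on {[]}"
    by (rule summable_on_cong_neutral) auto
  then show "sqs (\<lambda>xs::'a list. if xs = [] then 1 else 0) \<and>
      (\<forall>xs. \<not> set xs \<subseteq> (fock_basis::'a set) \<longrightarrow> (if xs = [] then 1 else 0::complex) = 0)"
    by (auto simp: sqs_def)
qed

definition tens :: "'a::complex_hilbert list \<Rightarrow> 'a fock" where
  "tens xs = foldr tensor xs fock_vacuum"

lemma tens_Nil [simp]: "tens [] = fock_vacuum" and tens_Cons [simp]: "tens (x # xs) = tensor x (tens xs)"
  by (simp_all add: tens_def)

lemma fock_coeff_tensor_Nil [simp]: "fock_coeff (tensor f \<psi>) [] = 0"
  by transfer simp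

lemma fock_coeff_tensor_Cons [simp]:
  "fock_coeff (tensor f \<psi>) (b # ys) = (if b \<in> fock_basis then cinner b f * fock_coeff \<psi> ys else 0)"
  by transfer simp

lemma cinner_vacuum: "cinner fock_vacuum \<psi> = fock_coeff \<psi> []"
proof (rule has_sum_unique[OF cinner_fock_has_sum])
  show "((\<lambda>xs. cnj (fock_coeff fock_vacuum xs) * fock_coeff \<psi> xs) has_sum fock_coeff \<psi> []) UNIV"
    by (rule has_sum_finite_neutralI[where B="{[]}"]) (auto simp: fock_vacuum.rep_eq)
qed

lemma cinner_tensor: "cinner (tensor f \<psi>) (tensor g \<phi>) = cinner f g * cinner \<psi> \<phi>"
proof (rule has_sum_unique[OF cinner_fock_has_sum])
  let ?h = "\<lambda>xs. cnj (fock_coeff (tensor f \<psi>) xs) * fock_coeff (tensor g \<phi>) xs"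
  let ?c = "\<lambda>(b::'a, ys::'a list). b # ys"
  have inj: "inj_on ?c (fock_basis \<times> UNIV)" by (auto simp: inj_on_def)
  have neutral: "(?h has_sum S) UNIV \<longleftrightarrow> (?h has_sum S) (?c ` (fock_basis \<times> UNIV))" for S
  proof (rule has_sum_cong_neutral)
    fix xs :: "'a list" assume xs: "xs \<in> UNIV - ?c ` (fock_basis \<times> UNIV)"
    show "?h xs = 0"
    proof (cases xs)
      case (Cons b ys)
      then have "b \<notin> fock_basis" using xs by auto
      then show ?thesis by (simp add: Cons)
    qed simp
  qed auto
  have "(?h has_sum cinner (tensor f \<psi>) (tensor g \<phi>)) UNIV" by (rule cinner_fock_has_sum)
  then have "(?h \<circ> ?c has_sum cinner (tensor f \<psi>) (tensor g \<phi>)) (fock_basis \<times> UNIV)"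
    unfolding neutral by (subst (asm) has_sum_reindex[OF inj])
  then have summ: "?h \<circ> ?c summable_on (fock_basis \<times> UNIV)" by (auto simp: summable_on_def)
  have "(?h \<circ> ?c has_sum cinner f g * cinner \<psi> \<phi>) (fock_basis \<times> UNIV)"
  proof (rule has_sum_SigmaI[OF _ _ summ])
    fix b :: 'a assume b: "b \<in> fock_basis"
    have "((\<lambda>ys. (cnj (cinner b f) * cinner b g) * (cnj (fock_coeff \<psi> ys) * fock_coeff \<phi> ys))
        has_sum (cnj (cinner b f) * cinner b g) * cinner \<psi> \<phi>) UNIV"
      by (rule has_sum_cmult_right[OF cinner_fock_has_sum])
    then show "((\<lambda>ys. (?h \<circ> ?c) (b, ys)) has_sum (cnj (cinner b f) * cinner b g) * cinner \<psi> \<phi>) UNIV"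
      using b by (simp add: mult_ac)
  next
    show "((\<lambda>b. cnj (cinner b f) * cinner b g * cinner \<psi> \<phi>) has_sum cinner f g * cinner \<psi> \<phi>) fock_basis"
      by (rule has_sum_cmult_left[OF parseval[OF fock_basis]])
  qed
  then show "(?h has_sum cinner f g * cinner \<psi> \<phi>) UNIV"
    unfolding neutral by (subst has_sum_reindex[OF inj])
qed

theorem cinner_tens:
  "cinner (tens xs) (tens ys) =
    (if length xs = length ys then \<Prod>i<length xs. cinner (xs ! i) (ys ! i) else 0)"
proof (induction xs arbitrary: ys)
  case Nil
  then show ?case
    by (cases ys) (simp_all add: cinner_vacuum fock_vacuum.rep_eq)
next
  case (Cons x xs)
  show ?case
  proof (cases ys)
    case Nil
    then show ?thesis
      using cinner_commute[of "tensor x (tens xs)" fock_vacuum] by (simp add: cinner_vacuum)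
  next
    case (Cons y ys')
    then show ?thesis
      by (simp add: cinner_tensor Cons.IH prod.lessThan_Suc_shift del: prod.lessThan_Suc)
  qed
qed

lemma fock_coeff_tens_basis:
  "set xs \<subseteq> fock_basis \<Longrightarrow> fock_coeff (tens xs) ys = (if ys = xs then 1 else 0)"
proof (induction xs arbitrary: ys)
  case Nil
  then show ?case by (simp add: fock_vacuum.rep_eq)
next
  case (Cons x xs)
  have "cinner b x = (if b = x then 1 else 0)" if "b \<in> fock_basis" for b
    using orthonormal_fock_basis that Cons.prems unfolding orthonormal_def by (metis list.set_intros(1) subsetD)
  with Cons show ?case by (cases ys) auto
qed

lemma cinner_tens_basis: "set xs \<subseteq> fock_basis \<Longrightarrow> cinner (tens xs) \<psi> = fock_coeff \<psi> xs"
proof (rule has_sum_unique[OF cinner_fock_has_sum])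
  assume xs: "set xs \<subseteq> fock_basis"
  show "((\<lambda>ys. cnj (fock_coeff (tens xs) ys) * fock_coeff \<psi> ys) has_sum fock_coeff \<psi> xs) UNIV"
    by (rule has_sum_finite_neutralI[where B="{xs}"]) (auto simp: fock_coeff_tens_basis[OF xs])
qed

theorem tens_total:
  assumes "\<And>xs. cinner (tens xs) \<psi> = 0"
  shows "\<psi> = 0"
proof (rule fock_eqI)
  show "fock_coeff \<psi> xs = fock_coeff 0 xs" for xs
    using cinner_tens_basis[of xs \<psi>] fock_coeff_outside[of xs \<psi>] assms[of xs]
    by (cases "set xs \<subseteq> fock_basis") (simp_all add: zero_fock.rep_eq)
qed

definition fock_comp :: "nat \<Rightarrow> 'a::complex_hilbert fock \<Rightarrow> 'a fock" where
  "fock_comp n \<psi> = Abs_fock (\<lambda>xs. if length xs = n then fock_coeff \<psi> xs else 0)"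

lemma fock_coeff_comp:
  "fock_coeff (fock_comp n \<psi>) xs = (if length xs = n then fock_coeff \<psi> xs else 0)"
proof -
  have "sqs (\<lambda>xs. if length xs = n then fock_coeff \<psi> xs else 0)"
    unfolding sqs_def
  proof (rule summable_on_comparison_test[where f="\<lambda>xs. (cmod (fock_coeff \<psi> xs))\<^sup>2"])
    show "(\<lambda>xs. (cmod (fock_coeff \<psi> xs))\<^sup>2) summable_on UNIV"
      using sqs_fock_coeff by (simp add: sqs_def)
  qed simp_all
  then show ?thesis
    unfolding fock_comp_def by (subst Abs_fock_inverse) (auto simp: fock_coeff_outside)
qed

section \<open>The symmetric Fock space\<close>

text \<open>Since \<open>\<langle>x\<^sub>1 \<otimes> \<dots> \<otimes> x\<^sub>n, \<psi>\<rangle>\<close> determines the \<open>n\<close>-particle component of \<open>\<psi>\<close>, the following is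
  invariance of every component under all permutations of the tensor factors.\<close>

definition is_symmetric :: "'a::complex_hilbert fock \<Rightarrow> bool" where
  "is_symmetric \<psi> \<longleftrightarrow> (\<forall>xs ys. mset xs = mset ys \<longrightarrow> cinner (tens xs) \<psi> = cinner (tens ys) \<psi>)"

definition sym_tensors :: "nat \<Rightarrow> 'a::complex_hilbert fock set" where
  "sym_tensors n = {\<psi>. is_symmetric \<psi> \<and> fock_comp n \<psi> = \<psi>}"

lemma is_symmetricI:
  "(\<And>xs ys. mset xs = mset ys \<Longrightarrow> cinner (tens xs) \<psi> = cinner (tens ys) \<psi>) \<Longrightarrow> is_symmetric \<psi>"
  unfolding is_symmetric_def by blast

lemma is_symmetricD:
  "is_symmetric \<psi> \<Longrightarrow> mset xs = mset ys \<Longrightarrow> cinner (tens xs) \<psi> = cinner (tens ys) \<psi>"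
  unfolding is_symmetric_def by blast

lemma symmetric_zero: "is_symmetric 0"
  by (rule is_symmetricI) (simp only: cinner_zero_right)

lemma symmetric_add: "is_symmetric \<psi> \<Longrightarrow> is_symmetric \<phi> \<Longrightarrow> is_symmetric (\<psi> + \<phi>)"
  by (rule is_symmetricI) (metis cinner_add_right is_symmetricD)

lemma symmetric_diff: "is_symmetric \<psi> \<Longrightarrow> is_symmetric \<phi> \<Longrightarrow> is_symmetric (\<psi> - \<phi>)"
  by (rule is_symmetricI) (metis cinner_diff_right is_symmetricD)

lemma symmetric_scaleC: "is_symmetric \<psi> \<Longrightarrow> is_symmetric (\<alpha> *\<^sub>C \<psi>)"
  by (rule is_symmetricI) (metis cinner_scaleC_right is_symmetricD)

lemma symmetric_uminus: "is_symmetric \<psi> \<Longrightarrow> is_symmetric (- \<psi>)"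
  using symmetric_diff[OF symmetric_zero, of \<psi>] by (simp only: diff_0)

lemma symmetric_scaleR: "is_symmetric \<psi> \<Longrightarrow> is_symmetric (r *\<^sub>R \<psi>)"
  unfolding scaleR_scaleC by (rule symmetric_scaleC)

typedef (overloaded) 'a sfock = "{\<psi> :: 'a::complex_hilbert fock. is_symmetric \<psi>}"
  morphisms fock_of Abs_sfock
  by (rule exI[of _ 0], rule CollectI, rule symmetric_zero)

setup_lifting type_definition_sfock

instantiation sfock :: (complex_hilbert) real_vector
begin
lift_definition zero_sfock :: "'a sfock" is 0 by (rule symmetric_zero)
lift_definition plus_sfock :: "'a sfock \<Rightarrow> 'a sfock \<Rightarrow> 'a sfock" is "(+)" by (rule symmetric_add)
lift_definition minus_sfock :: "'a sfock \<Rightarrow> 'a sfock \<Rightarrow> 'a sfock" is "(-)" by (rule symmetric_diff)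
lift_definition uminus_sfock :: "'a sfock \<Rightarrow> 'a sfock" is uminus
  by (rule symmetric_uminus)
lift_definition scaleR_sfock :: "real \<Rightarrow> 'a sfock \<Rightarrow> 'a sfock" is scaleR
  by (rule symmetric_scaleR)
instance
  by standard (transfer, simp add: algebra_simps)+
end

instantiation sfock :: (complex_hilbert) real_inner
begin
lift_definition inner_sfock :: "'a sfock \<Rightarrow> 'a sfock \<Rightarrow> real" is inner .
lift_definition norm_sfock :: "'a sfock \<Rightarrow> real" is norm .
definition sgn_sfock :: "'a sfock \<Rightarrow> 'a sfock" where
  "sgn_sfock \<psi> = \<psi> /\<^sub>R norm \<psi>"
definition dist_sfock :: "'a sfock \<Rightarrow> 'a sfock \<Rightarrow> real" where
  "dist_sfock \<psi> \<phi> = norm (\<psi> - \<phi>)"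
definition uniformity_sfock :: "('a sfock \<times> 'a sfock) filter" where
  "uniformity_sfock = (INF e\<in>{0<..}. principal {(x, y). dist x y < e})"
definition open_sfock :: "'a sfock set \<Rightarrow> bool" where
  "open_sfock U = (\<forall>x\<in>U. eventually (\<lambda>(x', y). x' = x \<longrightarrow> y \<in> U) uniformity)"
instance
proof
  fix x y z :: "'a sfock" and r :: real
  show "dist x y = norm (x - y)" by (rule dist_sfock_def)
  show "sgn x = x /\<^sub>R norm x" by (rule sgn_sfock_def)
  show "uniformity = (INF e\<in>{0<..}. principal {(x::'a sfock, y). dist x y < e})"
    by (rule uniformity_sfock_def)
  show "open U = (\<forall>x\<in>U. \<forall>\<^sub>F (x', y) in uniformity. x' = x \<longrightarrow> y \<in> U)" for U :: "'a sfock set"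
    by (rule open_sfock_def)
  show "inner x y = inner y x" by transfer (rule inner_commute)
  show "inner (x + y) z = inner x z + inner y z" by transfer (rule inner_add_left)
  show "inner (r *\<^sub>R x) y = r * inner x y" by transfer simp
  show "0 \<le> inner x x" by transfer simp
  show "inner x x = 0 \<longleftrightarrow> x = 0" by transfer simp
  show "norm x = sqrt (inner x x)" by transfer (rule norm_eq_sqrt_inner)
qed
end

lemma dist_sfock: "dist \<psi> \<phi> = dist (fock_of \<psi>) (fock_of \<phi>)"
  by (simp add: dist_sfock_def dist_norm norm_sfock.rep_eq minus_sfock.rep_eq)

lemma closed_symmetric: "closed {\<psi> :: 'a::complex_hilbert fock. is_symmetric \<psi>}"
proof -
  have "continuous_on UNIV (cinner \<psi>)" for \<psi> :: "'a fock"
    using bounded_linear_cinner_right linear_continuous_on by blast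
  then show ?thesis
    unfolding is_symmetric_def by (intro closed_Collect_all closed_Collect_imp closed_Collect_eq) auto
qed

instance sfock :: (complex_hilbert) complete_space
proof
  fix X :: "nat \<Rightarrow> 'a sfock"
  assume "Cauchy X"
  then have "Cauchy (\<lambda>n. fock_of (X n))" by (simp add: Cauchy_def dist_sfock)
  then obtain L where L: "(\<lambda>n. fock_of (X n)) \<longlonglongrightarrow> L"
    using Cauchy_convergent convergent_def by blast
  have "is_symmetric L"
    using closed_sequentially[OF closed_symmetric _ L] fock_of by blast
  then have "fock_of (Abs_sfock L) = L" by (simp add: Abs_sfock_inverse)
  then have "X \<longlonglongrightarrow> Abs_sfock L" using L by (simp add: tendsto_iff dist_sfock)
  then show "convergent X" by (rule convergentI)
qed

instantiation sfock :: (complex_hilbert) complex_hilbert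
begin
lift_definition scaleC_sfock :: "complex \<Rightarrow> 'a sfock \<Rightarrow> 'a sfock" is scaleC
  by (rule symmetric_scaleC)
lift_definition cinner_sfock :: "'a sfock \<Rightarrow> 'a sfock \<Rightarrow> complex" is cinner .
instance
proof
  fix x y z :: "'a sfock" and \<alpha> \<beta> :: complex and r :: real
  show "\<alpha> *\<^sub>C (x + y) = \<alpha> *\<^sub>C x + \<alpha> *\<^sub>C y" by transfer (rule scaleC_add_right)
  show "(\<alpha> + \<beta>) *\<^sub>C x = \<alpha> *\<^sub>C x + \<beta> *\<^sub>C x" by transfer (rule scaleC_add_left)
  show "\<alpha> *\<^sub>C \<beta> *\<^sub>C x = (\<alpha> * \<beta>) *\<^sub>C x" by transfer (rule scaleC_scaleC)
  show "r *\<^sub>R x = complex_of_real r *\<^sub>C x" by transfer (rule scaleR_scaleC)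
  show "cinner x y = cnj (cinner y x)" by transfer (rule cinner_commute)
  show "cinner x (y + z) = cinner x y + cinner x z" by transfer (rule cinner_add_right)
  show "cinner x (\<alpha> *\<^sub>C y) = \<alpha> * cinner x y" by transfer (rule cinner_scaleC_right)
  show "inner x y = Re (cinner x y)" by transfer (rule inner_cinner)
qed
end

lift_definition vacuum :: "'a::complex_hilbert sfock" is fock_vacuum
proof (rule is_symmetricI)
  fix xs ys :: "'a list" assume "mset xs = mset ys"
  then have "length xs = length ys" by (rule mset_eq_length)
  then show "cinner (tens xs) fock_vacuum = cinner (tens ys) fock_vacuum"
    using cinner_tens[of xs "[]"] cinner_tens[of ys "[]"] by simp
qed

text \<open>The \<open>n\<close>-particle component \<open>\<psi>\<^sup>(\<^sup>n\<^sup>)\<close>, as an element of the full Fock space.\<close>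

abbreviation sfock_comp :: "nat \<Rightarrow> 'a::complex_hilbert sfock \<Rightarrow> 'a fock" where
  "sfock_comp n \<psi> \<equiv> fock_comp n (fock_of \<psi>)"

section \<open>Unbounded operators\<close>

text \<open>A possibly unbounded, partially defined operator is represented by its graph.  The domain of
  \<open>A\<close> is \<open>Domain A\<close>, and the closure of a closable operator is the topological closure
  of its graph.\<close>

type_synonym 'a operator = "('a \<times> 'a) set"

definition app :: "'a operator \<Rightarrow> 'a \<Rightarrow> 'a" where
  "app A x = (THE y. (x, y) \<in> A)"

definition adjoint_op :: "'a::complex_hilbert operator \<Rightarrow> 'a operator" where
  "adjoint_op A = {(\<phi>, \<eta>). \<forall>(\<psi>, \<theta>)\<in>A. cinner \<phi> \<theta> = cinner \<eta> \<psi>}"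

definition orth_proj :: "'a::complex_hilbert set \<Rightarrow> 'a \<Rightarrow> 'a" where
  "orth_proj M x = (THE p. p \<in> M \<and> (\<forall>m\<in>M. cinner m (x - p) = 0))"

definition unitary :: "('a::complex_hilbert \<Rightarrow> 'a) \<Rightarrow> bool" where
  "unitary U \<longleftrightarrow> (\<forall>x y. U (x + y) = U x + U y) \<and> (\<forall>\<alpha> x. U (\<alpha> *\<^sub>C x) = \<alpha> *\<^sub>C U x)
    \<and> (\<forall>x. norm (U x) = norm x) \<and> surj U"

definition unitary_group :: "(real \<Rightarrow> 'a::complex_hilbert \<Rightarrow> 'a) \<Rightarrow> bool" where
  "unitary_group U \<longleftrightarrow> (\<forall>t. unitary (U t)) \<and> (\<forall>s t x. U (s + t) x = U s (U t x))
    \<and> (\<forall>x. continuous_on UNIV (\<lambda>t. U t x))"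

text \<open>For self-adjoint \<open>A\<close>, Stone's theorem defines \<open>(e\<^sup>i\<^sup>t\<^sup>A)\<^sub>t\<close> as the strongly continuous unitary
  group with generator \<open>A\<close>.  It suffices to require that the generator extends \<open>A\<close>: being
  self-adjoint as well, it then equals \<open>A\<close>.\<close>

definition exp_i :: "'a::complex_hilbert operator \<Rightarrow> 'a \<Rightarrow> 'a" where
  "exp_i A = (THE U. unitary_group U \<and>
    (\<forall>(x, y)\<in>A. ((\<lambda>t. U t x) has_vector_derivative \<i> *\<^sub>C y) (at 0))) 1"

section \<open>Second quantisation with parameter \<open>\<epsilon>\<close>\<close>

definition finite_particle :: "'a::complex_hilbert sfock \<Rightarrow> bool" where
  "finite_particle \<psi> \<longleftrightarrow> (\<exists>m. \<forall>n>m. sfock_comp n \<psi> = 0)"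

definition creation :: "real \<Rightarrow> 'a::complex_hilbert \<Rightarrow> 'a sfock operator" where
  "creation \<epsilon> f = {(\<psi>, \<phi>). finite_particle \<psi> \<and> sfock_comp 0 \<phi> = 0 \<and>
    (\<forall>n. sfock_comp (n + 1) \<phi> = complex_of_real (sqrt (\<epsilon> * real (n + 1))) *\<^sub>C
      orth_proj (sym_tensors (n + 1)) (tensor f (sfock_comp n \<psi>)))}"

definition annihilation :: "real \<Rightarrow> 'a::complex_hilbert \<Rightarrow> 'a sfock operator" where
  "annihilation \<epsilon> f = adjoint_op (creation \<epsilon> f)"

text \<open>The finite-particle vectors are a core of the self-adjoint field operator
  \<open>\<Phi>\<^sub>s(f) = (a\<^sup>*(f) + a(f)) / \<surd>2\<close>.\<close>

definition field_op :: "real \<Rightarrow> 'a::complex_hilbert \<Rightarrow> 'a sfock operator" where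
  "field_op \<epsilon> f = closure {(\<psi>, (1 / sqrt 2) *\<^sub>R (\<theta> + \<eta>)) | \<psi> \<theta> \<eta>.
    (\<psi>, \<theta>) \<in> creation \<epsilon> f \<and> (\<psi>, \<eta>) \<in> annihilation \<epsilon> f}"

definition weyl :: "real \<Rightarrow> 'a::complex_hilbert \<Rightarrow> 'a sfock \<Rightarrow> 'a sfock" where
  "weyl \<epsilon> f = exp_i (field_op \<epsilon> f)"

text \<open>\<open>Gamma_op r\<close> is \<open>\<Gamma>(r)\<close>, and \<open>number_fun \<epsilon> g\<close> is \<open>g(N)\<close>, where \<open>N\<close> acts as \<open>\<epsilon> n\<close> on the
  \<open>n\<close>-particle space; both with their maximal domains.\<close>

definition Gamma_op :: "real \<Rightarrow> 'a::complex_hilbert sfock operator" where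
  "Gamma_op r = {(\<psi>, \<phi>). \<forall>n. sfock_comp n \<phi> = complex_of_real (r ^ n) *\<^sub>C sfock_comp n \<psi>}"

definition number_fun :: "real \<Rightarrow> (real \<Rightarrow> complex) \<Rightarrow> 'a::complex_hilbert sfock operator" where
  "number_fun \<epsilon> g = {(\<psi>, \<phi>). \<forall>n. sfock_comp n \<phi> = g (\<epsilon> * real n) *\<^sub>C sfock_comp n \<psi>}"

definition conjugation :: "('a::complex_hilbert \<Rightarrow> 'a) \<Rightarrow> bool" where
  "conjugation c \<longleftrightarrow> (\<forall>x y. c (x + y) = c x + c y) \<and> (\<forall>\<alpha> x. c (\<alpha> *\<^sub>C x) = cnj \<alpha> *\<^sub>C c x)
    \<and> (\<forall>x. c (c x) = x) \<and> (\<forall>x. norm (c x) = norm x)"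

text \<open>\<open>F_Wick \<epsilon> c V\<close> is the closure of the linear extension of
  \<open>W(\<phi>) \<Omega> \<mapsto> W(\<phi>) \<Gamma>(\<surd>\<epsilon>) V\<close>, \<open>\<phi>\<close> real.\<close>

definition F_Wick ::
    "real \<Rightarrow> ('a::complex_hilbert \<Rightarrow> 'a) \<Rightarrow> 'a sfock \<Rightarrow> 'a sfock operator" where
  "F_Wick \<epsilon> c V = closure
    {(\<Sum>\<phi>\<in>A. \<alpha> \<phi> *\<^sub>C weyl \<epsilon> \<phi> vacuum,
      \<Sum>\<phi>\<in>A. \<alpha> \<phi> *\<^sub>C weyl \<epsilon> \<phi> (app (Gamma_op (sqrt \<epsilon>)) V)) | A \<alpha>.
      finite A \<and> A \<subseteq> {\<phi>. c \<phi> = \<phi>}}"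

end

(* In the Wiener chaos picture the Wick operator is multiplication by v, the image of V under
   Gamma(sqrt eps), so eps scales away and the claim is an estimate for products of chaos
   components.  The product formula with contractions turns <w, v psi> into a sum of trilinear
   forms, each bounded by the norms of the three components it involves, with squared combinatorial
   coefficients summing to at most (3 m)^n for v of degree n and psi of degree m >= 1.  Two
   applications of Cauchy-Schwarz, the second against 1/m^2 (this is what the shift in a_{n+2}
   pays for), give the bound; only psi of degree 0 contributes to the term |v| |psi|.

   The weights force v to decay faster than every exponential.  Hence the trilinear form is bounded
   in psi for w in the span of the exponential vectors, which makes the operator closable, and it is
   bounded in w for psi with finitely many particles, which puts such psi in the domain of the closure.

   On exponential vectors everything is explicit: the Weyl operators act as displacements, which are
   isometries because they preserve Gram matrices, and they form the only unitary group whose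
   generator extends the field operator. *)
theory Submission
  imports Defs "HOL-Complex_Analysis.Cauchy_Integral_Formula"
begin

section \<open>Complex Hilbert spaces\<close>

text \<open>The operator enters only through its matrix elements. For real \<phi> the Weyl operator
  is the displacement by u = i sqrt(\<epsilon>/2) \<phi>, and c u = - u. Multiplication by the Wick
  exponential of u, read on the left vector, turns expv h into a multiple of expv (h + c u) = expv
  (h - u), which is also what the adjoint displacement does; this sign is why the two descriptions
  of the operator agree on the generators.

  A contraction is bilinear while the inner product is sesquilinear, so the form is written in
  coefficients with respect to an orthonormal basis of real vectors, where conjugating a coefficient
  amounts to applying c.

  A term of the form has indices i, l, j, and its three arguments are seen in degrees i + j, i + l
  and l + j. Any two of these degrees add up to at least i + l + j, so exponential decay of two
  arguments makes everything absolutely convergent while the third enters by its norm alone. With v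
  always decaying, the third argument is psi for closability and w for the domain.\<close>

lemma scaleC_zero_left [simp]: "0 *\<^sub>C (x::'a::complex_hilbert) = 0"
  using norm_scaleC[of 0 x] by simp

lemma scaleC_zero_right [simp]: "\<alpha> *\<^sub>C (0::'a::complex_hilbert) = 0"
  using norm_scaleC[of \<alpha> "0::'a"] by simp

lemma scaleC_one [simp]: "1 *\<^sub>C (x::'a::complex_hilbert) = x"
  using scaleR_scaleC[of 1 x] by simp

lemma scaleC_minus_one: "(-1) *\<^sub>C (x::'a::complex_hilbert) = - x"
  using scaleR_scaleC[of "-1" x] by simp

lemma scaleC_minus_left: "(- \<alpha>) *\<^sub>C (x::'a::complex_hilbert) = - (\<alpha> *\<^sub>C x)"
  using scaleC_scaleC[of "-1" \<alpha> x] by (simp add: scaleC_minus_one)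

lemma scaleC_minus_right: "\<alpha> *\<^sub>C (- x::'a::complex_hilbert) = - (\<alpha> *\<^sub>C x)"
  using scaleC_add_right[of \<alpha> x "-x"] by (simp add: eq_neg_iff_add_eq_0 add.commute)

lemma scaleC_diff_right: "\<alpha> *\<^sub>C (x - y::'a::complex_hilbert) = \<alpha> *\<^sub>C x - \<alpha> *\<^sub>C y"
  using scaleC_add_right[of \<alpha> x "-y"] by (simp add: scaleC_minus_right)

lemma scaleC_sum_right: "\<alpha> *\<^sub>C (\<Sum>i\<in>A. f i :: 'a::complex_hilbert) = (\<Sum>i\<in>A. \<alpha> *\<^sub>C f i)"
  by (induction A rule: infinite_finite_induct) (simp_all add: scaleC_add_right)

lemma cinner_diff_left: "cinner (x - y) (z::'a::complex_hilbert) = cinner x z - cinner y z"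
  by (metis cinner_commute cinner_diff_right complex_cnj_diff)

lemma cinner_minus_right: "cinner x (- z::'a::complex_hilbert) = - cinner x z"
  using cinner_diff_right[of x 0 z] by simp

text \<open>Reduces continuity and isometry statements about the complex inner product to the real
  one; multiplying by \<i> exposes the imaginary part.\<close>

lemma cinner_inner:
  "cinner x y = complex_of_real (inner x y) + \<i> * complex_of_real (inner (\<i> *\<^sub>C x) (y::'a::complex_hilbert))"
  by (rule complex_eqI) (simp_all add: inner_cinner cinner_scaleC_left)

lemma tendsto_cinner:
  fixes f g :: "_ \<Rightarrow> 'a::complex_hilbert"
  assumes "(f \<longlongrightarrow> a) F" "(g \<longlongrightarrow> b) F"
  shows "((\<lambda>x. cinner (f x) (g x)) \<longlongrightarrow> cinner a b) F"
  unfolding cinner_inner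
  by (intro tendsto_intros assms bounded_linear.tendsto[OF bounded_linear_scaleC])

lemma tendsto_scaleC:
  fixes f :: "_ \<Rightarrow> 'a::complex_hilbert"
  assumes "(f \<longlongrightarrow> a) F" "(c \<longlongrightarrow> b) F"
  shows "((\<lambda>x. c x *\<^sub>C f x) \<longlongrightarrow> b *\<^sub>C a) F"
proof -
  have 1: "c *\<^sub>C x = Re c *\<^sub>R x + Im c *\<^sub>R (\<i> *\<^sub>C x)" for c and x :: 'a
    by (simp add: scaleR_scaleC scaleC_scaleC flip: scaleC_add_left)
      (metis complex_eq mult.commute)
  have 2: "(\<lambda>x. c x *\<^sub>C f x) = (\<lambda>x. Re (c x) *\<^sub>R f x + Im (c x) *\<^sub>R (\<i> *\<^sub>C f x))"
    by (rule ext) (rule 1)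
  show ?thesis
    unfolding 2 1[of b a]
    by (intro tendsto_intros assms bounded_linear.tendsto[OF bounded_linear_scaleC])
qed

text \<open>Zorn's lemma relative to an arbitrary set \<open>X\<close>, so that it serves both a
  closed complex subspace and the fixed points of a conjugation, which form only a real subspace. A
  unit vector of \<open>X\<close> orthogonal to a maximal system could be added to it.\<close>

lemma ex_maximal_orthonormal:
  obtains B :: "'a::complex_hilbert set" where "orthonormal B" "B \<subseteq> X"
    "\<And>u. u \<in> X \<Longrightarrow> cinner u u = 1 \<Longrightarrow> \<exists>b\<in>B. cinner b u \<noteq> 0"
proof -
  have "\<exists>M\<in>{B::'a set. orthonormal B \<and> B \<subseteq> X}. \<forall>Y\<in>{B. orthonormal B \<and> B \<subseteq> X}. M \<subseteq> Y \<longrightarrow> Y = M"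
  proof (rule subset_Zorn_nonempty)
    show "{B::'a set. orthonormal B \<and> B \<subseteq> X} \<noteq> {}"
      by (auto simp: orthonormal_def intro!: exI[of _ "{}"])
    fix C :: "'a set set"
    assume C: "C \<noteq> {}" "subset.chain {B. orthonormal B \<and> B \<subseteq> X} C"
    have "cinner x y = (if x = y then 1 else 0)" if xy: "x \<in> \<Union>C" "y \<in> \<Union>C" for x y
    proof -
      obtain Y Z where YZ: "Y \<in> C" "x \<in> Y" "Z \<in> C" "y \<in> Z" using xy by blast
      have "Y \<subseteq> Z \<or> Z \<subseteq> Y" and "orthonormal Y" "orthonormal Z"
        using C(2) YZ by (auto simp: subset_chain_def)
      then show ?thesis using YZ unfolding orthonormal_def by blast
    qed
    moreover have "\<Union>C \<subseteq> X" using C(2) by (auto simp: subset_chain_def)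
    ultimately show "\<Union>C \<in> {B. orthonormal B \<and> B \<subseteq> X}" by (simp add: orthonormal_def)
  qed
  then obtain B :: "'a set" where B: "orthonormal B" "B \<subseteq> X"
    and max: "\<And>Y. orthonormal Y \<Longrightarrow> Y \<subseteq> X \<Longrightarrow> B \<subseteq> Y \<Longrightarrow> Y = B" by auto
  have "\<exists>b\<in>B. cinner b u \<noteq> 0" if u: "u \<in> X" "cinner u u = 1" for u
  proof (rule ccontr)
    assume "\<not> ?thesis"
    then have bu: "cinner b u = 0" and ub: "cinner u b = 0" if "b \<in> B" for b
      using that cinner_commute[of u b] by auto
    have "orthonormal (insert u B)"
      unfolding orthonormal_def
    proof (intro ballI)
      fix a b assume "a \<in> insert u B" "b \<in> insert u B"
      then show "cinner a b = (if a = b then 1 else 0)"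
        using B bu ub u unfolding orthonormal_def by (metis insertE)
    qed
    then have "u \<in> B" using max[of "insert u B"] u B by blast
    then show False using bu[of u] u by simp
  qed
  with B that show ?thesis by blast
qed

section \<open>Complex subspaces and orthogonal projection\<close>

definition csubspace :: "'a::complex_hilbert set \<Rightarrow> bool" where
  "csubspace M \<longleftrightarrow> 0 \<in> M \<and> (\<forall>x\<in>M. \<forall>y\<in>M. x + y \<in> M) \<and> (\<forall>\<alpha>. \<forall>x\<in>M. \<alpha> *\<^sub>C x \<in> M)"

lemma csubspace_diff: "csubspace M \<Longrightarrow> x \<in> M \<Longrightarrow> y \<in> M \<Longrightarrow> x - y \<in> M"
  unfolding csubspace_def using scaleC_minus_one[of y] by (metis diff_conv_add_uminus)

lemma csubspace_sum: "csubspace M \<Longrightarrow> (\<And>i. i \<in> A \<Longrightarrow> f i \<in> M) \<Longrightarrow> sum f A \<in> M"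
  by (induction A rule: infinite_finite_induct) (auto simp: csubspace_def)

lemma csubspace_closure:
  assumes M: "csubspace M" shows "csubspace (closure M)"
  unfolding csubspace_def
proof (intro conjI ballI allI)
  show "0 \<in> closure M" using M closure_subset by (auto simp: csubspace_def)
next
  fix x y assume "x \<in> closure M" "y \<in> closure M"
  then obtain f g where "\<And>n. f n \<in> M" "f \<longlonglongrightarrow> x" "\<And>n. g n \<in> M" "g \<longlonglongrightarrow> y"
    unfolding closure_sequential by blast
  then show "x + y \<in> closure M"
    using M tendsto_add[of f x sequentially g y]
    unfolding closure_sequential csubspace_def by (intro exI[of _ "\<lambda>n. f n + g n"]) auto
next
  fix \<alpha> x assume "x \<in> closure M"
  then obtain f where "\<And>n. f n \<in> M" "f \<longlonglongrightarrow> x"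
    unfolding closure_sequential by blast
  then show "\<alpha> *\<^sub>C x \<in> closure M"
    using M bounded_linear.tendsto[OF bounded_linear_scaleC, of f x sequentially \<alpha>]
    unfolding closure_sequential csubspace_def by (intro exI[of _ "\<lambda>n. \<alpha> *\<^sub>C f n"]) auto
qed

text \<open>The projection is the Fourier sum over a maximal orthonormal system \<open>B\<close> of
  \<open>M\<close>. Each \<open>m\<close> in \<open>M\<close> equals its own Fourier sum, because a
  nonzero remainder, normalised, would be a unit vector of \<open>M\<close> orthogonal to
  \<open>B\<close>; hence orthogonality to \<open>B\<close> is orthogonality to
  \<open>M\<close>.\<close>

lemma ex_projection:
  assumes M: "csubspace M" "closed M"
  shows "\<exists>p\<in>M. \<forall>m\<in>M. cinner m (x - p) = 0"
proof -
  obtain B where B: "orthonormal B" "B \<subseteq> M"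
    and max: "\<And>u. u \<in> M \<Longrightarrow> cinner u u = 1 \<Longrightarrow> \<exists>b\<in>B. cinner b u \<noteq> 0"
    using ex_maximal_orthonormal[of M] by blast
  have expan: "\<exists>q\<in>M. ((\<lambda>b. cinner b y *\<^sub>C b) has_sum q) B \<and> (\<forall>b\<in>B. cinner b (y - q) = 0)" for y
  proof -
    obtain q where q: "((\<lambda>b. cinner b y *\<^sub>C b) has_sum q) B"
      using summable_on_basis[OF B(1) bessel_summable[OF B(1)]] by (auto simp: summable_on_def)
    have "q \<in> M"
    proof (rule Lim_in_closed_set[OF M(2)])
      show "(sum (\<lambda>b. cinner b y *\<^sub>C b) \<longlongrightarrow> q) (finite_subsets_at_top B)"
        using q by (simp add: has_sum_def)
      show "\<forall>\<^sub>F F in finite_subsets_at_top B. (\<Sum>b\<in>F. cinner b y *\<^sub>C b) \<in> M"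
        unfolding eventually_finite_subsets_at_top
        using B M(1) by (intro exI[of _ "{}"]) (auto intro!: csubspace_sum simp: csubspace_def)
    qed simp
    moreover have "cinner b (y - q) = 0" if b: "b \<in> B" for b
    proof -
      have "((\<lambda>b'. cinner b (cinner b' y *\<^sub>C b')) has_sum cinner b q) B"
        by (rule has_sum_bounded_linear[OF bounded_linear_cinner_right q])
      moreover have "((\<lambda>b'. cinner b (cinner b' y *\<^sub>C b')) has_sum cinner b y) B"
        by (rule has_sum_finite_neutralI[where B="{b}"])
          (use b B in \<open>auto simp: cinner_scaleC_right orthonormal_def\<close>)
      ultimately have "cinner b q = cinner b y" by (rule has_sum_unique)
      then show ?thesis by (simp add: cinner_diff_right)
    qed
    ultimately show ?thesis using q by blast
  qed
  obtain p where p: "p \<in> M" "\<And>b. b \<in> B \<Longrightarrow> cinner b (x - p) = 0" using expan[of x] by blast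
  have "cinner m (x - p) = 0" if m: "m \<in> M" for m
  proof -
    obtain q where q: "q \<in> M" "((\<lambda>b. cinner b m *\<^sub>C b) has_sum q) B" "\<And>b. b \<in> B \<Longrightarrow> cinner b (m - q) = 0"
      using expan[of m] by blast
    have "m = q"
    proof (rule ccontr)
      assume "m \<noteq> q"
      define u where "u = complex_of_real (inverse (norm (m - q))) *\<^sub>C (m - q)"
      have "cinner u u = 1"
        using \<open>m \<noteq> q\<close> by (simp add: cinner_self u_def norm_scaleC norm_inverse)
      moreover have "u \<in> M" unfolding u_def using csubspace_diff[OF M(1) m q(1)] M(1) by (simp add: csubspace_def)
      moreover have "cinner b u = 0" if "b \<in> B" for b
        using q(3)[OF that] by (simp add: u_def cinner_scaleC_right)
      ultimately show False using max by blast
    qed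
    have "((\<lambda>b. cinner (x - p) (cinner b m *\<^sub>C b)) has_sum cinner (x - p) q) B"
      by (rule has_sum_bounded_linear[OF bounded_linear_cinner_right q(2)])
    moreover have "cinner (x - p) (cinner b m *\<^sub>C b) = 0" if "b \<in> B" for b
      using p(2)[OF that] cinner_commute[of "x - p" b] by (simp add: cinner_scaleC_right)
    ultimately have "cinner (x - p) q = 0"
      by (metis (no_types, lifting) has_sum_0 has_sum_unique)
    then show ?thesis using \<open>m = q\<close> cinner_commute[of m] by simp
  qed
  with p show ?thesis by blast
qed

section \<open>Spans, linear relations given on generators, and isometries\<close>

definition lincomb :: "('i \<Rightarrow> 'a::complex_hilbert) \<Rightarrow> 'i set \<Rightarrow> 'a set" where
  "lincomb u I = {(\<Sum>i\<in>A. \<alpha> i *\<^sub>C u i) | A \<alpha>. finite A \<and> A \<subseteq> I}"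

text \<open>A linear relation, in general multivalued, since the \<open>u i\<close> may be linearly
  dependent. Working with it postpones the question whether \<open>u i\<close> \<mapsto>
  \<open>v i\<close> is well defined until after the closure has been taken.\<close>

definition lin_graph :: "('i \<Rightarrow> 'a::complex_hilbert) \<Rightarrow> ('i \<Rightarrow> 'b::complex_hilbert) \<Rightarrow> 'i set \<Rightarrow> ('a \<times> 'b) set" where
  "lin_graph u v I = {(\<Sum>i\<in>A. \<alpha> i *\<^sub>C u i, \<Sum>i\<in>A. \<alpha> i *\<^sub>C v i) | A \<alpha>. finite A \<and> A \<subseteq> I}"

lemma mem_lincomb: "x \<in> lincomb u I \<longleftrightarrow> (\<exists>y. (x, y) \<in> lin_graph u v I)"
  unfolding lincomb_def lin_graph_def by blast

lemma lin_graph_base: "i \<in> I \<Longrightarrow> (u i, v i) \<in> lin_graph u v I"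
  unfolding lin_graph_def by (intro CollectI exI[of _ "{i}"] exI[of _ "\<lambda>_. 1"]) auto

lemma lin_graph_0: "(0, 0) \<in> lin_graph u v I"
  unfolding lin_graph_def by (intro CollectI exI[of _ "{}"]) auto

lemma lin_graph_scaleC:
  "(x, y) \<in> lin_graph u v I \<Longrightarrow> (\<alpha> *\<^sub>C x, \<alpha> *\<^sub>C y) \<in> lin_graph u v I"
  unfolding lin_graph_def
proof clarify
  fix A \<beta> assume A: "finite A" "A \<subseteq> I"
  then show "\<exists>A' \<beta>'. (\<alpha> *\<^sub>C (\<Sum>i\<in>A. \<beta> i *\<^sub>C u i), \<alpha> *\<^sub>C (\<Sum>i\<in>A. \<beta> i *\<^sub>C v i)) =
       (\<Sum>i\<in>A'. \<beta>' i *\<^sub>C u i, \<Sum>i\<in>A'. \<beta>' i *\<^sub>C v i) \<and> finite A' \<and> A' \<subseteq> I"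
    by (intro exI[of _ A] exI[of _ "\<lambda>i. \<alpha> * \<beta> i"]) (auto simp: scaleC_sum_right scaleC_scaleC)
qed

lemma sum_scaleC_union:
  fixes u :: "'i \<Rightarrow> 'a::complex_hilbert"
  assumes "finite A" "finite B"
  shows "(\<Sum>i\<in>A. \<alpha> i *\<^sub>C u i) + (\<Sum>i\<in>B. \<beta> i *\<^sub>C u i) =
    (\<Sum>i\<in>A \<union> B. ((if i \<in> A then \<alpha> i else 0) + (if i \<in> B then \<beta> i else 0)) *\<^sub>C u i)"
proof -
  have "(\<Sum>i\<in>A. \<alpha> i *\<^sub>C u i) = (\<Sum>i\<in>A \<union> B. (if i \<in> A then \<alpha> i else 0) *\<^sub>C u i)"
    using assms by (intro sum.mono_neutral_cong_left) auto
  moreover have "(\<Sum>i\<in>B. \<beta> i *\<^sub>C u i) = (\<Sum>i\<in>A \<union> B. (if i \<in> B then \<beta> i else 0) *\<^sub>C u i)"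
    using assms by (intro sum.mono_neutral_cong_left) auto
  ultimately show ?thesis by (simp add: scaleC_add_left sum.distrib)
qed

lemma lin_graph_add:
  "(x, y) \<in> lin_graph u v I \<Longrightarrow> (x', y') \<in> lin_graph u v I \<Longrightarrow> (x + x', y + y') \<in> lin_graph u v I"
  unfolding lin_graph_def
proof clarify
  fix A B \<alpha> \<beta> assume "finite A" "A \<subseteq> I" "finite B" "B \<subseteq> I"
  then show "\<exists>A' \<gamma>. ((\<Sum>i\<in>A. \<alpha> i *\<^sub>C u i) + (\<Sum>i\<in>B. \<beta> i *\<^sub>C u i), (\<Sum>i\<in>A. \<alpha> i *\<^sub>C v i) + (\<Sum>i\<in>B. \<beta> i *\<^sub>C v i)) =
       (\<Sum>i\<in>A'. \<gamma> i *\<^sub>C u i, \<Sum>i\<in>A'. \<gamma> i *\<^sub>C v i) \<and> finite A' \<and> A' \<subseteq> I"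
    by (intro exI[of _ "A \<union> B"]
      exI[of _ "\<lambda>i. (if i \<in> A then \<alpha> i else 0) + (if i \<in> B then \<beta> i else 0)"])
      (simp add: sum_scaleC_union)
qed

lemma lin_graph_diff:
  "(x, y) \<in> lin_graph u v I \<Longrightarrow> (x', y') \<in> lin_graph u v I \<Longrightarrow> (x - x', y - y') \<in> lin_graph u v I"
  by (metis lin_graph_add lin_graph_scaleC scaleC_minus_one diff_conv_add_uminus)

lemma csubspace_lincomb: "csubspace (lincomb u I)"
  unfolding csubspace_def
proof (intro conjI ballI allI)
  show "0 \<in> lincomb u I"
    unfolding mem_lincomb[where v=u] using lin_graph_0 by blast
  show "x + y \<in> lincomb u I" if "x \<in> lincomb u I" "y \<in> lincomb u I" for x y
    using that unfolding mem_lincomb[where v=u] by (blast intro: lin_graph_add)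
  show "\<alpha> *\<^sub>C x \<in> lincomb u I" if "x \<in> lincomb u I" for \<alpha> x
    using that unfolding mem_lincomb[where v=u] by (blast intro: lin_graph_scaleC)
qed

lemma lincomb_base: "i \<in> I \<Longrightarrow> u i \<in> lincomb u I"
  unfolding mem_lincomb[where v=u] by (blast intro: lin_graph_base)

text \<open>A vector minus its projection onto the closed span is orthogonal to every generator,
  hence zero: totality gives density.\<close>

lemma closure_lincomb_UNIV:
  assumes "\<And>x. (\<And>i. i \<in> I \<Longrightarrow> cinner (u i) x = 0) \<Longrightarrow> x = 0"
  shows "closure (lincomb u I) = UNIV"
proof (rule UNIV_eq_I[symmetric])
  fix x
  obtain p where p: "p \<in> closure (lincomb u I)"
    "\<And>m. m \<in> closure (lincomb u I) \<Longrightarrow> cinner m (x - p) = 0"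
    using ex_projection[OF csubspace_closure[OF csubspace_lincomb, of u I] closed_closure, of x] by blast
  have "x - p = 0"
    by (rule assms, rule p(2)) (rule subsetD[OF closure_subset lincomb_base])
  then show "x \<in> closure (lincomb u I)" using p by simp
qed

text \<open>Turns weak estimates into norm estimates: \<open>y\<close> itself is approximated from
  \<open>D\<close>, so that in the limit |y|^2 \<le> K |y|.\<close>

lemma norm_le_dense:
  fixes y :: "'a::complex_hilbert"
  assumes D: "closure D = UNIV" and le: "\<And>x. x \<in> D \<Longrightarrow> cmod (cinner x y) \<le> K * norm x" and "0 \<le> K"
  shows "norm y \<le> K"
proof -
  obtain f where f: "\<And>n. f n \<in> D" "f \<longlonglongrightarrow> y"
    using D closure_sequential[of y D] by auto
  have "cmod (cinner y y) \<le> K * norm y"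
    by (rule LIMSEQ_le[OF tendsto_norm[OF tendsto_cinner[OF f(2) tendsto_const]]
          tendsto_mult_left[OF tendsto_norm[OF f(2)]]])
      (use le f in auto)
  then have a: "norm y * norm y \<le> K * norm y"
    by (simp add: cinner_self norm_power power2_eq_square norm_mult)
  show ?thesis by (cases "y = 0") (use a \<open>0 \<le> K\<close> in auto)
qed

lemma lincomb_subset: "csubspace M \<Longrightarrow> (\<And>i. i \<in> I \<Longrightarrow> u i \<in> M) \<Longrightarrow> lincomb u I \<subseteq> M"
proof
  fix x assume M: "csubspace M" and u: "\<And>i. i \<in> I \<Longrightarrow> u i \<in> M" and "x \<in> lincomb u I"
  then obtain A \<alpha> where A: "A \<subseteq> I" "x = (\<Sum>i\<in>A. \<alpha> i *\<^sub>C u i)" unfolding lincomb_def by blast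
  have "\<alpha> i *\<^sub>C u i \<in> M" if "i \<in> A" for i
    using M u[of i] A(1) that unfolding csubspace_def by blast
  then show "x \<in> M" unfolding A by (rule csubspace_sum[OF M])
qed

definition lin_isometry :: "('a::complex_hilbert \<Rightarrow> 'b::complex_hilbert) \<Rightarrow> bool" where
  "lin_isometry T \<longleftrightarrow> (\<forall>x y. T (x + y) = T x + T y) \<and> (\<forall>\<alpha> x. T (\<alpha> *\<^sub>C x) = \<alpha> *\<^sub>C T x)
    \<and> (\<forall>x. norm (T x) = norm x)"

lemma lin_isometry_add: "lin_isometry T \<Longrightarrow> T (x + y) = T x + T y"
  and lin_isometry_scaleC: "lin_isometry T \<Longrightarrow> T (\<alpha> *\<^sub>C x) = \<alpha> *\<^sub>C T x"
  and lin_isometry_norm: "lin_isometry T \<Longrightarrow> norm (T x) = norm x"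
  by (simp_all add: lin_isometry_def)

lemma bounded_linear_lin_isometry: "lin_isometry T \<Longrightarrow> bounded_linear T"
  by (rule bounded_linear_intro[where K=1])
    (simp_all add: lin_isometry_def scaleR_scaleC)

lemma lin_isometry_diff: "lin_isometry T \<Longrightarrow> T (x - y) = T x - T y"
  by (rule linear_diff[OF bounded_linear.linear[OF bounded_linear_lin_isometry]])

lemma lin_isometry_cinner:
  assumes T: "lin_isometry T" shows "cinner (T x) (T y) = cinner x y"
proof -
  have 1: "inner (T x) (T y) = inner x y" for x y
    by (simp add: dot_norm lin_isometry_norm[OF T] flip: lin_isometry_add[OF T])
  show ?thesis
    unfolding cinner_inner by (simp add: 1 flip: lin_isometry_scaleC[OF T])
qed

lemma lin_isometry_eqI:
  assumes T: "lin_isometry T" "lin_isometry T'" and D: "closure (lincomb u I) = UNIV"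
    and eq: "\<And>i. i \<in> I \<Longrightarrow> T (u i) = T' (u i)"
  shows "T = T'"
proof -
  let ?M = "{x. T x = T' x}"
  have "csubspace ?M"
    using T linear_0[OF bounded_linear.linear[OF bounded_linear_lin_isometry[OF T(1)]]]
      linear_0[OF bounded_linear.linear[OF bounded_linear_lin_isometry[OF T(2)]]]
    by (auto simp: csubspace_def lin_isometry_add lin_isometry_scaleC)
  then have "lincomb u I \<subseteq> ?M" by (rule lincomb_subset) (use eq in simp)
  moreover have "closed ?M"
    by (intro closed_Collect_eq linear_continuous_on bounded_linear_lin_isometry T)
  ultimately have "closure (lincomb u I) \<subseteq> ?M" by (rule closure_minimal)
  then show ?thesis using D by auto
qed

lemma closure_pair_sequential:
  fixes G :: "('a::metric_space \<times> 'b::metric_space) set"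
  shows "(x, y) \<in> closure G \<longleftrightarrow> (\<exists>f g. (\<forall>n. (f n, g n) \<in> G) \<and> f \<longlonglongrightarrow> x \<and> g \<longlonglongrightarrow> y)"
proof
  assume "(x, y) \<in> closure G"
  then obtain h where h: "\<forall>n. h n \<in> G" "h \<longlonglongrightarrow> (x, y)"
    unfolding closure_sequential by blast
  have "(\<lambda>n. fst (h n)) \<longlonglongrightarrow> x" "(\<lambda>n. snd (h n)) \<longlonglongrightarrow> y"
    using tendsto_fst[OF h(2)] tendsto_snd[OF h(2)] by simp_all
  then show "\<exists>f g. (\<forall>n. (f n, g n) \<in> G) \<and> f \<longlonglongrightarrow> x \<and> g \<longlonglongrightarrow> y"
    using h(1) by (intro exI[of _ "\<lambda>n. fst (h n)"] exI[of _ "\<lambda>n. snd (h n)"]) simp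
next
  assume "\<exists>f g. (\<forall>n. (f n, g n) \<in> G) \<and> f \<longlonglongrightarrow> x \<and> g \<longlonglongrightarrow> y"
  then show "(x, y) \<in> closure G"
    unfolding closure_sequential
  proof clarify
    fix f g assume "\<forall>n. (f n, g n) \<in> G" "f \<longlonglongrightarrow> x" "g \<longlonglongrightarrow> y"
    then show "\<exists>h. (\<forall>n. h n \<in> G) \<and> h \<longlonglongrightarrow> (x, y)"
      by (intro exI[of _ "\<lambda>n. (f n, g n)"]) (simp add: tendsto_Pair)
  qed
qed

lemma lin_graph_closure_add:
  assumes "(x, y) \<in> closure (lin_graph u v I)" "(x', y') \<in> closure (lin_graph u v I)"
  shows "(x + x', y + y') \<in> closure (lin_graph u v I)"
proof -
  obtain f g f' g' where "\<forall>n. (f n, g n) \<in> lin_graph u v I" "f \<longlonglongrightarrow> x" "g \<longlonglongrightarrow> y"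
    "\<forall>n. (f' n, g' n) \<in> lin_graph u v I" "f' \<longlonglongrightarrow> x'" "g' \<longlonglongrightarrow> y'"
    using assms unfolding closure_pair_sequential by blast
  then show ?thesis
    unfolding closure_pair_sequential
    by (intro exI[of _ "\<lambda>n. f n + f' n"] exI[of _ "\<lambda>n. g n + g' n"])
      (auto intro!: tendsto_add lin_graph_add)
qed

lemma lin_graph_closure_scaleC:
  assumes "(x, y) \<in> closure (lin_graph u v I)"
  shows "(\<alpha> *\<^sub>C x, \<alpha> *\<^sub>C y) \<in> closure (lin_graph u v I)"
proof -
  obtain f g where "\<forall>n. (f n, g n) \<in> lin_graph u v I" "f \<longlonglongrightarrow> x" "g \<longlonglongrightarrow> y"
    using assms unfolding closure_pair_sequential by blast
  then show ?thesis
    unfolding closure_pair_sequential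
    by (intro exI[of _ "\<lambda>n. \<alpha> *\<^sub>C f n"] exI[of _ "\<lambda>n. \<alpha> *\<^sub>C g n"])
      (auto intro!: tendsto_scaleC lin_graph_scaleC)
qed

text \<open>Equal Gram matrices make the relation norm preserving, and this survives the closure; a
  pair (0, y) in the closure thus has y = 0, which is single-valuedness. Density and completeness
  provide a value at every vector.\<close>

lemma ex_lin_isometry:
  fixes u :: "'i \<Rightarrow> 'a::complex_hilbert" and v :: "'i \<Rightarrow> 'b::complex_hilbert"
  assumes D: "closure (lincomb u I) = UNIV"
    and gram: "\<And>i j. i \<in> I \<Longrightarrow> j \<in> I \<Longrightarrow> cinner (v i) (v j) = cinner (u i) (u j)"
  shows "\<exists>T. lin_isometry T \<and> (\<forall>i\<in>I. T (u i) = v i)"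
proof -
  let ?G = "lin_graph u v I"
  have nG: "norm y = norm x" if xy: "(x, y) \<in> ?G" for x y
  proof -
    obtain A \<alpha> where A: "finite A" "A \<subseteq> I" "x = (\<Sum>i\<in>A. \<alpha> i *\<^sub>C u i)" "y = (\<Sum>i\<in>A. \<alpha> i *\<^sub>C v i)"
      using xy unfolding lin_graph_def by blast
    have "cinner y y = cinner x x"
      using A(2) gram unfolding A
      by (simp add: cinner_sum_left cinner_sum_right cinner_scaleC_left cinner_scaleC_right subset_iff)
    then have "(norm y)\<^sup>2 = (norm x)\<^sup>2" unfolding cinner_self of_real_eq_iff .
    then show ?thesis by simp
  qed
  have nC: "norm y = norm x" if xy: "(x, y) \<in> closure ?G" for x y
  proof -
    obtain f g where f: "\<forall>n. (f n, g n) \<in> ?G" "f \<longlonglongrightarrow> x" "g \<longlonglongrightarrow> y"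
      using xy unfolding closure_pair_sequential by blast
    have "(\<lambda>n. norm (g n)) = (\<lambda>n. norm (f n))" using nG f(1) by auto
    then show ?thesis
      using tendsto_norm[OF f(2)] tendsto_norm[OF f(3)] LIMSEQ_unique by metis
  qed
  have ex: "\<exists>y. (x, y) \<in> closure ?G" for x
  proof -
    obtain f where f: "\<And>n. f n \<in> lincomb u I" "f \<longlonglongrightarrow> x"
      using D closure_sequential[of x "lincomb u I"] by auto
    have "\<exists>g. \<forall>n. (f n, g n) \<in> ?G"
      using f(1) unfolding mem_lincomb[where v=v] by metis
    then obtain g where g: "\<And>n. (f n, g n) \<in> ?G" by blast
    have "norm (g m - g n) = norm (f m - f n)" for m n
      using nG[OF lin_graph_diff[OF g g]] .
    moreover have "Cauchy f" using f(2) LIMSEQ_imp_Cauchy by blast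
    ultimately have "Cauchy g" by (simp add: Cauchy_def dist_norm)
    then obtain y where "g \<longlonglongrightarrow> y" using Cauchy_convergent convergent_def by blast
    then show ?thesis unfolding closure_pair_sequential using f g by blast
  qed
  have uniq: "y = y'" if "(x, y) \<in> closure ?G" "(x, y') \<in> closure ?G" for x y y'
    using nC[OF lin_graph_closure_add[OF that(1) lin_graph_closure_scaleC[OF that(2), of "-1"]]]
    by (simp add: scaleC_minus_one)
  obtain T where T: "\<And>x. (x, T x) \<in> closure ?G" using ex by metis
  have "lin_isometry T"
    unfolding lin_isometry_def
    using uniq[OF T lin_graph_closure_add[OF T T]] uniq[OF T lin_graph_closure_scaleC[OF T]] nC[OF T]
    by blast
  moreover have "T (u i) = v i" if "i \<in> I" for i
    using uniq[OF T] lin_graph_base[OF that, of u v] closure_subset by blast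
  ultimately show ?thesis by blast
qed

section \<open>Particle number components\<close>

lemma fock_comp_0 [simp]: "fock_comp n 0 = 0"
  by (rule fock_eqI) (simp add: fock_coeff_comp zero_fock.rep_eq)

lemma fock_comp_add: "fock_comp n (\<psi> + \<phi>) = fock_comp n \<psi> + fock_comp n \<phi>"
  by (rule fock_eqI) (simp add: fock_coeff_comp plus_fock.rep_eq)

lemma fock_comp_diff: "fock_comp n (\<psi> - \<phi>) = fock_comp n \<psi> - fock_comp n \<phi>"
  by (rule fock_eqI) (simp add: fock_coeff_comp minus_fock.rep_eq)

lemma fock_comp_scaleC: "fock_comp n (\<alpha> *\<^sub>C \<psi>) = \<alpha> *\<^sub>C fock_comp n \<psi>"
  by (rule fock_eqI) (simp add: fock_coeff_comp scaleC_fock.rep_eq)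

lemma fock_comp_scaleR: "fock_comp n (r *\<^sub>R \<psi>) = r *\<^sub>R fock_comp n \<psi>"
  by (simp add: scaleR_scaleC fock_comp_scaleC)

lemma fock_comp_comp: "fock_comp m (fock_comp n \<psi>) = (if m = n then fock_comp n \<psi> else 0)"
  by (rule fock_eqI) (simp add: fock_coeff_comp zero_fock.rep_eq)

lemma fock_eq_compI: "(\<And>n. fock_comp n \<psi> = fock_comp n \<phi>) \<Longrightarrow> \<psi> = \<phi>"
  by (rule fock_eqI) (metis fock_coeff_comp)

lemma bij_betw_length: "bij_betw snd (Sigma UNIV (\<lambda>n. {xs. length xs = n})) (UNIV::'a list set)"
  by (auto simp: bij_betw_def inj_on_def image_iff)

lemma has_sum_by_length:
  fixes f :: "'a list \<Rightarrow> 'b::{topological_comm_monoid_add,t3_space}"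
  assumes f: "(f has_sum s) UNIV"
    and g: "\<And>n. ((\<lambda>xs. if length xs = n then f xs else 0) has_sum g n) UNIV"
  shows "(g has_sum s) UNIV"
proof (rule has_sum_SigmaD)
  show "((\<lambda>x. f (snd x)) has_sum s) (Sigma UNIV (\<lambda>n. {xs. length xs = n}))"
    using f has_sum_reindex_bij_betw[OF bij_betw_length, of f s] by simp
  show "((\<lambda>xs. f (snd (n, xs))) has_sum g n) {xs. length xs = n}" for n
    using g[of n]
    by (rule has_sum_cong_neutral[THEN iffD1, rotated -1]) auto
qed

lemma cinner_fock_comp: "cinner (fock_comp n \<psi>) \<phi> = cinner \<psi> (fock_comp n \<phi>)"
proof (rule has_sum_unique[OF cinner_fock_has_sum])
  have "(\<lambda>xs. cnj (fock_coeff (fock_comp n \<psi>) xs) * fock_coeff \<phi> xs)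
      = (\<lambda>xs. cnj (fock_coeff \<psi> xs) * fock_coeff (fock_comp n \<phi>) xs)"
    by (auto simp: fock_coeff_comp)
  then show "((\<lambda>xs. cnj (fock_coeff (fock_comp n \<psi>) xs) * fock_coeff \<phi> xs)
      has_sum cinner \<psi> (fock_comp n \<phi>)) UNIV"
    using cinner_fock_has_sum[of \<psi> "fock_comp n \<phi>"] by simp
qed

lemma cinner_comp_comp: "cinner (fock_comp n \<psi>) (fock_comp n \<phi>) = cinner \<psi> (fock_comp n \<phi>)"
  by (simp add: cinner_fock_comp fock_comp_comp)

lemma cinner_comp_has_sum:
  "((\<lambda>n. cinner (fock_comp n \<psi>) (fock_comp n \<phi>)) has_sum cinner \<psi> \<phi>) UNIV"
proof (rule has_sum_by_length[OF cinner_fock_has_sum])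
  fix n
  have "(\<lambda>xs. cnj (fock_coeff (fock_comp n \<psi>) xs) * fock_coeff (fock_comp n \<phi>) xs)
     = (\<lambda>xs. if length xs = n then cnj (fock_coeff \<psi> xs) * fock_coeff \<phi> xs else 0)"
    by (auto simp: fock_coeff_comp)
  then show "((\<lambda>xs. if length xs = n then cnj (fock_coeff \<psi> xs) * fock_coeff \<phi> xs else 0)
      has_sum cinner (fock_comp n \<psi>) (fock_comp n \<phi>)) UNIV"
    using cinner_fock_has_sum[of "fock_comp n \<psi>" "fock_comp n \<phi>"] by simp
qed

lemma norm_comp_has_sum: "((\<lambda>n. (norm (fock_comp n \<psi>))\<^sup>2) has_sum (norm \<psi>)\<^sup>2) UNIV"
  using has_sum_Re[OF cinner_comp_has_sum[of \<psi> \<psi>]] by (simp add: cinner_self del: of_real_power)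

lemma norm_fock_comp_le: "norm (fock_comp n \<psi>) \<le> norm \<psi>"
proof -
  have "(\<Sum>k\<in>{n}. (norm (fock_comp k \<psi>))\<^sup>2) \<le> (norm \<psi>)\<^sup>2"
    by (rule finite_sum_le_has_sum[OF norm_comp_has_sum]) auto
  then show ?thesis by (simp add: power2_le_iff_abs_le)
qed

lemma bounded_linear_fock_comp: "bounded_linear (fock_comp n)"
  by (rule bounded_linear_intro[where K=1])
    (simp_all add: fock_comp_add fock_comp_scaleR norm_fock_comp_le)

text \<open>The Hilbert sum property of the list model: components of square-summable norms glue
  together because each list contributes to exactly one of them.\<close>

lemma ex_fock_of_comps:
  fixes x :: "nat \<Rightarrow> 'a::complex_hilbert fock"
  assumes x: "\<And>n. fock_comp n (x n) = x n" and summ: "summable (\<lambda>n. (norm (x n))\<^sup>2)"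
  shows "\<exists>\<psi>. \<forall>n. fock_comp n \<psi> = x n"
proof -
  let ?f = "\<lambda>xs. fock_coeff (x (length xs)) xs"
  let ?g = "\<lambda>xs. (cmod (?f xs))\<^sup>2"
  have x0: "fock_coeff (x n) xs = 0" if "length xs \<noteq> n" for n xs
    using fock_coeff_comp[of n "x n" xs] that x[of n] by simp
  have "((\<lambda>xs. (cmod (fock_coeff (x n) xs))\<^sup>2) has_sum (norm (x n))\<^sup>2) {xs. length xs = n}" for n
    by (rule has_sum_cong_neutral[THEN iffD1, rotated -1, OF norm_fock_has_sum]) (auto simp: x0)
  then have 1: "((\<lambda>xs. ?g (snd (n, xs))) has_sum (norm (x n))\<^sup>2) {xs. length xs = n}" for n
    by (rule has_sum_cong[THEN iffD1, rotated]) simp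
  have "(\<lambda>p. ?g (snd p)) summable_on Sigma UNIV (\<lambda>n. {xs. length xs = n})"
  proof (rule summable_on_SigmaI[where g="\<lambda>n. (norm (x n))\<^sup>2"])
    show "((\<lambda>y. ?g (snd (n, y))) has_sum (norm (x n))\<^sup>2) {xs. length xs = n}" for n by (rule 1)
    show "(\<lambda>n. (norm (x n))\<^sup>2) summable_on UNIV"
      using summ by (simp add: summable_on_UNIV_nonneg_real_iff)
  qed auto
  then have "?g summable_on UNIV"
    using summable_on_reindex_bij_betw[OF bij_betw_length, of ?g] by simp
  then have "fock_coeff (Abs_fock ?f) = ?f"
    by (intro Abs_fock_inverse) (auto simp: sqs_def fock_coeff_outside)
  then have "fock_comp n (Abs_fock ?f) = x n" for n
    by (intro fock_eqI) (simp add: fock_coeff_comp x0)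
  then show ?thesis by blast
qed

lemma fock_coeff_tens_length: "length ys \<noteq> length xs \<Longrightarrow> fock_coeff (tens xs) ys = 0"
proof (induction xs arbitrary: ys)
  case Nil
  then show ?case by (simp add: fock_vacuum.rep_eq)
next
  case (Cons x xs)
  then show ?case by (cases ys) simp_all
qed

lemma fock_comp_tens: "fock_comp n (tens xs) = (if n = length xs then tens xs else 0)"
  by (rule fock_eqI) (auto simp: fock_coeff_comp fock_coeff_tens_length zero_fock.rep_eq)

lemma cinner_tens_comp: "cinner (tens xs) (fock_comp n \<psi>) = (if n = length xs then cinner (tens xs) \<psi> else 0)"
  by (simp add: cinner_fock_comp[symmetric] fock_comp_tens)

lemma tensor_add_left: "tensor (f + g) \<psi> = tensor f \<psi> + tensor g \<psi>"
proof (rule fock_eqI)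
  show "fock_coeff (tensor (f + g) \<psi>) xs = fock_coeff (tensor f \<psi> + tensor g \<psi>) xs" for xs
    by (cases xs) (simp_all add: plus_fock.rep_eq cinner_add_right algebra_simps)
qed

lemma tensor_add_right: "tensor f (\<psi> + \<phi>) = tensor f \<psi> + tensor f \<phi>"
proof (rule fock_eqI)
  show "fock_coeff (tensor f (\<psi> + \<phi>)) xs = fock_coeff (tensor f \<psi> + tensor f \<phi>) xs" for xs
    by (cases xs) (simp_all add: plus_fock.rep_eq algebra_simps)
qed

lemma tensor_scaleC_left: "tensor (\<alpha> *\<^sub>C f) \<psi> = \<alpha> *\<^sub>C tensor f \<psi>"
proof (rule fock_eqI)
  show "fock_coeff (tensor (\<alpha> *\<^sub>C f) \<psi>) xs = fock_coeff (\<alpha> *\<^sub>C tensor f \<psi>) xs" for xs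
    by (cases xs) (simp_all add: scaleC_fock.rep_eq cinner_scaleC_right)
qed

lemma tensor_scaleC_right: "tensor f (\<alpha> *\<^sub>C \<psi>) = \<alpha> *\<^sub>C tensor f \<psi>"
proof (rule fock_eqI)
  show "fock_coeff (tensor f (\<alpha> *\<^sub>C \<psi>)) xs = fock_coeff (\<alpha> *\<^sub>C tensor f \<psi>) xs" for xs
    by (cases xs) (simp_all add: scaleC_fock.rep_eq)
qed

lemma norm_tensor: "norm (tensor f \<psi>) = norm f * norm \<psi>"
proof -
  have "complex_of_real ((norm (tensor f \<psi>))\<^sup>2) = complex_of_real ((norm f * norm \<psi>)\<^sup>2)"
    using cinner_tensor[of f \<psi> f \<psi>] by (simp add: cinner_self power_mult_distrib)
  then have "(norm (tensor f \<psi>))\<^sup>2 = (norm f * norm \<psi>)\<^sup>2" unfolding of_real_eq_iff .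
  then show ?thesis by simp
qed

lemma bounded_linear_tensor_left: "bounded_linear (\<lambda>f. tensor f \<psi>)"
  by (rule bounded_linear_intro[where K="norm \<psi>"])
    (simp_all add: tensor_add_left scaleR_scaleC tensor_scaleC_left norm_tensor)

lemma bounded_linear_tensor_right: "bounded_linear (tensor f)"
  by (rule bounded_linear_intro[where K="norm f"])
    (simp_all add: tensor_add_right scaleR_scaleC tensor_scaleC_right norm_tensor mult.commute)

section \<open>Symmetric components and their projections\<close>

lemma symmetric_comp: "is_symmetric \<psi> \<Longrightarrow> is_symmetric (fock_comp n \<psi>)"
  by (rule is_symmetricI) (metis cinner_tens_comp is_symmetricD size_mset)

lemma symmetric_of_comps: "(\<And>n. is_symmetric (fock_comp n \<psi>)) \<Longrightarrow> is_symmetric \<psi>"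
  by (rule is_symmetricI) (metis cinner_tens_comp is_symmetricD size_mset)

lemma csubspace_sym_tensors: "csubspace (sym_tensors n)"
  by (simp add: csubspace_def sym_tensors_def symmetric_zero symmetric_add symmetric_scaleC
      fock_comp_add fock_comp_scaleC)

lemma sym_tensors_scaleC: "\<psi> \<in> sym_tensors n \<Longrightarrow> \<alpha> *\<^sub>C \<psi> \<in> sym_tensors n"
  using csubspace_sym_tensors unfolding csubspace_def by blast

lemma closed_sym_tensors: "closed (sym_tensors n :: 'a::complex_hilbert fock set)"
proof -
  have "sym_tensors n = {\<psi>::'a fock. is_symmetric \<psi>} \<inter> {\<psi>. fock_comp n \<psi> = \<psi>}"
    by (auto simp: sym_tensors_def)
  moreover have "closed {\<psi>::'a fock. fock_comp n \<psi> = \<psi>}"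
    by (intro closed_Collect_eq linear_continuous_on[OF bounded_linear_fock_comp] continuous_on_id)
  ultimately show ?thesis using closed_Int[OF closed_symmetric] by metis
qed

text \<open>\<open>orth_proj\<close> is a definite description, so existence comes from
  \<open>ex_projection\<close>; two candidates differ by an element of the subspace that is
  orthogonal to itself.\<close>

lemma orth_proj_sym_tensors:
  shows orth_proj_mem: "orth_proj (sym_tensors n) x \<in> sym_tensors n" (is "?p \<in> ?M")
    and cinner_orth_proj: "m \<in> sym_tensors n \<Longrightarrow> cinner m (orth_proj (sym_tensors n) x) = cinner m x"
proof -
  obtain p where p: "p \<in> ?M" "\<forall>m\<in>?M. cinner m (x - p) = 0"
    using ex_projection[OF csubspace_sym_tensors closed_sym_tensors] by blast
  have uniq: "q = p" if q: "q \<in> ?M" "\<forall>m\<in>?M. cinner m (x - q) = 0" for q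
  proof -
    have "p - q \<in> ?M" by (rule csubspace_diff[OF csubspace_sym_tensors p(1) q(1)])
    then have "cinner (p - q) (x - q) - cinner (p - q) (x - p) = 0" using p q by simp
    then have "cinner (p - q) (p - q) = 0" by (simp add: cinner_diff_right)
    then show "q = p" by (simp add: cinner_self)
  qed
  have pp: "?p = p"
    unfolding orth_proj_def
  proof (rule the_equality)
    show "p \<in> ?M \<and> (\<forall>m\<in>?M. cinner m (x - p) = 0)" using p by (rule conjI)
    show "q = p" if "q \<in> ?M \<and> (\<forall>m\<in>?M. cinner m (x - q) = 0)" for q
      using uniq[OF conjunct1[OF that] conjunct2[OF that]] .
  qed
  show "?p \<in> ?M" unfolding pp by (rule p(1))
  show "cinner m ?p = cinner m x" if "m \<in> ?M"
    unfolding pp using bspec[OF p(2) that] by (simp add: cinner_diff_right)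
qed

lemma sfock_comp_simps:
  "sfock_comp n 0 = 0"
  "sfock_comp n (\<psi> + \<phi>) = sfock_comp n \<psi> + sfock_comp n \<phi>"
  "sfock_comp n (\<psi> - \<phi>) = sfock_comp n \<psi> - sfock_comp n \<phi>"
  "sfock_comp n (\<alpha> *\<^sub>C \<psi>) = \<alpha> *\<^sub>C sfock_comp n \<psi>"
  "sfock_comp n (r *\<^sub>R \<psi>) = r *\<^sub>R sfock_comp n \<psi>"
  by (simp_all add: zero_sfock.rep_eq plus_sfock.rep_eq minus_sfock.rep_eq scaleC_sfock.rep_eq
      scaleR_sfock.rep_eq fock_comp_add fock_comp_diff fock_comp_scaleC fock_comp_scaleR)

lemma sfock_eqI: "(\<And>n. sfock_comp n \<psi> = sfock_comp n \<phi>) \<Longrightarrow> \<psi> = \<phi>"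
  using fock_eq_compI[of "fock_of \<psi>" "fock_of \<phi>"] by (simp add: fock_of_inject)

lemma symmetric_fock_of: "is_symmetric (fock_of \<psi>)"
  using fock_of[of \<psi>] by simp

lemma sfock_comp_mem: "sfock_comp n \<psi> \<in> sym_tensors n"
  by (simp add: sym_tensors_def symmetric_comp symmetric_fock_of fock_comp_comp)

lemma ex_sfock_of_comps:
  assumes x: "\<And>n. x n \<in> sym_tensors n" and summ: "summable (\<lambda>n. (norm (x n))\<^sup>2)"
  shows "\<exists>\<psi>. \<forall>n. sfock_comp n \<psi> = x n"
proof -
  obtain \<psi> where \<psi>: "\<And>n. fock_comp n \<psi> = x n"
    using ex_fock_of_comps[OF _ summ] x by (auto simp: sym_tensors_def)
  have "is_symmetric \<psi>"
    by (rule symmetric_of_comps) (use x \<psi> in \<open>simp add: sym_tensors_def\<close>)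
  then have "fock_of (Abs_sfock \<psi>) = \<psi>" by (simp add: Abs_sfock_inverse)
  then show ?thesis using \<psi> by metis
qed

lemma cinner_sfock_has_sum:
  "((\<lambda>n. cinner (sfock_comp n \<psi>) (sfock_comp n \<phi>)) has_sum cinner \<psi> \<phi>) UNIV"
  by (simp add: cinner_sfock.rep_eq cinner_comp_has_sum)

lemma norm_sfock_sums: "(\<lambda>n. (norm (sfock_comp n \<psi>))\<^sup>2) sums (norm \<psi>)\<^sup>2"
  by (simp add: norm_sfock.rep_eq has_sum_imp_sums norm_comp_has_sum)

lemma norm_sfock_comp_le: "norm (sfock_comp n \<psi>) \<le> norm \<psi>"
  by (simp add: norm_sfock.rep_eq norm_fock_comp_le)

lemma ex_sfock_weighted:
  assumes "summable (\<lambda>n. (cmod (w n) * norm (sfock_comp n \<psi>))\<^sup>2)"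
  shows "\<exists>\<phi>. \<forall>n. sfock_comp n \<phi> = w n *\<^sub>C sfock_comp n \<psi>"
  by (rule ex_sfock_of_comps)
    (use assms in \<open>auto simp: norm_scaleC intro!: sym_tensors_scaleC sfock_comp_mem\<close>)

lemma app_eqI: "(x, y) \<in> A \<Longrightarrow> (\<And>z. (x, z) \<in> A \<Longrightarrow> z = y) \<Longrightarrow> app A x = y"
  unfolding app_def by (rule the_equality)

lemma app_Gamma_op:
  assumes "\<And>n. sfock_comp n \<phi> = complex_of_real (r ^ n) *\<^sub>C sfock_comp n \<psi>"
  shows "app (Gamma_op r) \<psi> = \<phi>"
  by (rule app_eqI) (use assms in \<open>auto simp: Gamma_op_def intro!: sfock_eqI\<close>)

lemma app_number_fun:
  assumes "\<And>n. sfock_comp n \<phi> = g (\<epsilon> * real n) *\<^sub>C sfock_comp n \<psi>"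
  shows "app (number_fun \<epsilon> g) \<psi> = \<phi>"
  by (rule app_eqI) (use assms in \<open>auto simp: number_fun_def intro!: sfock_eqI\<close>)

definition truncate :: "nat \<Rightarrow> 'a::complex_hilbert sfock \<Rightarrow> 'a sfock" where
  "truncate M \<psi> = (SOME \<phi>. \<forall>n. sfock_comp n \<phi> = (if n \<le> M then sfock_comp n \<psi> else 0))"

lemma sfock_comp_truncate: "sfock_comp n (truncate M \<psi>) = (if n \<le> M then sfock_comp n \<psi> else 0)"
proof -
  have "summable (\<lambda>n. (norm (if n \<le> M then sfock_comp n \<psi> else 0))\<^sup>2)"
    by (rule summable_finite[of "{..M}"]) auto
  then have "\<exists>\<phi>. \<forall>n. sfock_comp n \<phi> = (if n \<le> M then sfock_comp n \<psi> else 0)"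
    by (intro ex_sfock_of_comps)
      (use sfock_comp_mem csubspace_sym_tensors in \<open>auto simp: csubspace_def\<close>)
  from someI_ex[OF this] show ?thesis unfolding truncate_def by blast
qed

lemma norm_sfock_truncate: "(norm (\<psi> - truncate M \<psi>))\<^sup>2 = (norm \<psi>)\<^sup>2 - (\<Sum>n\<le>M. (norm (sfock_comp n \<psi>))\<^sup>2)"
proof (rule sums_unique2[OF norm_sfock_sums])
  have "(\<lambda>n. if n \<in> {..M} then (norm (sfock_comp n \<psi>))\<^sup>2 else 0) sums (\<Sum>n\<le>M. (norm (sfock_comp n \<psi>))\<^sup>2)"
    by (rule sums_If_finite_set) simp
  from sums_diff[OF norm_sfock_sums this]
  have "(\<lambda>n. (norm (sfock_comp n \<psi>))\<^sup>2 - (if n \<in> {..M} then (norm (sfock_comp n \<psi>))\<^sup>2 else 0))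
    sums ((norm \<psi>)\<^sup>2 - (\<Sum>n\<le>M. (norm (sfock_comp n \<psi>))\<^sup>2))" .
  moreover have "(\<lambda>n. (norm (sfock_comp n \<psi>))\<^sup>2 - (if n \<in> {..M} then (norm (sfock_comp n \<psi>))\<^sup>2 else 0))
     = (\<lambda>n. (norm (sfock_comp n (\<psi> - truncate M \<psi>)))\<^sup>2)"
    by (auto simp: sfock_comp_simps sfock_comp_truncate)
  ultimately show "(\<lambda>n. (norm (sfock_comp n (\<psi> - truncate M \<psi>)))\<^sup>2)
    sums ((norm \<psi>)\<^sup>2 - (\<Sum>n\<le>M. (norm (sfock_comp n \<psi>))\<^sup>2))" by simp
qed

lemma truncate_tendsto: "(\<lambda>M. truncate M \<psi>) \<longlonglongrightarrow> \<psi>"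
proof -
  have "(\<lambda>M. \<Sum>n\<le>M. (norm (sfock_comp n \<psi>))\<^sup>2) \<longlonglongrightarrow> (norm \<psi>)\<^sup>2"
    using norm_sfock_sums[of \<psi>] by (simp add: sums_def_le)
  then have "(\<lambda>M. sqrt ((norm \<psi>)\<^sup>2 - (\<Sum>n\<le>M. (norm (sfock_comp n \<psi>))\<^sup>2))) \<longlonglongrightarrow> sqrt ((norm \<psi>)\<^sup>2 - (norm \<psi>)\<^sup>2)"
    by (intro tendsto_intros)
  then have "(\<lambda>M. norm (\<psi> - truncate M \<psi>)) \<longlonglongrightarrow> 0"
    unfolding norm_sfock_truncate[symmetric] by simp
  then have "(\<lambda>M. \<psi> - truncate M \<psi>) \<longlonglongrightarrow> 0" by (rule tendsto_norm_zero_cancel)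
  then show ?thesis
    using tendsto_diff[OF tendsto_const[of \<psi>], of "\<lambda>M. \<psi> - truncate M \<psi>" 0 sequentially] by simp
qed

section \<open>Exponential vectors\<close>

text \<open>A nonzero power series has isolated zeros. Only real arguments are tested because the
  sets to which this is applied are closed under real scaling only.\<close>

lemma real_powser_zeroD:
  fixes p :: "nat \<Rightarrow> complex"
  assumes "\<And>t::real. (\<lambda>n. p n * of_real t ^ n) sums 0"
  shows "p n = 0"
proof (rule ccontr)
  assume "p n \<noteq> 0"
  have sm: "summable (\<lambda>k. p k * z ^ k)" for z
  proof (rule powser_inside)
    show "summable (\<lambda>k. p k * complex_of_real (norm z + 1) ^ k)"
      using assms[of "norm z + 1"] sums_summable by blast
    have "norm (complex_of_real (norm z + 1)) = norm z + 1"
      unfolding norm_of_real by simp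
    then show "norm z < norm (complex_of_real (norm z + 1))" by linarith
  qed
  define f where "f z = (\<Sum>k. p k * z ^ k)" for z
  \<comment> \<open>Isolation of the zero at 0 needs a nonzero coefficient of positive index; the
    constant one is read off at t = 0.\<close>
  show False
  proof (cases "n = 0")
    case True
    have "(\<lambda>k. p k * of_real 0 ^ k) sums p 0" by (simp add: powser_sums_zero)
    then show False using assms[of 0] sums_unique2 \<open>p n \<noteq> 0\<close> True by blast
  next
    case False
    have "f 0 = 0" unfolding f_def using sums_unique[OF assms[of 0]] by simp
    then obtain s where s: "0 < s" "\<And>z. z \<in> cball 0 s - {0} \<Longrightarrow> f z \<noteq> 0"
      using powser_0_nonzero[of 1 0 p f n] sm False \<open>p n \<noteq> 0\<close> unfolding f_def
      by (auto simp: summable_sums)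
    have "f (of_real s) = 0" unfolding f_def using sums_unique[OF assms[of s]] by simp
    then show False using s(2)[of "of_real s"] s(1) by simp
  qed
qed

lemma cinner_tens_replicate:
  "cinner (tens xs) (tens (replicate n g)) = (if length xs = n then \<Prod>x\<in>#mset xs. cinner x g else 0)"
proof (induction xs arbitrary: n)
  case Nil
  then show ?case by (cases n) (simp_all add: cinner_vacuum fock_vacuum.rep_eq)
next
  case (Cons x xs)
  then show ?case using cinner_tens[of "x # xs" "[]"] by (cases n) (simp_all add: cinner_tensor)
qed

lemma tens_replicate_mem: "tens (replicate n g) \<in> sym_tensors n"
proof -
  have "is_symmetric (tens (replicate n g))"
    by (rule is_symmetricI) (metis cinner_tens_replicate mset_eq_length)
  then show ?thesis by (simp add: sym_tensors_def fock_comp_tens)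
qed

lemma norm_fock_vacuum: "norm (fock_vacuum :: 'a::complex_hilbert fock) = 1"
proof -
  have "cinner fock_vacuum (fock_vacuum :: 'a fock) = 1"
    by (simp add: cinner_vacuum fock_vacuum.rep_eq)
  then have "complex_of_real ((norm (fock_vacuum :: 'a fock))\<^sup>2) = complex_of_real 1"
    by (simp add: cinner_self)
  then show ?thesis
    unfolding of_real_eq_iff using power2_eq_iff_nonneg[of "norm (fock_vacuum :: 'a fock)" 1] by simp
qed

lemma norm_tens_replicate: "norm (tens (replicate n g)) = norm g ^ n"
  by (induction n) (simp_all add: norm_fock_vacuum norm_tensor)

text \<open>The exponential vector, an unnormalised coherent state, with no \<epsilon> in it. The
  root of the factorial makes the inner product of two such vectors the exponential of that of their
  arguments.\<close>

definition expv :: "'a::complex_hilbert \<Rightarrow> 'a sfock" where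
  "expv g = (SOME \<psi>. \<forall>n. sfock_comp n \<psi> = complex_of_real (1 / sqrt (fact n)) *\<^sub>C tens (replicate n g))"

lemma sfock_comp_expv:
  "sfock_comp n (expv g) = complex_of_real (1 / sqrt (fact n)) *\<^sub>C tens (replicate n g)"
proof -
  let ?x = "\<lambda>n. complex_of_real (1 / sqrt (fact n)) *\<^sub>C tens (replicate n g)"
  have "(norm (?x n))\<^sup>2 = inverse (fact n) * ((norm g)\<^sup>2) ^ n" for n
    by (simp add: norm_scaleC norm_tens_replicate power_mult_distrib power_divide norm_divide
        divide_inverse real_sqrt_inverse[symmetric] power_mult[symmetric] mult.commute power_inverse)
  then have "summable (\<lambda>n. (norm (?x n))\<^sup>2)" using summable_exp[of "(norm g)\<^sup>2"] by simp
  then have "\<exists>\<psi>. \<forall>n. sfock_comp n \<psi> = ?x n"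
    by (intro ex_sfock_of_comps sym_tensors_scaleC tens_replicate_mem)
  from someI_ex[OF this] show ?thesis unfolding expv_def by blast
qed

lemma cinner_tens_sfock_comp: "n = length xs \<Longrightarrow> cinner (tens xs) (sfock_comp n \<psi>) = cinner (tens xs) (fock_of \<psi>)"
  by (simp add: cinner_tens_comp)

lemma cinner_expv_has_sum:
  "((\<lambda>n. cinner (tens (replicate n g)) (fock_of \<psi>) / complex_of_real (sqrt (fact n))) has_sum cinner (expv g) \<psi>) UNIV"
  using cinner_sfock_has_sum[of "expv g" \<psi>]
  by (simp add: sfock_comp_expv cinner_scaleC_left cinner_tens_comp)

lemma cinner_tens_expv:
  "cinner (tens xs) (fock_of (expv g))
     = (\<Prod>x\<in>#mset xs. cinner x g) / complex_of_real (sqrt (fact (length xs)))"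
  using cinner_tens_sfock_comp[OF refl, of xs "expv g"]
  by (simp add: sfock_comp_expv cinner_scaleC_right cinner_tens_replicate)

lemma cinner_expv_expv: "cinner (expv f) (expv g) = exp (cinner f g)"
proof -
  have "(\<lambda>n. cinner (tens (replicate n f)) (fock_of (expv g)) / complex_of_real (sqrt (fact n)))
     = (\<lambda>n. cinner f g ^ n /\<^sub>R fact n)"
  proof
    fix n
    have "complex_of_real (sqrt (fact n)) * complex_of_real (sqrt (fact n)) = of_real (fact n)"
      by (simp flip: of_real_mult)
    then have "x / complex_of_real (sqrt (fact n)) / complex_of_real (sqrt (fact n)) = x /\<^sub>R fact n" for x
      by (simp add: scaleR_conv_of_real divide_inverse mult.assoc mult.commute flip: inverse_mult_distrib)
    then show "cinner (tens (replicate n f)) (fock_of (expv g)) / complex_of_real (sqrt (fact n)) = cinner f g ^ n /\<^sub>R fact n"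
      by (simp add: cinner_tens_expv)
  qed
  then show ?thesis
    using has_sum_imp_sums[OF cinner_expv_has_sum[of f "expv g"]] exp_converges[of "cinner f g"] sums_unique2
    by metis
qed

lemma tensor_zero_left: "tensor 0 \<psi> = 0"
  by (rule linear_0[OF bounded_linear.linear[OF bounded_linear_tensor_left]])

lemma vacuum_eq_expv: "(vacuum :: 'a::complex_hilbert sfock) = expv 0"
proof (rule sfock_eqI)
  show "sfock_comp n (vacuum :: 'a sfock) = sfock_comp n (expv 0)" for n
    using fock_comp_tens[of n "[] :: 'a list"]
    by (cases n) (simp_all add: sfock_comp_expv vacuum.rep_eq tensor_zero_left)
qed

lemma tens_scaleC_replicate: "tens (replicate n (\<alpha> *\<^sub>C h) @ ws) = \<alpha> ^ n *\<^sub>C tens (replicate n h @ ws)"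
  by (induction n) (simp_all add: tensor_scaleC_left tensor_scaleC_right scaleC_scaleC mult.commute)

text \<open>The binomial formula for tensor powers, valid when tested against a symmetric vector.
  The trailing word \<open>ws\<close> receives the factor split off in each induction step.\<close>

lemma cinner_tens_replicate_add:
  assumes sym: "is_symmetric \<psi>"
  shows "cinner (tens (replicate n (h + g) @ ws)) \<psi> =
    (\<Sum>k\<le>n. of_nat (n choose k) * cinner (tens (replicate k h @ replicate (n - k) g @ ws)) \<psi>)"
proof (induction n arbitrary: ws)
  case (Suc n)
  define b where "b k m = cinner (tens (replicate k h @ replicate m g @ ws)) \<psi>" for k m
  have 1: "cinner (tens (x # replicate n (h + g) @ ws)) \<psi> = cinner (tens (replicate n (h + g) @ x # ws)) \<psi>" for x
    by (rule is_symmetricD[OF sym]) simp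
  have "cinner (tens (replicate (Suc n) (h + g) @ ws)) \<psi>
      = cinner (tens (replicate n (h + g) @ h # ws)) \<psi> + cinner (tens (replicate n (h + g) @ g # ws)) \<psi>"
    unfolding 1[symmetric] by (simp add: tensor_add_left cinner_add_left)
  also have "\<dots> = (\<Sum>k\<le>n. of_nat (n choose k) * b (Suc k) (n - k)) + (\<Sum>k\<le>n. of_nat (n choose k) * b k (Suc n - k))"
  proof (intro arg_cong2[of _ _ _ _ "(+)"])
    show "cinner (tens (replicate n (h + g) @ h # ws)) \<psi> = (\<Sum>k\<le>n. of_nat (n choose k) * b (Suc k) (n - k))"
      unfolding Suc.IH b_def
      by (intro sum.cong refl arg_cong2[of _ _ _ _ "(*)"] is_symmetricD[OF sym]) simp
    show "cinner (tens (replicate n (h + g) @ g # ws)) \<psi> = (\<Sum>k\<le>n. of_nat (n choose k) * b k (Suc n - k))"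
      unfolding Suc.IH b_def
      by (intro sum.cong refl arg_cong2[of _ _ _ _ "(*)"] is_symmetricD[OF sym]) (simp add: Suc_diff_le)
  qed
  also have "(\<Sum>k\<le>n. of_nat (n choose k) * b k (Suc n - k)) = (\<Sum>k\<le>Suc n. of_nat (n choose k) * b k (Suc n - k))"
    by simp
  also have "\<dots> = b 0 (Suc n) + (\<Sum>k\<le>n. of_nat (n choose Suc k) * b (Suc k) (n - k))"
    by (subst sum.atMost_Suc_shift) simp
  also have "(\<Sum>k\<le>n. of_nat (n choose k) * b (Suc k) (n - k)) + \<dots>
     = b 0 (Suc n) + (\<Sum>k\<le>n. of_nat (Suc n choose Suc k) * b (Suc k) (n - k))"
    by (simp add: sum.distrib algebra_simps)
  also have "\<dots> = (\<Sum>k\<le>Suc n. of_nat (Suc n choose k) * b k (Suc n - k))"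
    by (subst sum.atMost_Suc_shift) simp
  finally show ?case by (simp add: b_def del: sum.atMost_Suc)
qed simp

text \<open>Polarisation: the \<open>t\<close>-coefficients of \<open>\<langle>(f + t y)\<^sup>\<otimes>\<^sup>n, \<psi>\<rangle>\<close> replace the factors \<open>f\<close> one by one.\<close>

lemma expv_total:
  assumes X: "\<And>x y t::real. x \<in> X \<Longrightarrow> y \<in> X \<Longrightarrow> t *\<^sub>R x + y \<in> X" "0 \<in> X"
    and split: "\<And>z. \<exists>x\<in>X. \<exists>y\<in>X. z = x + \<i> *\<^sub>C (y::'a::complex_hilbert)"
    and orth: "\<And>f. f \<in> X \<Longrightarrow> cinner (expv f) \<psi> = 0"
  shows "\<psi> = 0"
proof -
  define P where "P = fock_of \<psi>"
  have sym: "is_symmetric P" unfolding P_def by (rule symmetric_fock_of)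
  have c1: "cinner (tens (replicate n f)) P = 0" if f: "f \<in> X" for n f
  proof -
    have "(\<lambda>n. cinner (tens (replicate n f)) P / complex_of_real (sqrt (fact n)) * of_real t ^ n) sums 0" for t :: real
    proof -
      have "t *\<^sub>R f \<in> X" using X(1)[OF f X(2), of t] by simp
      then have "(\<lambda>n. cinner (tens (replicate n (t *\<^sub>R f))) P / complex_of_real (sqrt (fact n))) sums 0"
        using has_sum_imp_sums[OF cinner_expv_has_sum[of "t *\<^sub>R f" \<psi>]] orth by (simp add: P_def)
      then show ?thesis
        using tens_scaleC_replicate[of _ "of_real t" f "[]"]
        by (simp add: scaleR_scaleC cinner_scaleC_left mult.commute)
    qed
    from real_powser_zeroD[OF this, of n] show ?thesis by simp
  qed
  have c2: "set ys \<subseteq> X \<Longrightarrow> f \<in> X \<Longrightarrow> cinner (tens (replicate n f @ ys)) P = 0" for ys f n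
  proof (induction ys arbitrary: n f)
    case Nil
    then show ?case using c1 by simp
  next
    case (Cons y ys)
    let ?p = "\<lambda>k. if k \<le> Suc n then of_nat (Suc n choose k) * cinner (tens (replicate k y @ replicate (Suc n - k) f @ ys)) P else 0"
    have "(\<lambda>k. ?p k * of_real t ^ k) sums 0" for t :: real
    proof -
      have "(\<lambda>k. ?p k * of_real t ^ k) sums (\<Sum>k\<le>Suc n. ?p k * of_real t ^ k)"
        by (rule sums_finite) auto
      also have "(\<Sum>k\<le>Suc n. ?p k * of_real t ^ k) = cinner (tens (replicate (Suc n) (t *\<^sub>R y + f) @ ys)) P"
        unfolding cinner_tens_replicate_add[OF sym]
        by (intro sum.cong refl) (simp add: scaleR_scaleC tens_scaleC_replicate cinner_scaleC_left)
      also have "\<dots> = 0"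
      proof (rule Cons.IH)
        show "t *\<^sub>R y + f \<in> X" using Cons.prems by (intro X) auto
      qed (use Cons.prems in simp)
      finally show ?thesis .
    qed
    \<comment> \<open>The linear coefficient has exactly one factor \<open>y\<close> and
      \<open>n\<close> factors \<open>f\<close>, with the nonzero binomial n + 1.\<close>
    from real_powser_zeroD[OF this, of 1]
    have "cinner (tens (y # replicate n f @ ys)) P = 0"
      using of_nat_neq_0[of n, where 'a=complex] by simp
    moreover have "cinner (tens (y # replicate n f @ ys)) P = cinner (tens (replicate n f @ y # ys)) P"
      by (rule is_symmetricD[OF sym]) simp
    ultimately show ?case by simp
  qed
  \<comment> \<open>A factor outside \<open>X\<close> is split as x + \<i> y over \<open>X\<close>,
    and both parts are moved to the right, past the factors \<open>zs\<close> still to be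
    treated.\<close>
  have c3: "set ys \<subseteq> X \<Longrightarrow> cinner (tens (zs @ ys)) P = 0" for zs ys
  proof (induction zs arbitrary: ys)
    case Nil
    then show ?case using c2[of ys 0 0] X by simp
  next
    case (Cons z zs)
    obtain x y where xy: "x \<in> X" "y \<in> X" "z = x + \<i> *\<^sub>C y" using split by blast
    have mv: "cinner (tens (v # zs @ ys)) P = cinner (tens (zs @ v # ys)) P" for v
      by (rule is_symmetricD[OF sym]) simp
    have "cinner (tens (x # zs @ ys)) P = 0" "cinner (tens (y # zs @ ys)) P = 0"
      unfolding mv using xy Cons by simp_all
    then show ?case
      by (simp add: xy(3) tensor_add_left tensor_scaleC_left cinner_add_left cinner_scaleC_left)
  qed
  have "P = 0" by (rule tens_total) (use c3[of "[]"] in simp)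
  then show ?thesis unfolding P_def using fock_of_inject zero_sfock.rep_eq by metis
qed

lemma closure_lincomb_expv_UNIV: "closure (lincomb expv UNIV) = (UNIV :: 'a::complex_hilbert sfock set)"
proof (rule closure_lincomb_UNIV)
  fix x :: "'a sfock" assume x: "\<And>i. i \<in> UNIV \<Longrightarrow> cinner (expv i) x = 0"
  show "x = 0"
  proof (rule expv_total[of UNIV])
    show "\<exists>x\<in>UNIV. \<exists>y\<in>UNIV. z = x + \<i> *\<^sub>C y" for z :: 'a
      by (intro bexI[of _ z] bexI[of _ 0]) simp_all
  qed (use x in auto)
qed

section \<open>Weyl operators\<close>

text \<open>The displacement operator, that is the exponential of creation minus annihilation by
  \<open>u\<close> at \<epsilon> = 1. Its usual action on exponential vectors is taken as
  definition; \<open>ex_lin_isometry\<close> supplies the extension, and the prefactor is what keeps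
  the Gram matrix.\<close>

definition displace :: "'a::complex_hilbert \<Rightarrow> 'a sfock \<Rightarrow> 'a sfock" where
  "displace u = (SOME T. lin_isometry T \<and>
    (\<forall>g. T (expv g) = exp (- of_real ((norm u)\<^sup>2 / 2) - cinner u g) *\<^sub>C expv (g + u)))"

lemma displace_props:
  shows lin_isometry_displace: "lin_isometry (displace u)"
    and displace_expv: "displace u (expv g) = exp (- of_real ((norm u)\<^sup>2 / 2) - cinner u g) *\<^sub>C expv (g + u)"
proof -
  let ?v = "\<lambda>g. exp (- of_real ((norm u)\<^sup>2 / 2) - cinner u g) *\<^sub>C expv (g + u)"
  have "\<exists>T. lin_isometry T \<and> (\<forall>g\<in>UNIV. T (expv g) = ?v g)"
  proof (rule ex_lin_isometry[OF closure_lincomb_expv_UNIV])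
    fix g h :: 'a
    have "cinner (?v g) (?v h) = cnj (exp (- of_real ((norm u)\<^sup>2 / 2) - cinner u g))
        * (exp (- of_real ((norm u)\<^sup>2 / 2) - cinner u h) * exp (cinner (g + u) (h + u)))"
      by (simp only: cinner_scaleC_left cinner_scaleC_right cinner_expv_expv mult_ac)
    also have "\<dots> = exp (cnj (- of_real ((norm u)\<^sup>2 / 2) - cinner u g)
        + (- of_real ((norm u)\<^sup>2 / 2) - cinner u h) + cinner (g + u) (h + u))"
      by (simp only: exp_cnj exp_add mult.assoc)
    also have "cnj (- of_real ((norm u)\<^sup>2 / 2) - cinner u g)
        + (- of_real ((norm u)\<^sup>2 / 2) - cinner u h) + cinner (g + u) (h + u) = cinner g h"
      by (simp add: cinner_add_left cinner_add_right cinner_self cinner_commute[of g u]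
          algebra_simps)
    finally show "cinner (?v g) (?v h) = cinner (expv g) (expv h)"
      by (simp only: cinner_expv_expv)
  qed
  then have "\<exists>T. lin_isometry T \<and> (\<forall>g. T (expv g) = ?v g)" by simp
  from someI_ex[OF this]
  show "lin_isometry (displace u)" "displace u (expv g) = ?v g"
    unfolding displace_def by blast+
qed

lemma lin_isometry_comp: "lin_isometry S \<Longrightarrow> lin_isometry T \<Longrightarrow> lin_isometry (\<lambda>x. S (T x))"
  by (simp add: lin_isometry_def)

text \<open>In general the product carries the phase exp (- \<i> Im <u, w>), which is 1 under the
  assumption. The case that matters is that of real multiples of one vector.\<close>

lemma displace_displace:
  assumes "Im (cinner u w) = 0"
  shows "displace u (displace w x) = displace (u + w) x"
proof -
  have uw: "cinner w u = cinner u w"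
    using cinner_commute[of w u] assms by (simp add: complex_eq_iff)
  have nn: "complex_of_real ((norm (u + w))\<^sup>2) = complex_of_real ((norm u)\<^sup>2) + 2 * cinner u w + complex_of_real ((norm w)\<^sup>2)"
    unfolding cinner_self[symmetric] by (simp add: cinner_add_left cinner_add_right uw)
  have "(\<lambda>x. displace u (displace w x)) = displace (u + w)"
  proof (rule lin_isometry_eqI[OF lin_isometry_comp[OF lin_isometry_displace lin_isometry_displace]
        lin_isometry_displace closure_lincomb_expv_UNIV])
    fix g :: 'a
    have "- of_real ((norm w)\<^sup>2 / 2) - cinner w g + (- of_real ((norm u)\<^sup>2 / 2) - cinner u (g + w))
      = - of_real ((norm (u + w))\<^sup>2 / 2) - cinner (u + w) g"
      using nn by (simp add: cinner_add_left cinner_add_right field_simps)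
    then show "displace u (displace w (expv g)) = displace (u + w) (expv g)"
      by (simp add: displace_expv lin_isometry_scaleC[OF lin_isometry_displace] scaleC_scaleC
          exp_add[symmetric] add_ac del: of_real_power of_real_divide)
  qed
  then show ?thesis by metis
qed

lemma displace_0: "displace 0 x = x"
proof -
  have "displace 0 = (\<lambda>x::'a sfock. x)"
    by (rule lin_isometry_eqI[OF lin_isometry_displace _ closure_lincomb_expv_UNIV])
      (simp_all add: displace_expv lin_isometry_def)
  then show ?thesis by metis
qed

lemma displace_scaleR_add:
  "displace (s *\<^sub>R u) (displace (t *\<^sub>R u) x) = displace ((s + t) *\<^sub>R u) x"
  by (subst displace_displace)
    (simp_all add: scaleR_scaleC cinner_scaleC_left cinner_scaleC_right cinner_self scaleC_add_left
      flip: of_real_power)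

lemma displace_minus: "displace (- u) (displace u x) = x" "displace u (displace (- u) x) = x"
  using displace_scaleR_add[of "-1" u 1 x] displace_scaleR_add[of 1 u "-1" x]
  by (simp_all add: displace_0)

lemma cinner_displace: "cinner x (displace u y) = cinner (displace (- u) x) y"
  using lin_isometry_cinner[OF lin_isometry_displace, of u "displace (- u) x" y]
  by (simp add: displace_minus)

lemma unitary_displace: "unitary (displace u)"
  unfolding unitary_def
proof (intro conjI allI)
  show "surj (displace u)" by (rule surjI[of _ "displace (- u)"]) (rule displace_minus)
qed (simp_all add: lin_isometry_add lin_isometry_scaleC lin_isometry_norm lin_isometry_displace)

lemma norm_diff_sq:
  "(norm (x - y))\<^sup>2 = Re (cinner x x - cinner x y - cinner y x + cinner y (y::'a::complex_hilbert))"
proof -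
  have "complex_of_real ((norm (x - y))\<^sup>2) = cinner x x - cinner x y - cinner y x + cinner y y"
    unfolding cinner_self[symmetric] by (simp add: cinner_diff_left cinner_diff_right)
  then show ?thesis by (metis Re_complex_of_real)
qed

text \<open>The distance of two exponential vectors is an explicit continuous function of the inner
  products of their arguments.\<close>

lemma tendsto_expv:
  assumes f: "(f \<longlongrightarrow> g) F" shows "((\<lambda>x. expv (f x)) \<longlongrightarrow> expv g) F"
proof -
  have "((\<lambda>x. sqrt (Re (exp (cinner (f x) (f x)) - exp (cinner (f x) g) - exp (cinner g (f x)) + exp (cinner g g))))
      \<longlongrightarrow> sqrt (Re (exp (cinner g g) - exp (cinner g g) - exp (cinner g g) + exp (cinner g g)))) F"
    by (intro tendsto_intros tendsto_cinner f)
  then have "((\<lambda>x. norm (expv (f x) - expv g)) \<longlongrightarrow> 0) F"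
    unfolding cinner_expv_expv[symmetric] norm_diff_sq[symmetric] by simp
  then have "((\<lambda>x. expv (f x) - expv g) \<longlongrightarrow> 0) F" by (rule tendsto_norm_zero_cancel)
  then show ?thesis by (rule LIM_zero_cancel)
qed

lemma displace_zero: "displace u 0 = 0"
  by (rule linear_0[OF bounded_linear.linear[OF bounded_linear_lin_isometry[OF lin_isometry_displace]]])

text \<open>Explicit on exponential vectors, hence true on their span; for general \<open>x\<close>
  the approximation is uniform in \<open>t\<close>, since displacements are isometries.\<close>

lemma continuous_displace: "continuous_on UNIV (\<lambda>t. displace (t *\<^sub>R u) x)"
proof -
  let ?M = "{x. continuous_on UNIV (\<lambda>t. displace (t *\<^sub>R u) x)}"
  have M: "csubspace ?M"
    by (auto simp: csubspace_def displace_zero lin_isometry_add[OF lin_isometry_displace]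
        lin_isometry_scaleC[OF lin_isometry_displace] continuous_on_def
        intro!: tendsto_intros tendsto_scaleC)
  have "lincomb expv UNIV \<subseteq> ?M"
  proof (rule lincomb_subset[OF M])
    fix g :: 'a
    have "continuous_on UNIV (\<lambda>t. exp (- of_real ((norm (t *\<^sub>R u))\<^sup>2 / 2) - cinner (t *\<^sub>R u) g) *\<^sub>C expv (g + t *\<^sub>R u))"
      unfolding continuous_on_def
      by (intro ballI tendsto_scaleC tendsto_expv tendsto_intros tendsto_cinner) simp_all
    then show "expv g \<in> ?M" by (simp only: displace_expv mem_Collect_eq)
  qed
  moreover obtain y where y: "\<And>n. y n \<in> lincomb expv UNIV" "y \<longlonglongrightarrow> x"
    using closure_lincomb_expv_UNIV closure_sequential[of x "lincomb expv UNIV"] by auto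
  ultimately have yc: "continuous_on UNIV (\<lambda>t. displace (t *\<^sub>R u) (y n))" for n by blast
  have "uniform_limit UNIV (\<lambda>n t. displace (t *\<^sub>R u) (y n)) (\<lambda>t. displace (t *\<^sub>R u) x) sequentially"
    unfolding uniform_limit_iff
  proof (intro allI impI)
    fix e :: real assume "e > 0"
    then have "\<forall>\<^sub>F n in sequentially. dist (y n) x < e" by (rule tendstoD[OF y(2)])
    then show "\<forall>\<^sub>F n in sequentially. \<forall>t\<in>UNIV. dist (displace (t *\<^sub>R u) (y n)) (displace (t *\<^sub>R u) x) < e"
      by (simp add: dist_norm lin_isometry_norm[OF lin_isometry_displace]
          flip: lin_isometry_diff[OF lin_isometry_displace])
  qed
  then show ?thesis
    by (rule uniform_limit_theorem[rotated]) (simp_all add: yc)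
qed

lemma unitary_group_displace: "unitary_group (\<lambda>t. displace (t *\<^sub>R u))"
  unfolding unitary_group_def
  by (simp add: unitary_displace displace_scaleR_add continuous_displace)

subsection \<open>The field operators on exponential vectors\<close>

lemma norm_orth_proj_le: "norm (orth_proj (sym_tensors n) x) \<le> norm x"
proof -
  let ?p = "orth_proj (sym_tensors n) x"
  have "cmod (cinner ?p ?p) \<le> norm ?p * norm x"
    unfolding cinner_orth_proj[OF orth_proj_mem] by (rule norm_cinner_le)
  then have "norm ?p * norm ?p \<le> norm ?p * norm x"
    by (simp add: cinner_self power2_eq_square norm_mult)
  then show ?thesis by (cases "norm ?p = 0") auto
qed

lemma orth_proj_0: "orth_proj (sym_tensors n) 0 = 0"
  using norm_orth_proj_le[of n 0] by simp

text \<open>In terms of the generating function g \<mapsto> <expv g, x>, creation is multiplication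
  by sqrt(\<epsilon>) <g, f>; on its coefficients this is a shift by one degree.\<close>

lemma cinner_creation:
  assumes "(x, \<theta>) \<in> creation \<epsilon> f"
  shows "cinner (tens (replicate (Suc j) g)) (fock_of \<theta>) / complex_of_real (sqrt (fact (Suc j)))
    = complex_of_real (sqrt \<epsilon>) * cinner g f * (cinner (tens (replicate j g)) (fock_of x) / complex_of_real (sqrt (fact j)))"
    and "cinner (tens []) (fock_of \<theta>) = 0"
proof -
  have \<theta>: "sfock_comp 0 \<theta> = 0" "sfock_comp (Suc j) \<theta> = complex_of_real (sqrt (\<epsilon> * real (Suc j))) *\<^sub>C
      orth_proj (sym_tensors (Suc j)) (tensor f (sfock_comp j x))"
    using assms by (auto simp: creation_def)
  have "cinner (tens (replicate (Suc j) g)) (fock_of \<theta>) = cinner (tens (replicate (Suc j) g)) (sfock_comp (Suc j) \<theta>)"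
    by (subst cinner_tens_sfock_comp) simp_all
  also have "\<dots> = complex_of_real (sqrt (\<epsilon> * real (Suc j))) * cinner (tens (replicate (Suc j) g)) (tensor f (sfock_comp j x))"
    unfolding \<theta> cinner_scaleC_right cinner_orth_proj[OF tens_replicate_mem] ..
  also have "cinner (tens (replicate (Suc j) g)) (tensor f (sfock_comp j x)) = cinner g f * cinner (tens (replicate j g)) (fock_of x)"
    by (simp add: cinner_tensor cinner_tens_comp)
  finally show "cinner (tens (replicate (Suc j) g)) (fock_of \<theta>) / complex_of_real (sqrt (fact (Suc j)))
    = complex_of_real (sqrt \<epsilon>) * cinner g f * (cinner (tens (replicate j g)) (fock_of x) / complex_of_real (sqrt (fact j)))"
    by (simp add: real_sqrt_mult field_simps del: of_nat_Suc)
  show "cinner (tens []) (fock_of \<theta>) = 0"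
    using cinner_tens_sfock_comp[of 0 "[]" \<theta>] \<theta>(1) by simp
qed

lemma cinner_expv_creation:
  assumes "(x, \<theta>) \<in> creation \<epsilon> f"
  shows "cinner (expv g) \<theta> = complex_of_real (sqrt \<epsilon>) * cinner g f * cinner (expv g) x"
proof -
  have "(\<lambda>j. cinner (tens (replicate (Suc j) g)) (fock_of \<theta>) / complex_of_real (sqrt (fact (Suc j))))
      sums (complex_of_real (sqrt \<epsilon>) * cinner g f * cinner (expv g) x)"
    unfolding cinner_creation(1)[OF assms]
    by (intro sums_mult has_sum_imp_sums cinner_expv_has_sum)
  then have "(\<lambda>j. cinner (tens (replicate j g)) (fock_of \<theta>) / complex_of_real (sqrt (fact j)))
      sums (complex_of_real (sqrt \<epsilon>) * cinner g f * cinner (expv g) x)"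
    using cinner_creation(2)[OF assms] by (subst (asm) sums_Suc_iff) simp
  then show ?thesis using has_sum_imp_sums[OF cinner_expv_has_sum[of g \<theta>]] sums_unique2 by blast
qed

lemma cinner_truncate_expv:
  "cinner (truncate k (expv g)) \<psi> = (\<Sum>n\<le>k. cinner (tens (replicate n g)) (fock_of \<psi>) / complex_of_real (sqrt (fact n)))"
proof -
  let ?t = "\<lambda>n. cinner (sfock_comp n (truncate k (expv g))) (sfock_comp n \<psi>)"
  have "?t sums (\<Sum>n\<le>k. ?t n)"
    by (rule sums_finite) (auto simp: sfock_comp_truncate)
  then have "cinner (truncate k (expv g)) \<psi> = (\<Sum>n\<le>k. ?t n)"
    using has_sum_imp_sums[OF cinner_sfock_has_sum] sums_unique2 by blast
  also have "\<dots> = (\<Sum>n\<le>k. cinner (tens (replicate n g)) (fock_of \<psi>) / complex_of_real (sqrt (fact n)))"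
    by (intro sum.cong refl) (simp add: sfock_comp_truncate sfock_comp_expv cinner_scaleC_left cinner_tens_comp)
  finally show ?thesis .
qed

text \<open>An exponential vector is an eigenvector of annihilation with eigenvalue sqrt(\<epsilon>)
  <f, g>. Truncating keeps the vector in the domain of \<open>creation\<close>, at the cost of one
  degree between argument and value.\<close>

lemma annihilation_truncate_expv:
  "(truncate (Suc k) (expv g), (complex_of_real (sqrt \<epsilon>) * cinner f g) *\<^sub>C truncate k (expv g)) \<in> annihilation \<epsilon> f"
  unfolding annihilation_def adjoint_op_def
proof clarify
  fix x \<theta> assume x: "(x, \<theta>) \<in> creation \<epsilon> f"
  show "cinner (truncate (Suc k) (expv g)) \<theta> = cinner ((complex_of_real (sqrt \<epsilon>) * cinner f g) *\<^sub>C truncate k (expv g)) x"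
    unfolding cinner_truncate_expv cinner_scaleC_left
    by (subst sum.atMost_Suc_shift)
      (simp only: cinner_creation[OF x] sum_distrib_left replicate_0 complex_cnj_mult cinner_commute[of g f, symmetric]
        complex_cnj_complex_of_real, simp)
qed

text \<open>Creation applied to \<open>expv g\<close>, although \<open>creation\<close> is
  restricted to finitely many particles. In the estimate the factor n + 1 is absorbed by 2^n inside
  an exponential series.\<close>

lemma ex_creation_expv:
  assumes "0 \<le> \<epsilon>"
  shows "\<exists>\<theta>. sfock_comp 0 \<theta> = 0 \<and> (\<forall>n. sfock_comp (Suc n) \<theta> = complex_of_real (sqrt (\<epsilon> * real (Suc n))) *\<^sub>C
    orth_proj (sym_tensors (Suc n)) (tensor f (sfock_comp n (expv g))))"
proof -
  let ?x = "\<lambda>n. case n of 0 \<Rightarrow> 0 | Suc n \<Rightarrow> complex_of_real (sqrt (\<epsilon> * real (Suc n))) *\<^sub>C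
    orth_proj (sym_tensors (Suc n)) (tensor f (sfock_comp n (expv g)))"
  have mem: "?x n \<in> sym_tensors n" for n
    using csubspace_sym_tensors[of n]
    by (cases n) (auto simp: csubspace_def intro: sym_tensors_scaleC orth_proj_mem)
  have summ: "summable (\<lambda>n. (norm (?x (Suc n)))\<^sup>2)"
  proof (rule summable_comparison_test'[where N=0])
    show "summable (\<lambda>n. (\<bar>\<epsilon>\<bar> * (norm f)\<^sup>2) * (inverse (fact n) * (2 * (norm g)\<^sup>2) ^ n))"
      by (intro summable_mult summable_exp)
    fix n :: nat
    have 1: "real (Suc n) \<le> 2 ^ n" by (induction n) auto
    have "(norm (?x (Suc n)))\<^sup>2 \<le> (\<bar>sqrt (\<epsilon> * real (Suc n))\<bar> * (norm f * (norm g ^ n / sqrt (fact n))))\<^sup>2"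
      unfolding nat.case norm_scaleC norm_of_real
    proof (intro power_mono mult_left_mono)
      have "norm (tensor f (sfock_comp n (expv g))) = norm f * (norm g ^ n / sqrt (fact n))"
        by (simp add: norm_tensor sfock_comp_expv norm_scaleC norm_tens_replicate norm_divide)
      then show "norm (orth_proj (sym_tensors (Suc n)) (tensor f (sfock_comp n (expv g)))) \<le> norm f * (norm g ^ n / sqrt (fact n))"
        using norm_orth_proj_le[of "Suc n" "tensor f (sfock_comp n (expv g))"] by simp
    qed auto
    also have "\<dots> = (\<bar>\<epsilon>\<bar> * (norm f)\<^sup>2) * (inverse (fact n) * (norm g)\<^sup>2 ^ n) * real (Suc n)"
    proof -
      have "\<bar>sqrt (\<epsilon> * real (Suc n))\<bar>\<^sup>2 = \<bar>\<epsilon>\<bar> * real (Suc n)"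
        using \<open>0 \<le> \<epsilon>\<close> by (simp del: of_nat_Suc)
      moreover have "(sqrt (fact n))\<^sup>2 = (fact n :: real)" by simp
      moreover have "(norm g ^ n)\<^sup>2 = (norm g)\<^sup>2 ^ n" by (simp add: power_mult[symmetric] mult.commute)
      ultimately show ?thesis
        unfolding power_mult_distrib power_divide by (simp add: divide_inverse mult_ac del: of_nat_Suc)
    qed
    also have "\<dots> \<le> (\<bar>\<epsilon>\<bar> * (norm f)\<^sup>2) * (inverse (fact n) * (norm g)\<^sup>2 ^ n) * 2 ^ n"
      by (intro mult_left_mono 1) auto
    finally show "norm ((norm (?x (Suc n)))\<^sup>2) \<le> (\<bar>\<epsilon>\<bar> * (norm f)\<^sup>2) * (inverse (fact n) * (2 * (norm g)\<^sup>2) ^ n)"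
      by (simp add: power_mult_distrib mult_ac)
  qed
  have "summable (\<lambda>n. (norm (?x n))\<^sup>2)"
    using summ unfolding summable_Suc_iff[where f="\<lambda>n. (norm (?x n))\<^sup>2"] .
  from ex_sfock_of_comps[OF mem this] obtain \<theta> where "\<forall>n. sfock_comp n \<theta> = ?x n" ..
  then show ?thesis by (intro exI[of _ \<theta>]) simp
qed

lemma tensor_zero_right: "tensor f 0 = 0"
  by (rule linear_0[OF bounded_linear.linear[OF bounded_linear_tensor_right]])

lemma cinner_expv_finite:
  assumes "\<forall>n>m. sfock_comp n x = 0"
  shows "cinner (expv g) x = (\<Sum>n\<le>m. cinner (tens (replicate n g)) (fock_of x) / complex_of_real (sqrt (fact n)))"
proof (rule sums_unique2[OF has_sum_imp_sums[OF cinner_expv_has_sum]])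
  show "(\<lambda>n. cinner (tens (replicate n g)) (fock_of x) / complex_of_real (sqrt (fact n))) sums
    (\<Sum>n\<le>m. cinner (tens (replicate n g)) (fock_of x) / complex_of_real (sqrt (fact n)))"
  proof (rule sums_finite)
    fix n assume "n \<notin> {..m}"
    then have "sfock_comp n x = 0" using assms by simp
    then show "cinner (tens (replicate n g)) (fock_of x) / complex_of_real (sqrt (fact n)) = 0"
      using cinner_tens_sfock_comp[of n "replicate n g" x] by simp
  qed simp
qed

text \<open>The derivative of \<open>g \<mapsto> \<langle>expv g, x\<rangle>\<close> in the direction \<open>f\<close>, for \<open>x\<close> with at most \<open>m\<close> particles.\<close>

definition expv_deriv :: "nat \<Rightarrow> 'a::complex_hilbert sfock \<Rightarrow> 'a \<Rightarrow> 'a \<Rightarrow> complex" where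
  "expv_deriv m x g f = (\<Sum>j<m. complex_of_real (sqrt (real (Suc j)) / sqrt (fact j)) *
    cinner (tens (f # replicate j g)) (fock_of x))"

lemma expv_deriv_scaleC: "expv_deriv m x g (\<alpha> *\<^sub>C f) = cnj \<alpha> * expv_deriv m x g f"
  unfolding expv_deriv_def sum_distrib_left
  by (intro sum.cong refl) (simp add: tensor_scaleC_left cinner_scaleC_left)

text \<open>As creation is multiplication, annihilation is differentiation of the generating
  function in the direction \<open>f\<close>. The adjoint relation is used on truncations of
  \<open>expv g\<close>, which lie in the domain of \<open>creation\<close>, and then passed to the
  limit.\<close>

lemma cinner_expv_annihilation:
  assumes \<eta>: "(x, \<eta>) \<in> annihilation \<epsilon> f" and \<epsilon>: "0 \<le> \<epsilon>" and m: "\<forall>n>m. sfock_comp n x = 0"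
  shows "cinner (expv g) \<eta> = complex_of_real (sqrt \<epsilon>) * expv_deriv m x g f"
proof -
  obtain \<theta> where \<theta>: "sfock_comp 0 \<theta> = 0" "\<And>n. sfock_comp (Suc n) \<theta> = complex_of_real (sqrt (\<epsilon> * real (Suc n))) *\<^sub>C
    orth_proj (sym_tensors (Suc n)) (tensor f (sfock_comp n (expv g)))"
    using ex_creation_expv[OF \<epsilon>] by blast
  have cr: "(truncate k (expv g), truncate (Suc k) \<theta>) \<in> creation \<epsilon> f" for k
    unfolding creation_def finite_particle_def
    by (auto simp: sfock_comp_truncate \<theta> tensor_zero_right orth_proj_0 intro!: exI[of _ k])
  have eq: "cinner x (truncate (Suc k) \<theta>) = cinner \<eta> (truncate k (expv g))" for k
    using \<eta> cr[of k] unfolding annihilation_def adjoint_op_def by blast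
  have "(\<lambda>k. cinner x (truncate (Suc k) \<theta>)) \<longlonglongrightarrow> cinner x \<theta>"
    by (intro tendsto_cinner tendsto_const LIMSEQ_Suc truncate_tendsto)
  moreover have "(\<lambda>k. cinner \<eta> (truncate k (expv g))) \<longlonglongrightarrow> cinner \<eta> (expv g)"
    by (intro tendsto_cinner tendsto_const truncate_tendsto)
  ultimately have "cinner x \<theta> = cinner \<eta> (expv g)" unfolding eq by (rule LIMSEQ_unique)
  then have 1: "cinner (expv g) \<eta> = cinner \<theta> x"
    using cinner_commute[of \<theta> x] cinner_commute[of "expv g" \<eta>] by simp
  have tm: "cinner (sfock_comp (Suc j) \<theta>) (sfock_comp (Suc j) x)
      = complex_of_real (sqrt \<epsilon>) * (complex_of_real (sqrt (real (Suc j)) / sqrt (fact j)) * cinner (tens (f # replicate j g)) (fock_of x))" for j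
  proof -
    have "cinner (orth_proj (sym_tensors (Suc j)) y) (sfock_comp (Suc j) x) = cinner y (sfock_comp (Suc j) x)" for y
      by (metis cinner_commute cinner_orth_proj[OF sfock_comp_mem])
    then have "cinner (sfock_comp (Suc j) \<theta>) (sfock_comp (Suc j) x)
      = complex_of_real (sqrt (\<epsilon> * real (Suc j))) * cinner (tensor f (sfock_comp j (expv g))) (sfock_comp (Suc j) x)"
      by (simp add: \<theta> cinner_scaleC_left)
    also have "cinner (tensor f (sfock_comp j (expv g))) (sfock_comp (Suc j) x)
       = complex_of_real (1 / sqrt (fact j)) * cinner (tens (f # replicate j g)) (sfock_comp (Suc j) x)"
      by (simp add: sfock_comp_expv tensor_scaleC_right cinner_scaleC_left)
    also have "cinner (tens (f # replicate j g)) (sfock_comp (Suc j) x) = cinner (tens (f # replicate j g)) (fock_of x)"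
      by (rule cinner_tens_sfock_comp) simp
    finally show ?thesis by (simp add: real_sqrt_mult del: of_nat_Suc)
  qed
  have "(\<lambda>n. cinner (sfock_comp n \<theta>) (sfock_comp n x)) sums cinner \<theta> x"
    by (rule has_sum_imp_sums[OF cinner_sfock_has_sum])
  then have "(\<lambda>j. cinner (sfock_comp (Suc j) \<theta>) (sfock_comp (Suc j) x)) sums cinner \<theta> x"
    by (subst sums_Suc_iff) (simp add: \<theta>)
  moreover have "(\<lambda>j. cinner (sfock_comp (Suc j) \<theta>) (sfock_comp (Suc j) x)) sums
      (\<Sum>j<m. cinner (sfock_comp (Suc j) \<theta>) (sfock_comp (Suc j) x))"
    by (rule sums_finite) (use m in auto)
  ultimately have "cinner \<theta> x = (\<Sum>j<m. cinner (sfock_comp (Suc j) \<theta>) (sfock_comp (Suc j) x))"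
    by (rule sums_unique2)
  then show ?thesis unfolding 1 tm expv_deriv_def sum_distrib_left .
qed

lemma power_shift_has_derivative:
  "((\<lambda>s. complex_of_real (s - s0) ^ k) has_vector_derivative (if k = 1 then 1 else 0)) (at s0)"
proof -
  have "((\<lambda>s. (s - s0) ^ k) has_real_derivative (real k * (s0 - s0) ^ (k - 1))) (at s0)"
    by (auto intro!: derivative_eq_intros)
  from has_vector_derivative_of_real[OF this, where 'a=complex]
  show ?thesis by (cases k) (auto simp: zero_power)
qed

text \<open>Expanding around \<open>s0\<close> by the binomial formula leaves a polynomial in s -
  s0, whose linear coefficient is the derivative.\<close>

lemma tens_replicate_has_derivative:
  assumes sym: "is_symmetric P"
  shows "((\<lambda>s. cinner (tens (replicate n (g + s *\<^sub>R u))) P) has_vector_derivative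
    of_nat n * cinner (tens (u # replicate (n - 1) (g + s0 *\<^sub>R u))) P) (at s0)"
proof -
  let ?g = "g + s0 *\<^sub>R u"
  let ?c = "\<lambda>k. cinner (tens (replicate k u @ replicate (n - k) ?g)) P"
  have 1: "cinner (tens (replicate n (g + s *\<^sub>R u))) P
    = (\<Sum>k\<le>n. of_nat (n choose k) * ?c k * complex_of_real (s - s0) ^ k)" for s
  proof -
    have "g + s *\<^sub>R u = (s - s0) *\<^sub>R u + ?g" by (simp add: algebra_simps)
    then have "g + s *\<^sub>R u = complex_of_real (s - s0) *\<^sub>C u + ?g" by (simp only: scaleR_scaleC)
    then have "cinner (tens (replicate n (g + s *\<^sub>R u))) P
      = cinner (tens (replicate n (complex_of_real (s - s0) *\<^sub>C u + ?g) @ [])) P"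
      by (simp only: append_Nil2)
    also have "\<dots> = (\<Sum>k\<le>n. of_nat (n choose k) * ?c k * complex_of_real (s - s0) ^ k)"
      unfolding cinner_tens_replicate_add[OF sym] tens_scaleC_replicate cinner_scaleC_left
      by (intro sum.cong refl) simp
    finally show ?thesis .
  qed
  have "((\<lambda>s. \<Sum>k\<le>n. of_nat (n choose k) * ?c k * complex_of_real (s - s0) ^ k) has_vector_derivative
      (\<Sum>k\<le>n. of_nat (n choose k) * ?c k * (if k = 1 then 1 else 0))) (at s0)"
    by (intro has_vector_derivative_sum has_vector_derivative_mult_right power_shift_has_derivative)
  also have "(\<Sum>k\<le>n. of_nat (n choose k) * ?c k * (if k = 1 then 1 else 0))
      = of_nat n * cinner (tens (u # replicate (n - 1) ?g)) P"
    by (cases n) (simp_all add: if_distrib[of "\<lambda>x. _ * x"] sum.delta cong: if_cong)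
  finally show ?thesis unfolding 1 .
qed

lemma cinner_expv_has_derivative:
  assumes m: "\<forall>n>m. sfock_comp n x = 0"
  shows "((\<lambda>s. cinner (expv (g + s *\<^sub>R u)) x) has_vector_derivative expv_deriv m x (g + s0 *\<^sub>R u) u) (at s0)"
proof -
  let ?F = "\<lambda>n. of_nat n * cinner (tens (u # replicate (n - 1) (g + s0 *\<^sub>R u))) (fock_of x) / complex_of_real (sqrt (fact n))"
  have "((\<lambda>s. \<Sum>n\<le>m. cinner (tens (replicate n (g + s *\<^sub>R u))) (fock_of x) / complex_of_real (sqrt (fact n)))
    has_vector_derivative (\<Sum>n\<le>m. ?F n)) (at s0)"
    by (intro has_vector_derivative_sum has_vector_derivative_divide tens_replicate_has_derivative symmetric_fock_of)
  also have "(\<Sum>n\<le>m. ?F n) = (\<Sum>j<m. ?F (Suc j))" by (simp add: sum.atMost_shift)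
  also have "\<dots> = expv_deriv m x (g + s0 *\<^sub>R u) u"
    unfolding expv_deriv_def
  proof (intro sum.cong refl)
    fix j
    have "real (Suc j) / sqrt (fact (Suc j)) = sqrt (real (Suc j)) / sqrt (fact j)"
      by (simp add: real_sqrt_mult field_simps del: of_nat_Suc)
    then have "of_nat (Suc j) / complex_of_real (sqrt (fact (Suc j))) = complex_of_real (sqrt (real (Suc j)) / sqrt (fact j))"
      by (metis of_real_divide of_real_of_nat_eq)
    then show "?F (Suc j) = complex_of_real (sqrt (real (Suc j)) / sqrt (fact j)) * cinner (tens (u # replicate j (g + s0 *\<^sub>R u))) (fock_of x)"
      by (metis (no_types, lifting) diff_Suc_1 mult.commute times_divide_eq_right)
  qed
  finally show ?thesis unfolding cinner_expv_finite[OF m] .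
qed

section \<open>Displacements along the field operator\<close>

definition field_graph :: "real \<Rightarrow> 'a::complex_hilbert \<Rightarrow> 'a sfock operator" where
  "field_graph \<epsilon> f = {(\<psi>, (1 / sqrt 2) *\<^sub>R (\<theta> + \<eta>)) | \<psi> \<theta> \<eta>.
    (\<psi>, \<theta>) \<in> creation \<epsilon> f \<and> (\<psi>, \<eta>) \<in> annihilation \<epsilon> f}"

text \<open>On the left vector the displacement is explicit, so for an arbitrary \<open>z\<close>
  the dependence on \<open>s\<close> is a Gaussian factor times the translated generating function
  of \<open>z\<close>.\<close>

lemma cinner_expv_displace:
  "cinner (expv g) (displace (s *\<^sub>R u) z)
    = exp (- (of_real s)\<^sup>2 * cinner u u / 2 + of_real s * cinner g u) * cinner (expv (g + s *\<^sub>R (- u))) z"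
proof -
  have 1: "- (s *\<^sub>R u) = s *\<^sub>R (- u)" by simp
  have "complex_of_real ((norm (s *\<^sub>R (- u)))\<^sup>2) = (of_real s)\<^sup>2 * cinner u u"
    unfolding cinner_self by (simp add: power_mult_distrib)
  then have 2: "complex_of_real ((norm (s *\<^sub>R (- u)))\<^sup>2 / 2) = (of_real s)\<^sup>2 * cinner u u / 2"
    by (simp del: of_real_power)
  have 3: "cnj (cinner (s *\<^sub>R (- u)) g) = - of_real s * cinner g u"
    unfolding cinner_commute[of g, symmetric]
    by (simp add: scaleR_scaleC cinner_scaleC_right cinner_minus_right scaleC_minus_right)
  have 4: "cnj (cinner u u) = cinner u u" by (rule cinner_commute[symmetric])
  show ?thesis
    unfolding cinner_displace 1 displace_expv cinner_scaleC_left exp_cnj complex_cnj_diff complex_cnj_minus 2 3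
    by (simp add: 4)
qed

text \<open>Product rule: the derivative of the Gaussian factor is the creation part of the field
  operator, that of the translation the annihilation part. In \<open>u\<close>, the root combines
  the sqrt(\<epsilon>) of \<open>creation\<close> with the 1 / sqrt 2 of the field, and \<i> comes
  from exp (\<i> \<Phi>).\<close>

lemma field_graph_has_derivative:
  fixes f :: "'a::complex_hilbert"
  assumes xy: "(x, y) \<in> field_graph \<epsilon> f" and \<epsilon>: "0 \<le> \<epsilon>"
    and u: "u = (\<i> * complex_of_real (sqrt (\<epsilon> / 2))) *\<^sub>C f"
  shows "((\<lambda>s. cinner (expv g) (displace (s *\<^sub>R u) x)) has_vector_derivative
    cinner (expv g) (displace (s0 *\<^sub>R u) (\<i> *\<^sub>C y))) (at s0)"
proof -
  obtain \<theta> \<eta> where y: "y = (1 / sqrt 2) *\<^sub>R (\<theta> + \<eta>)" "(x, \<theta>) \<in> creation \<epsilon> f" "(x, \<eta>) \<in> annihilation \<epsilon> f"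
    using xy unfolding field_graph_def by blast
  obtain m where m: "\<forall>n>m. sfock_comp n x = 0"
    using y(2) unfolding creation_def finite_particle_def by blast
  define N c where "N = cinner u u" and "c = cinner g u"
  define A where "A z = exp (- z\<^sup>2 * N / 2 + z * c)" for z
  let ?g = "\<lambda>s. g + s *\<^sub>R (- u)"
  have "(A has_field_derivative A z * (c - z * N)) (at z)" for z
    unfolding A_def by (auto intro!: derivative_eq_intros simp: algebra_simps)
  then have A': "((\<lambda>s. A (of_real s)) has_vector_derivative A (of_real s0) * (c - of_real s0 * N)) (at s0)"
    by (rule has_vector_derivative_real_field)
  have G': "((\<lambda>s. cinner (expv (?g s)) x) has_vector_derivative expv_deriv m x (?g s0) (- u)) (at s0)"
    by (rule cinner_expv_has_derivative[OF m])
  have "((\<lambda>s. cinner (expv g) (displace (s *\<^sub>R u) x)) has_vector_derivative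
    (A (of_real s0) * expv_deriv m x (?g s0) (- u) + A (of_real s0) * (c - of_real s0 * N) * cinner (expv (?g s0)) x)) (at s0)"
    unfolding cinner_expv_displace
    using has_vector_derivative_mult[OF A' G'] by (simp only: A_def N_def c_def)
  moreover have "cinner (expv g) (displace (s0 *\<^sub>R u) (\<i> *\<^sub>C y))
    = A (of_real s0) * expv_deriv m x (?g s0) (- u) + A (of_real s0) * (c - of_real s0 * N) * cinner (expv (?g s0)) x"
  proof -
    have e: "sqrt \<epsilon> / sqrt 2 = sqrt (\<epsilon> / 2)" by (simp add: real_sqrt_divide)
    have gu: "c - of_real s0 * N = cinner (?g s0) u"
      unfolding c_def N_def
      by (simp add: cinner_diff_left cinner_scaleC_left scaleR_scaleC scaleC_minus_right)
    also have "\<dots> = \<i> * complex_of_real (sqrt (\<epsilon> / 2)) * cinner (?g s0) f"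
      unfolding u by (simp only: cinner_scaleC_right)
    finally have gu: "c - of_real s0 * N = \<i> * complex_of_real (sqrt (\<epsilon> / 2)) * cinner (?g s0) f" .
    have "- u = (- 1) *\<^sub>C u" by (simp add: scaleC_minus_one)
    then have du: "expv_deriv m x (?g s0) (- u) = \<i> * complex_of_real (sqrt (\<epsilon> / 2)) * expv_deriv m x (?g s0) f"
      by (simp only: expv_deriv_scaleC u) simp
    have "cinner (expv (?g s0)) y
        = complex_of_real (1 / sqrt 2) * (cinner (expv (?g s0)) \<theta> + cinner (expv (?g s0)) \<eta>)"
      unfolding y(1) scaleR_scaleC[of "1 / sqrt 2"] cinner_scaleC_right cinner_add_right ..
    also have "\<dots> = complex_of_real (sqrt (\<epsilon> / 2)) * (cinner (?g s0) f * cinner (expv (?g s0)) x + expv_deriv m x (?g s0) f)"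
      unfolding cinner_expv_creation[OF y(2)] cinner_expv_annihilation[OF y(3) \<epsilon> m] e[symmetric]
      by (simp add: field_simps)
    finally show ?thesis
      unfolding cinner_expv_displace gu du cinner_scaleC_right
      by (simp add: A_def N_def[symmetric] c_def[symmetric] algebra_simps)
  qed
  ultimately show ?thesis by simp
qed

text \<open>The mean value inequality turns the weak derivative into a weak estimate, and density
  removes the test vector. The right-hand side depends only on the orbit of \<open>y\<close>, which
  is why the estimate survives the closure of the graph.\<close>

lemma field_graph_bound:
  fixes f :: "'a::complex_hilbert"
  assumes xy: "(x, y) \<in> field_graph \<epsilon> f" and \<epsilon>: "0 \<le> \<epsilon>"
    and u: "u = (\<i> * complex_of_real (sqrt (\<epsilon> / 2))) *\<^sub>C f"
    and \<delta>: "\<And>s. s \<in> closed_segment 0 t \<Longrightarrow> norm (displace (s *\<^sub>R u) y - y) \<le> \<delta>"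
  shows "norm (displace (t *\<^sub>R u) x - x - t *\<^sub>R (\<i> *\<^sub>C y)) \<le> \<bar>t\<bar> * \<delta>"
proof (rule norm_le_dense[OF closure_lincomb_expv_UNIV])
  let ?M = "{w::'a sfock. \<forall>s0. ((\<lambda>s. cinner w (displace (s *\<^sub>R u) x)) has_vector_derivative
    cinner w (displace (s0 *\<^sub>R u) (\<i> *\<^sub>C y))) (at s0)}"
  have "csubspace ?M"
    by (auto simp: csubspace_def cinner_add_left cinner_scaleC_left
        intro!: has_vector_derivative_add has_vector_derivative_mult_right)
  then have M: "lincomb expv UNIV \<subseteq> ?M"
    by (rule lincomb_subset) (use field_graph_has_derivative[OF xy \<epsilon> u] in blast)
  have \<delta>0: "0 \<le> \<delta>" using order_trans[OF norm_ge_zero \<delta>[of 0]] by simp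
  then show "0 \<le> \<bar>t\<bar> * \<delta>" by simp
  fix w :: "'a sfock" assume "w \<in> lincomb expv UNIV"
  then have d: "((\<lambda>s. cinner w (displace (s *\<^sub>R u) x)) has_vector_derivative
    cinner w (displace (s *\<^sub>R u) (\<i> *\<^sub>C y))) (at s within S)" for s S
    using M has_vector_derivative_at_within by blast
  have "norm (cinner w (displace (t *\<^sub>R u) x) - cinner w (displace (0 *\<^sub>R u) x)
      - (t - 0) *\<^sub>R cinner w (displace (0 *\<^sub>R u) (\<i> *\<^sub>C y))) \<le> norm (t - 0) * (norm w * \<delta>)"
  proof (rule vector_differentiable_bound_linearization[OF d, of 0 t "closed_segment 0 t"])
    fix s assume s: "s \<in> closed_segment 0 t"
    have "cinner w (displace (s *\<^sub>R u) (\<i> *\<^sub>C y)) - cinner w (displace (0 *\<^sub>R u) (\<i> *\<^sub>C y))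
       = cinner w (\<i> *\<^sub>C (displace (s *\<^sub>R u) y - y))"
      by (simp add: displace_0 lin_isometry_scaleC[OF lin_isometry_displace] cinner_diff_right scaleC_diff_right)
    then show "norm (cinner w (displace (s *\<^sub>R u) (\<i> *\<^sub>C y)) - cinner w (displace (0 *\<^sub>R u) (\<i> *\<^sub>C y))) \<le> norm w * \<delta>"

      using norm_cinner_le[of w "\<i> *\<^sub>C (displace (s *\<^sub>R u) y - y)"] mult_left_mono[OF \<delta>[OF s] norm_ge_zero[of w]]
      by (simp add: norm_scaleC)
  qed auto
  moreover have "cinner w (displace (t *\<^sub>R u) x) - cinner w (displace (0 *\<^sub>R u) x)
      - (t - 0) *\<^sub>R cinner w (displace (0 *\<^sub>R u) (\<i> *\<^sub>C y))
    = cinner w (displace (t *\<^sub>R u) x - x - t *\<^sub>R (\<i> *\<^sub>C y))"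
    by (simp add: displace_0 cinner_diff_right cinner_scaleC_right scaleR_scaleC scaleR_conv_of_real)
  ultimately show "cmod (cinner w (displace (t *\<^sub>R u) x - x - t *\<^sub>R (\<i> *\<^sub>C y))) \<le> \<bar>t\<bar> * \<delta> * norm w"
    by (simp add: mult_ac)
qed

text \<open>For graph points approximating (x, y), \<delta> is enlarged by twice the distance to
  \<open>y\<close>, once for the displaced and once for the undisplaced vector.\<close>

lemma field_op_bound:
  assumes xy: "(x, y) \<in> field_op \<epsilon> f" and \<epsilon>: "0 \<le> \<epsilon>"
    and u: "u = (\<i> * complex_of_real (sqrt (\<epsilon> / 2))) *\<^sub>C f"
    and \<delta>: "\<And>s. s \<in> closed_segment 0 t \<Longrightarrow> norm (displace (s *\<^sub>R u) y - y) \<le> \<delta>"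
  shows "norm (displace (t *\<^sub>R u) x - x - t *\<^sub>R (\<i> *\<^sub>C y)) \<le> \<bar>t\<bar> * \<delta>"
proof -
  obtain p q where pq: "\<And>n. (p n, q n) \<in> field_graph \<epsilon> f" "p \<longlonglongrightarrow> x" "q \<longlonglongrightarrow> y"
    using xy unfolding field_op_def field_graph_def[symmetric] closure_pair_sequential by blast
  have "norm (displace (t *\<^sub>R u) (p n) - p n - t *\<^sub>R (\<i> *\<^sub>C q n)) \<le> \<bar>t\<bar> * (\<delta> + 2 * norm (q n - y))" for n
  proof (rule field_graph_bound[OF pq(1) \<epsilon> u])
    fix s assume s: "s \<in> closed_segment 0 t"
    have "displace (s *\<^sub>R u) (q n) - q n = (displace (s *\<^sub>R u) y - y) + displace (s *\<^sub>R u) (q n - y) - (q n - y)"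
      by (simp add: lin_isometry_diff[OF lin_isometry_displace])
    also have "norm \<dots> \<le> norm (displace (s *\<^sub>R u) y - y) + norm (displace (s *\<^sub>R u) (q n - y)) + norm (q n - y)"
      by (rule order_trans[OF norm_triangle_ineq4 add_right_mono[OF norm_triangle_ineq]])
    also have "\<dots> \<le> \<delta> + 2 * norm (q n - y)"
      using \<delta>[OF s] by (simp add: lin_isometry_norm[OF lin_isometry_displace])
    finally show "norm (displace (s *\<^sub>R u) (q n) - q n) \<le> \<delta> + 2 * norm (q n - y)" .
  qed
  moreover have "(\<lambda>n. norm (displace (t *\<^sub>R u) (p n) - p n - t *\<^sub>R (\<i> *\<^sub>C q n)))
      \<longlonglongrightarrow> norm (displace (t *\<^sub>R u) x - x - t *\<^sub>R (\<i> *\<^sub>C y))"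
    by (intro tendsto_intros tendsto_scaleC pq
        bounded_linear.tendsto[OF bounded_linear_lin_isometry[OF lin_isometry_displace]])
  moreover have "(\<lambda>n. \<bar>t\<bar> * (\<delta> + 2 * norm (q n - y))) \<longlonglongrightarrow> \<bar>t\<bar> * (\<delta> + 2 * norm (y - y))"
    by (intro tendsto_intros pq)
  ultimately show ?thesis
    using LIMSEQ_le[of _ _ "\<lambda>n. \<bar>t\<bar> * (\<delta> + 2 * norm (q n - y))"] by auto
qed

text \<open>Strong continuity makes the \<delta> of \<open>field_op_bound\<close> arbitrarily small
  for small times.\<close>

lemma field_op_has_derivative:
  assumes xy: "(x, y) \<in> field_op \<epsilon> f" and \<epsilon>: "0 \<le> \<epsilon>"
    and u: "u = (\<i> * complex_of_real (sqrt (\<epsilon> / 2))) *\<^sub>C f"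
  shows "((\<lambda>t. displace (t *\<^sub>R u) x) has_vector_derivative \<i> *\<^sub>C y) (at 0)"
  unfolding has_vector_derivative_def has_derivative_at'
proof (intro conjI allI impI bounded_linear_scaleR_left)
  fix e :: real assume e: "0 < e"
  have "((\<lambda>t. displace (t *\<^sub>R u) y) \<longlongrightarrow> displace (0 *\<^sub>R u) y) (at 0)"
    using continuous_displace[of u y] by (simp only: continuous_on_def) blast
  then obtain d where d: "d > 0" "\<And>t. t \<noteq> 0 \<Longrightarrow> \<bar>t\<bar> < d \<Longrightarrow> norm (displace (t *\<^sub>R u) y - y) < e / 2"
    using tendstoD[of _ _ "at 0" "e/2"] e
    by (force simp: eventually_at dist_norm displace_0)
  show "\<exists>d>0. \<forall>t. 0 < norm (t - 0) \<and> norm (t - 0) < d \<longrightarrow>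
    norm (displace (t *\<^sub>R u) x - displace (0 *\<^sub>R u) x - (t - 0) *\<^sub>R \<i> *\<^sub>C y) / norm (t - 0) < e"
  proof (intro exI[of _ d] conjI allI impI d(1))
    fix t :: real assume t: "0 < norm (t - 0) \<and> norm (t - 0) < d"
    have "norm (displace (t *\<^sub>R u) x - x - t *\<^sub>R (\<i> *\<^sub>C y)) \<le> \<bar>t\<bar> * (e / 2)"
    proof (rule field_op_bound[OF xy \<epsilon> u])
      fix s assume "s \<in> closed_segment 0 t"
      then have "\<bar>s\<bar> \<le> \<bar>t\<bar>" by (auto simp: closed_segment_eq_real_ivl split: if_splits)
      then have "\<bar>s\<bar> < d" using t by simp
      then show "norm (displace (s *\<^sub>R u) y - y) \<le> e / 2"
        using d(2)[of s] e by (cases "s = 0") (auto simp: displace_0)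
    qed
    also have "\<bar>t\<bar> * (e / 2) < e * \<bar>t\<bar>" using t e by simp
    finally show "norm (displace (t *\<^sub>R u) x - displace (0 *\<^sub>R u) x - (t - 0) *\<^sub>R \<i> *\<^sub>C y) / norm (t - 0) < e"
      using t by (simp add: displace_0 divide_less_eq)
  qed
qed

text \<open>Only the closure is at stake, since exponential vectors have infinitely many particles
  in general. The approximants pair the truncation at k + 1 with creation up to degree k + 2 and
  annihilation up to degree k.\<close>

lemma expv_mem_field_op:
  assumes \<epsilon>: "0 \<le> \<epsilon>"
  shows "\<exists>y. (expv g, y) \<in> field_op \<epsilon> f"
proof -
  obtain \<theta> where \<theta>: "sfock_comp 0 \<theta> = 0" "\<And>n. sfock_comp (Suc n) \<theta> = complex_of_real (sqrt (\<epsilon> * real (Suc n))) *\<^sub>C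
    orth_proj (sym_tensors (Suc n)) (tensor f (sfock_comp n (expv g)))"
    using ex_creation_expv[OF \<epsilon>] by blast
  have cr: "(truncate k (expv g), truncate (Suc k) \<theta>) \<in> creation \<epsilon> f" for k
    unfolding creation_def finite_particle_def
    by (auto simp: sfock_comp_truncate \<theta> tensor_zero_right orth_proj_0 intro!: exI[of _ k])
  let ?\<alpha> = "complex_of_real (sqrt \<epsilon>) * cinner f g"
  have "(truncate (Suc k) (expv g), (1 / sqrt 2) *\<^sub>R (truncate (Suc (Suc k)) \<theta> + ?\<alpha> *\<^sub>C truncate k (expv g))) \<in> field_graph \<epsilon> f" for k
    unfolding field_graph_def using cr annihilation_truncate_expv by blast
  moreover have "(\<lambda>k. truncate (Suc k) (expv g)) \<longlonglongrightarrow> expv g"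
    by (intro LIMSEQ_Suc truncate_tendsto)
  moreover have "(\<lambda>k. (1 / sqrt 2) *\<^sub>R (truncate (Suc (Suc k)) \<theta> + ?\<alpha> *\<^sub>C truncate k (expv g)))
      \<longlonglongrightarrow> (1 / sqrt 2) *\<^sub>R (\<theta> + ?\<alpha> *\<^sub>C expv g)"
    by (intro tendsto_scaleR tendsto_add tendsto_const tendsto_scaleC truncate_tendsto
        LIMSEQ_Suc[OF LIMSEQ_Suc[OF truncate_tendsto]])
  ultimately have "(expv g, (1 / sqrt 2) *\<^sub>R (\<theta> + ?\<alpha> *\<^sub>C expv g)) \<in> field_op \<epsilon> f"
    unfolding field_op_def field_graph_def[symmetric] closure_pair_sequential
    by (intro exI[of _ "\<lambda>k. truncate (Suc k) (expv g)"]
        exI[of _ "\<lambda>k. (1 / sqrt 2) *\<^sub>R (truncate (Suc (Suc k)) \<theta> + ?\<alpha> *\<^sub>C truncate k (expv g))"]) auto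
  then show ?thesis by blast
qed

section \<open>Uniqueness of the unitary group\<close>

lemma unitary_lin_isometry: "unitary U \<Longrightarrow> lin_isometry U"
  by (simp add: unitary_def lin_isometry_def)

text \<open>Both groups have the same derivative along exponential vectors, which displacement maps to
  multiples of exponential vectors; hence \<open>U (- s) (displace (s u) (expv g))\<close> is constant in \<open>s\<close>.\<close>

lemma unitary_group_unique:
  fixes U :: "real \<Rightarrow> 'a::complex_hilbert sfock \<Rightarrow> 'a sfock"
  assumes U: "unitary_group U" and \<epsilon>: "0 \<le> \<epsilon>"
    and dU: "\<And>x y. (x, y) \<in> field_op \<epsilon> f \<Longrightarrow> ((\<lambda>t. U t x) has_vector_derivative \<i> *\<^sub>C y) (at 0)"
    and u: "u = (\<i> * complex_of_real (sqrt (\<epsilon> / 2))) *\<^sub>C f"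
  shows "U s = displace (s *\<^sub>R u)"
proof (rule lin_isometry_eqI[OF _ lin_isometry_displace closure_lincomb_expv_UNIV])
  have iso: "lin_isometry (U t)" for t using U unitary_lin_isometry[of "U t"] by (simp add: unitary_group_def)
  then show "lin_isometry (U s)" .
  have Uadd: "U (s + t) x = U s (U t x)" for s t x using U by (simp add: unitary_group_def)
  \<comment> \<open>\<open>unitary_group\<close> does not state this: \<open>U 0\<close> is an
    idempotent isometry, hence the identity.\<close>
  have U0: "U 0 x = x" for x
  proof -
    have "norm (U 0 (U 0 x - x)) = 0"
      using Uadd[of 0 0 x] by (simp add: lin_isometry_diff[OF iso])
    then show ?thesis by (simp add: lin_isometry_norm[OF iso])
  qed
  let ?D = "\<lambda>t. displace (t *\<^sub>R u)"
  fix g :: 'a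
  let ?z = "\<lambda>s. U (- s) (?D s (expv g))"
  have "(?z has_derivative (\<lambda>h. 0)) (at s)" for s
    unfolding has_derivative_at
  proof
    \<comment> \<open>The displaced vector at time \<open>s\<close> is \<open>?c\<close> times the
      exponential vector \<open>?e\<close>, so derivatives at 0 along exponential vectors suffice
      for every \<open>s\<close>.\<close>
    let ?c = "exp (- of_real ((norm (s *\<^sub>R u))\<^sup>2 / 2) - cinner (s *\<^sub>R u) g)"
    let ?e = "expv (g + s *\<^sub>R u)"
    obtain y where y: "(?e, y) \<in> field_op \<epsilon> f" using expv_mem_field_op[OF \<epsilon>] by blast
    have D1: "((\<lambda>h. ?D h ?e - U h ?e) has_vector_derivative (\<i> *\<^sub>C y - \<i> *\<^sub>C y)) (at 0)"
      by (intro has_vector_derivative_diff field_op_has_derivative[OF y \<epsilon> u] dU[OF y])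
    have "((\<lambda>h. ?D h ?e - U h ?e) has_derivative (\<lambda>h. 0)) (at 0)"
      using D1 by (simp add: has_vector_derivative_def)
    then have "(\<lambda>h. norm (?D h ?e - U h ?e) / norm h) \<midarrow>0\<rightarrow> 0"
      by (simp add: has_derivative_at displace_0 U0)
    then have lim: "(\<lambda>h. cmod ?c * (norm (?D h ?e - U h ?e) / norm h)) \<midarrow>0\<rightarrow> cmod ?c * 0"
      by (rule tendsto_mult_left)
    have eq: "norm (?z (s + h) - ?z s - 0) / norm h = cmod ?c * (norm (?D h ?e - U h ?e) / norm h)" for h
    proof -
      have "?z (s + h) = U (- (s + h)) (?D h (?D s (expv g)))"
        by (simp add: displace_scaleR_add add.commute)
      moreover have "?z s = U (- (s + h)) (U h (?D s (expv g)))"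
        by (simp flip: Uadd)
      ultimately have "norm (?z (s + h) - ?z s) = norm (?D h (?D s (expv g)) - U h (?D s (expv g)))"
        by (simp only: lin_isometry_diff[OF iso, symmetric] lin_isometry_norm[OF iso])
      also have "?D h (?D s (expv g)) - U h (?D s (expv g)) = ?c *\<^sub>C (?D h ?e - U h ?e)"
        unfolding displace_expv[of "s *\<^sub>R u"]
        by (simp only: lin_isometry_scaleC[OF iso] lin_isometry_scaleC[OF lin_isometry_displace] scaleC_diff_right)
      finally show ?thesis by (simp add: norm_scaleC)
    qed
    show "(\<lambda>h. norm (?z (s + h) - ?z s - 0) / norm h) \<midarrow>0\<rightarrow> 0"
      using lim unfolding eq mult_zero_right .
  qed simp
  then obtain c where "\<And>s. ?z s = c"
    using has_derivative_zero_constant[of UNIV ?z] by auto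
  then have "?z s = ?z 0" by metis
  then have "U s (?z s) = U s (expv g)" by (simp add: displace_0 U0)
  then show "U s (expv g) = ?D s (expv g)" by (simp add: U0 flip: Uadd)
qed

theorem weyl_eq_displace:
  assumes \<epsilon>: "0 \<le> \<epsilon>"
  shows "weyl \<epsilon> f = displace ((\<i> * complex_of_real (sqrt (\<epsilon> / 2))) *\<^sub>C f)" (is "_ = displace ?u")
proof -
  have "(THE U. unitary_group U \<and> (\<forall>(x, y)\<in>field_op \<epsilon> f. ((\<lambda>t. U t x) has_vector_derivative \<i> *\<^sub>C y) (at 0)))
    = (\<lambda>t. displace (t *\<^sub>R ?u))"
  proof (rule the_equality)
    show "unitary_group (\<lambda>t. displace (t *\<^sub>R ?u)) \<and>
      (\<forall>(x, y)\<in>field_op \<epsilon> f. ((\<lambda>t. displace (t *\<^sub>R ?u) x) has_vector_derivative \<i> *\<^sub>C y) (at 0))"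
      using unitary_group_displace field_op_has_derivative[OF _ \<epsilon> refl] by auto
  next
    fix U assume U: "unitary_group U \<and> (\<forall>(x, y)\<in>field_op \<epsilon> f. ((\<lambda>t. U t x) has_vector_derivative \<i> *\<^sub>C y) (at 0))"
    show "U = (\<lambda>t. displace (t *\<^sub>R ?u))"
    proof
      show "U s = displace (s *\<^sub>R ?u)" for s
        by (rule unitary_group_unique[OF conjunct1[OF U] \<epsilon> _ refl]) (use U in auto)
    qed
  qed
  then show ?thesis unfolding weyl_def exp_i_def by simp
qed

section \<open>Coefficients in a real basis\<close>

text \<open>Being additive and norm preserving, \<open>c\<close> preserves the real inner product;
  antilinearity reverses the sign of the imaginary part.\<close>

lemma conjugation_cinner:
  assumes c: "conjugation c" shows "cinner (c x) (c y) = cnj (cinner x y)"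
proof -
  have nm: "norm (c x) = norm x" and ad: "c (x + y) = c x + c y" and sc: "c (\<alpha> *\<^sub>C x) = cnj \<alpha> *\<^sub>C c x" for x y \<alpha>
    using c by (auto simp: conjugation_def)
  have 1: "inner (c x) (c y) = inner x y" for x y
    by (simp add: dot_norm nm flip: ad)
  have "\<i> *\<^sub>C c x = - c (\<i> *\<^sub>C x)" by (simp add: sc scaleC_minus_left)
  then show ?thesis
    unfolding cinner_inner by (simp add: 1)
qed

definition real_basis :: "('a::complex_hilbert \<Rightarrow> 'a) \<Rightarrow> 'a set \<Rightarrow> bool" where
  "real_basis c R \<longleftrightarrow> orthonormal_basis R \<and> (\<forall>r\<in>R. c r = r)"

lemma real_decomposition:
  assumes c: "conjugation c"
  shows "c ((1/2) *\<^sub>C (x + c x)) = (1/2) *\<^sub>C (x + c x)"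
    and "c ((- \<i> / 2) *\<^sub>C (x - c x)) = (- \<i> / 2) *\<^sub>C (x - c x)"
    and "x = (1/2) *\<^sub>C (x + c x) + \<i> *\<^sub>C ((- \<i> / 2) *\<^sub>C (x - c x))"
proof -
  have ad: "c (x + y) = c x + c y" and sc: "c (\<alpha> *\<^sub>C x) = cnj \<alpha> *\<^sub>C c x" and cc: "c (c x) = x" for x y \<alpha>
    using c by (auto simp: conjugation_def)
  have mi: "c (x - y) = c x - c y" for x y
    using ad[of x "- y"] sc[of "-1" y] by (simp add: scaleC_minus_one)
  show "c ((1/2) *\<^sub>C (x + c x)) = (1/2) *\<^sub>C (x + c x)"
    by (simp add: sc ad cc add.commute)
  show "c ((- \<i> / 2) *\<^sub>C (x - c x)) = (- \<i> / 2) *\<^sub>C (x - c x)"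
    by (simp add: sc mi cc scaleC_diff_right scaleC_minus_left)
  have "x = (1/2) *\<^sub>C x + (1/2) *\<^sub>C x" by (simp flip: scaleC_add_left)
  then show "x = (1/2) *\<^sub>C (x + c x) + \<i> *\<^sub>C ((- \<i> / 2) *\<^sub>C (x - c x))"
    by (simp add: scaleC_scaleC scaleC_add_right scaleC_diff_right)
qed

text \<open>A vector orthogonal to a maximal system of real vectors has real and imaginary parts
  orthogonal to it as well, because the basis vectors are fixed by \<open>c\<close>; both parts then
  vanish by maximality.\<close>

lemma ex_real_basis:
  fixes c :: "'a::complex_hilbert \<Rightarrow> 'a"
  assumes c: "conjugation c" shows "\<exists>R. real_basis c R"
proof -
  obtain R where R: "orthonormal R" "R \<subseteq> {x. c x = x}"
    and max: "\<And>u. u \<in> {x. c x = x} \<Longrightarrow> cinner u u = 1 \<Longrightarrow> \<exists>b\<in>R. cinner b u \<noteq> 0"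
    using ex_maximal_orthonormal[of "{x. c x = x}"] by blast
  have real0: "y = 0" if y: "c y = y" "\<And>r. r \<in> R \<Longrightarrow> cinner r y = 0" for y
  proof (rule ccontr)
    assume "y \<noteq> 0"
    define u where "u = complex_of_real (inverse (norm y)) *\<^sub>C y"
    have "cinner u u = 1"
      using \<open>y \<noteq> 0\<close> by (simp add: cinner_self u_def norm_scaleC norm_inverse)
    moreover have "c u = complex_of_real (inverse (norm y)) *\<^sub>C y"
      using c y(1) unfolding u_def conjugation_def by (metis complex_cnj_complex_of_real)
    then have "u \<in> {x. c x = x}" by (simp add: u_def)
    moreover have "cinner r u = 0" if "r \<in> R" for r using y(2)[OF that] by (simp add: u_def cinner_scaleC_right)
    ultimately show False using max by blast
  qed
  have "x = 0" if x: "\<forall>r\<in>R. cinner r x = 0" for x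
  proof -
    define y z where yz: "y = (1/2) *\<^sub>C (x + c x)" "z = (- \<i> / 2) *\<^sub>C (x - c x)"
    have rc: "cinner r (c x) = 0" if "r \<in> R" for r
    proof -
      have "c r = r" using R(2) that by blast
      then show ?thesis using conjugation_cinner[OF c, of r x] x that by simp
    qed
    have "cinner r y = 0" "cinner r z = 0" if "r \<in> R" for r
      unfolding yz using x rc[OF that] that
      by (simp_all add: cinner_scaleC_right cinner_add_right cinner_diff_right)
    then have "y = 0" "z = 0"
      using real0[of y] real0[of z] real_decomposition(1,2)[OF c, of x] by (simp_all only: yz)
    then show "x = 0" using real_decomposition(3)[OF c, of x] unfolding yz[symmetric] by simp
  qed
  then have "real_basis c R" using R unfolding real_basis_def orthonormal_basis_def by blast
  then show ?thesis by blast
qed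

lemma cinner_tens_orthonormal:
  assumes R: "orthonormal R"
  shows "set xs \<subseteq> R \<Longrightarrow> set ys \<subseteq> R \<Longrightarrow> cinner (tens xs) (tens ys) = (if xs = ys then 1 else 0)"
proof (induction xs arbitrary: ys)
  case Nil
  then show ?case using cinner_tens[of "[]" ys] by (cases ys) auto
next
  case (Cons x xs)
  show ?case
  proof (cases ys)
    case Nil
    then show ?thesis using cinner_tens[of "x # xs" "[]"] by simp
  next
    case (Cons y ys')
    have "cinner x y = (if x = y then 1 else 0)"
      using R Cons Cons.prems by (auto simp: orthonormal_def)
    then show ?thesis using Cons Cons.prems Cons.IH[of ys'] by (simp add: cinner_tensor)
  qed
qed

lemma bounded_linear_tens: "bounded_linear (\<lambda>z. tens (as @ z # zs))"
proof (induction as)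
  case (Cons a as)
  then show ?case using bounded_linear_compose[OF bounded_linear_tensor_right Cons] by simp
qed (simp add: bounded_linear_tensor_left)

text \<open>\<open>R\<close> is unrelated to the basis underlying the list model. A general tensor
  is reached by expanding its factors in \<open>R\<close> one at a time, \<open>as\<close> being the
  factors already expanded.\<close>

lemma tens_total_basis:
  assumes R: "orthonormal_basis R" and 0: "\<And>xs. set xs \<subseteq> R \<Longrightarrow> cinner (tens xs) \<psi> = 0"
  shows "\<psi> = 0"
proof -
  have "set as \<subseteq> R \<Longrightarrow> cinner \<psi> (tens (as @ zs)) = 0" for as zs
  proof (induction zs arbitrary: as)
    case Nil
    then show ?case using 0[of as] cinner_commute[of \<psi>] by simp
  next
    case (Cons z zs)
    have "((\<lambda>r. cinner \<psi> (tens (as @ (cinner r z *\<^sub>C r) # zs))) has_sum cinner \<psi> (tens (as @ z # zs))) R"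
      by (rule has_sum_bounded_linear[OF bounded_linear_compose[OF bounded_linear_cinner_right bounded_linear_tens]
            basis_expansion[OF R]])
    moreover have "cinner \<psi> (tens (as @ (cinner r z *\<^sub>C r) # zs)) = 0" if r: "r \<in> R" for r
    proof -
      have "tens (as @ (\<alpha> *\<^sub>C r) # zs) = \<alpha> *\<^sub>C tens (as @ r # zs)" for \<alpha>
        by (induction as) (simp_all add: tensor_scaleC_left tensor_scaleC_right)
      moreover have "cinner \<psi> (tens ((as @ [r]) @ zs)) = 0"
        by (rule Cons.IH) (use r Cons.prems in auto)
      ultimately show ?thesis by (simp add: cinner_scaleC_right)
    qed
    ultimately show ?case using has_sum_unique has_sum_0 by (metis (no_types, lifting))
  qed
  from this[of "[]"] show ?thesis
    by (intro tens_total) (metis append_Nil cinner_commute complex_cnj_zero empty_set empty_subsetI)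
qed

definition words :: "'a set \<Rightarrow> nat \<Rightarrow> 'a list set" where
  "words R n = {xs. set xs \<subseteq> R \<and> length xs = n}"

text \<open>The words over \<open>R\<close> give an orthonormal basis of the full Fock space;
  projecting to degree \<open>n\<close> keeps those of length \<open>n\<close>.\<close>

lemma parseval_words:
  assumes R: "orthonormal_basis R"
  shows "((\<lambda>xs. cnj (cinner (tens xs) \<psi>) * cinner (tens xs) \<phi>) has_sum cinner (fock_comp n \<psi>) \<phi>) (words R n)"
proof -
  have on: "orthonormal R" using R by (simp add: orthonormal_basis_def)
  have inj: "inj_on tens {xs. set xs \<subseteq> R}"
  proof (rule inj_onI)
    fix xs ys assume *: "xs \<in> {xs. set xs \<subseteq> R}" "ys \<in> {xs. set xs \<subseteq> R}" "tens xs = tens ys"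
    then have "cinner (tens xs) (tens ys) = 1" using cinner_tens_orthonormal[OF on, of ys ys] by simp
    then show "xs = ys" using * cinner_tens_orthonormal[OF on, of xs ys] by (simp split: if_splits)
  qed
  have "orthonormal (tens ` {xs. set xs \<subseteq> R})"
    unfolding orthonormal_def using cinner_tens_orthonormal[OF on] inj_on_eq_iff[OF inj] by auto
  then have "orthonormal_basis (tens ` {xs. set xs \<subseteq> R})"
    unfolding orthonormal_basis_def using tens_total_basis[OF R] by auto
  from parseval[OF this, of "fock_comp n \<psi>" \<phi>]
  have "((\<lambda>xs. cnj (cinner (tens xs) (fock_comp n \<psi>)) * cinner (tens xs) \<phi>) has_sum cinner (fock_comp n \<psi>) \<phi>)
      {xs. set xs \<subseteq> R}"
    by (subst (asm) has_sum_reindex[OF inj]) (simp add: o_def)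
  then show ?thesis
    by (rule has_sum_cong_neutral[THEN iffD1, rotated -1]) (auto simp: words_def cinner_tens_comp)
qed

lemma parseval_words_append:
  assumes R: "orthonormal_basis R"
  shows "((\<lambda>(I, J). cnj (cinner (tens (I @ J)) \<psi>) * cinner (tens (I @ J)) \<phi>)
    has_sum cinner (fock_comp (i + j) \<psi>) \<phi>) (words R i \<times> words R j)"
proof -
  have "((\<lambda>xs. cnj (cinner (tens xs) \<psi>) * cinner (tens xs) \<phi>) has_sum cinner (fock_comp (i + j) \<psi>) \<phi>) (words R (i + j))"
    by (rule parseval_words[OF R])
  then show ?thesis
  proof (rule has_sum_reindex_bij_witness[THEN iffD1, rotated -1])
    show "(\<lambda>(I, J). I @ J) ((\<lambda>xs. (take i xs, drop i xs)) xs) = xs" for xs :: "'a list" by simp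
    show "(\<lambda>xs. (take i xs, drop i xs)) xs \<in> words R i \<times> words R j" if "xs \<in> words R (i + j)" for xs
      using that by (auto simp: words_def dest: in_set_takeD in_set_dropD)
    show "(\<lambda>xs. (take i xs, drop i xs)) ((\<lambda>(I, J). I @ J) p) = p" if "p \<in> words R i \<times> words R j" for p
      using that by (auto simp: words_def)
    show "(\<lambda>(I, J). I @ J) p \<in> words R (i + j)" if "p \<in> words R i \<times> words R j" for p
      using that by (auto simp: words_def)
  qed auto
qed

lemma norm_words_append:
  assumes R: "orthonormal_basis R"
  shows "((\<lambda>(I, J). (cmod (cinner (tens (I @ J)) \<psi>))\<^sup>2) has_sum (norm (fock_comp (i + j) \<psi>))\<^sup>2) (words R i \<times> words R j)"
proof -
  have "cinner (fock_comp (i + j) \<psi>) \<psi> = complex_of_real ((norm (fock_comp (i + j) \<psi>))\<^sup>2)"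
    using cinner_comp_comp[of "i + j" \<psi> \<psi>] cinner_fock_comp[of "i + j" \<psi> \<psi>] by (simp add: cinner_self)
  then show ?thesis
    using has_sum_Re[OF parseval_words_append[OF R, of \<psi> \<psi> i j]]
    by (simp add: cnj_mult_self case_prod_unfold del: of_real_power)
qed

section \<open>The trilinear form of the product\<close>

text \<open>The trace inequality for three Hilbert-Schmidt matrices: Cauchy-Schwarz in (i, j), then
  in l for each entry of the product.\<close>

lemma cauchy_schwarz_triple:
  fixes a b c :: "_ \<Rightarrow> _ \<Rightarrow> real"
  shows "(\<Sum>i\<in>A. \<Sum>l\<in>C. \<Sum>j\<in>B. a i j * b i l * c l j)
    \<le> sqrt (\<Sum>i\<in>A. \<Sum>j\<in>B. (a i j)\<^sup>2) * sqrt (\<Sum>i\<in>A. \<Sum>l\<in>C. (b i l)\<^sup>2) * sqrt (\<Sum>l\<in>C. \<Sum>j\<in>B. (c l j)\<^sup>2)"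
proof -
  let ?d = "\<lambda>i j. \<Sum>l\<in>C. b i l * c l j"
  have "(\<Sum>i\<in>A. \<Sum>l\<in>C. \<Sum>j\<in>B. a i j * b i l * c l j) = (\<Sum>i\<in>A. \<Sum>j\<in>B. a i j * ?d i j)"
    unfolding sum_distrib_left by (subst sum.swap) (simp add: mult.assoc)
  also have "\<dots> = (\<Sum>p\<in>A \<times> B. (\<lambda>(i, j). a i j) p * (\<lambda>(i, j). ?d i j) p)"
    by (simp add: sum.cartesian_product case_prod_beta)
  also have "\<dots> \<le> sqrt (\<Sum>p\<in>A \<times> B. ((\<lambda>(i, j). a i j) p)\<^sup>2) * sqrt (\<Sum>p\<in>A \<times> B. ((\<lambda>(i, j). ?d i j) p)\<^sup>2)"
    unfolding real_sqrt_mult[symmetric] by (rule real_le_rsqrt[OF Cauchy_Schwarz_ineq_sum])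
  also have "\<dots> = sqrt (\<Sum>i\<in>A. \<Sum>j\<in>B. (a i j)\<^sup>2) * sqrt (\<Sum>i\<in>A. \<Sum>j\<in>B. (?d i j)\<^sup>2)"
    by (simp add: sum.cartesian_product case_prod_beta)
  also have "\<dots> \<le> sqrt (\<Sum>i\<in>A. \<Sum>j\<in>B. (a i j)\<^sup>2) * sqrt (\<Sum>i\<in>A. \<Sum>j\<in>B. (\<Sum>l\<in>C. (b i l)\<^sup>2) * (\<Sum>l\<in>C. (c l j)\<^sup>2))"
    by (intro mult_left_mono real_sqrt_le_mono sum_mono Cauchy_Schwarz_ineq_sum real_sqrt_ge_zero sum_nonneg) auto
  also have "(\<Sum>i\<in>A. \<Sum>j\<in>B. (\<Sum>l\<in>C. (b i l)\<^sup>2) * (\<Sum>l\<in>C. (c l j)\<^sup>2))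
      = (\<Sum>i\<in>A. \<Sum>l\<in>C. (b i l)\<^sup>2) * (\<Sum>l\<in>C. \<Sum>j\<in>B. (c l j)\<^sup>2)"
    unfolding sum.swap[of "\<lambda>l j. (c l j)\<^sup>2" B C] by (simp add: sum_product)
  finally show ?thesis by (simp add: real_sqrt_mult mult.assoc)
qed

text \<open>\<open>I\<close> and \<open>J\<close> pair \<open>w\<close> with \<open>v\<close> and
  with \<open>\<psi>\<close>, and \<open>L\<close> contracts \<open>v\<close> with
  \<open>\<psi>\<close>. Neither factor is conjugated in the sum over \<open>L\<close>; over a real
  basis this is, letter by letter, the bilinear pairing <c x, y>.\<close>

definition tri_term :: "'a::complex_hilbert set \<Rightarrow> nat \<Rightarrow> nat \<Rightarrow> nat \<Rightarrow> 'a fock \<Rightarrow> 'a fock \<Rightarrow> 'a fock \<Rightarrow>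
    ('a list \<times> 'a list) \<times> 'a list \<Rightarrow> complex" where
  "tri_term R i l j w v \<psi> = (\<lambda>((I, L), J).
    cnj (cinner (tens (I @ J)) w) * cinner (tens (I @ L)) v * cinner (tens (L @ J)) \<psi>)"

lemma tri_term_sum_le:
  assumes R: "orthonormal_basis R" and F: "finite F" "F \<subseteq> (words R i \<times> words R l) \<times> words R j"
  shows "(\<Sum>p\<in>F. cmod (tri_term R i l j w v \<psi> p))
    \<le> norm (fock_comp (i + j) w) * norm (fock_comp (i + l) v) * norm (fock_comp (l + j) \<psi>)"
proof -
  \<comment> \<open>Enlarging \<open>F\<close> to a product of finite sets gives a sum over a full
    box, as \<open>cauchy_schwarz_triple\<close> requires.\<close>
  define A C B where "A = fst ` fst ` F" and "C = snd ` fst ` F" and "B = snd ` F"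
  have fin: "finite A" "finite B" "finite C" using F(1) by (simp_all add: A_def B_def C_def)
  have sub: "A \<subseteq> words R i" "C \<subseteq> words R l" "B \<subseteq> words R j"
    using F(2) unfolding A_def B_def C_def by fastforce+
  have Fs: "F \<subseteq> (A \<times> C) \<times> B" unfolding A_def B_def C_def by force
  have nb: "sqrt (\<Sum>x\<in>X. \<Sum>y\<in>Y. (cmod (cinner (tens (x @ y)) u))\<^sup>2) \<le> norm (fock_comp (p + q) u)"
    if "finite X" "finite Y" "X \<subseteq> words R p" "Y \<subseteq> words R q" for X Y p q u
  proof (rule real_le_lsqrt)
    have "(\<Sum>z\<in>X \<times> Y. (\<lambda>(x, y). (cmod (cinner (tens (x @ y)) u))\<^sup>2) z) \<le> (norm (fock_comp (p + q) u))\<^sup>2"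
      by (rule finite_sum_le_has_sum[OF norm_words_append[OF R]]) (use that in auto)
    then show "(\<Sum>x\<in>X. \<Sum>y\<in>Y. (cmod (cinner (tens (x @ y)) u))\<^sup>2) \<le> (norm (fock_comp (p + q) u))\<^sup>2"
      by (simp add: sum.cartesian_product case_prod_beta)
  qed (auto intro!: sum_nonneg)
  have "(\<Sum>p\<in>F. cmod (tri_term R i l j w v \<psi> p)) \<le> (\<Sum>p\<in>(A \<times> C) \<times> B. cmod (tri_term R i l j w v \<psi> p))"
    by (rule sum_mono2) (use fin Fs in auto)
  also have "\<dots> = (\<Sum>I\<in>A. \<Sum>L\<in>C. \<Sum>J\<in>B. cmod (cinner (tens (I @ J)) w) * cmod (cinner (tens (I @ L)) v) * cmod (cinner (tens (L @ J)) \<psi>))"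
    by (simp add: sum.cartesian_product' tri_term_def norm_mult)
  also have "\<dots> \<le> sqrt (\<Sum>I\<in>A. \<Sum>J\<in>B. (cmod (cinner (tens (I @ J)) w))\<^sup>2) * sqrt (\<Sum>I\<in>A. \<Sum>L\<in>C. (cmod (cinner (tens (I @ L)) v))\<^sup>2)
      * sqrt (\<Sum>L\<in>C. \<Sum>J\<in>B. (cmod (cinner (tens (L @ J)) \<psi>))\<^sup>2)"
    by (rule cauchy_schwarz_triple)
  also have "\<dots> \<le> norm (fock_comp (i + j) w) * norm (fock_comp (i + l) v) * norm (fock_comp (l + j) \<psi>)"
    by (intro mult_mono nb fin sub mult_nonneg_nonneg real_sqrt_ge_zero sum_nonneg) auto
  finally show ?thesis .
qed

lemma tri_term_abs_summable:
  assumes R: "orthonormal_basis R"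
  shows "(\<lambda>p. cmod (tri_term R i l j w v \<psi> p)) summable_on (words R i \<times> words R l) \<times> words R j"
  by (rule nonneg_bdd_above_summable_on)
    (auto intro!: bdd_aboveI2 tri_term_sum_le[OF R])

definition tri :: "'a::complex_hilbert set \<Rightarrow> nat \<Rightarrow> nat \<Rightarrow> nat \<Rightarrow> 'a fock \<Rightarrow> 'a fock \<Rightarrow> 'a fock \<Rightarrow> complex" where
  "tri R i l j w v \<psi> = (\<Sum>\<^sub>\<infinity>p\<in>(words R i \<times> words R l) \<times> words R j. tri_term R i l j w v \<psi> p)"

lemma tri_has_sum:
  assumes R: "orthonormal_basis R"
  shows "(tri_term R i l j w v \<psi> has_sum tri R i l j w v \<psi>) ((words R i \<times> words R l) \<times> words R j)"
  unfolding tri_def by (rule has_sum_infsum[OF abs_summable_summable[OF tri_term_abs_summable[OF R]]])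

lemma tri_bound:
  assumes R: "orthonormal_basis R"
  shows "cmod (tri R i l j w v \<psi>) \<le> norm (fock_comp (i + j) w) * norm (fock_comp (i + l) v) * norm (fock_comp (l + j) \<psi>)"
proof -
  have "cmod (tri R i l j w v \<psi>) \<le> (\<Sum>\<^sub>\<infinity>p\<in>(words R i \<times> words R l) \<times> words R j. cmod (tri_term R i l j w v \<psi> p))"
    unfolding tri_def by (rule norm_infsum_bound[OF tri_term_abs_summable[OF R]])
  also have "\<dots> \<le> norm (fock_comp (i + j) w) * norm (fock_comp (i + l) v) * norm (fock_comp (l + j) \<psi>)"
    by (rule infsum_le_finite_sums[OF tri_term_abs_summable[OF R] tri_term_sum_le[OF R]])
  finally show ?thesis .
qed

lemma tri_linear:
  assumes R: "orthonormal_basis R"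
  shows tri_add_right: "tri R i l j w v (\<psi> + \<phi>) = tri R i l j w v \<psi> + tri R i l j w v \<phi>"
    and tri_scaleC_right: "tri R i l j w v (\<alpha> *\<^sub>C \<psi>) = \<alpha> * tri R i l j w v \<psi>"
    and tri_add_left: "tri R i l j (w + w') v \<psi> = tri R i l j w v \<psi> + tri R i l j w' v \<psi>"
    and tri_scaleC_left: "tri R i l j (\<alpha> *\<^sub>C w) v \<psi> = cnj \<alpha> * tri R i l j w v \<psi>"
proof -
  have "tri_term R i l j w v (\<psi> + \<phi>) = (\<lambda>p. tri_term R i l j w v \<psi> p + tri_term R i l j w v \<phi> p)"
    by (auto simp: tri_term_def cinner_add_right distrib_left)
  from tri_has_sum[OF R, of i l j w v "\<psi> + \<phi>", unfolded this] has_sum_add[OF tri_has_sum[OF R] tri_has_sum[OF R]]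
  show "tri R i l j w v (\<psi> + \<phi>) = tri R i l j w v \<psi> + tri R i l j w v \<phi>"
    by (rule has_sum_unique)
  have "tri_term R i l j w v (\<alpha> *\<^sub>C \<psi>) = (\<lambda>p. \<alpha> * tri_term R i l j w v \<psi> p)"
    by (auto simp: tri_term_def cinner_scaleC_right)
  from tri_has_sum[OF R, of i l j w v "\<alpha> *\<^sub>C \<psi>", unfolded this] has_sum_cmult_right[OF tri_has_sum[OF R]]
  show "tri R i l j w v (\<alpha> *\<^sub>C \<psi>) = \<alpha> * tri R i l j w v \<psi>"
    by (rule has_sum_unique)
  have "tri_term R i l j (w + w') v \<psi> = (\<lambda>p. tri_term R i l j w v \<psi> p + tri_term R i l j w' v \<psi> p)"
    by (auto simp: tri_term_def cinner_add_right distrib_right)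
  from tri_has_sum[OF R, of i l j "w + w'" v \<psi>, unfolded this] has_sum_add[OF tri_has_sum[OF R] tri_has_sum[OF R]]
  show "tri R i l j (w + w') v \<psi> = tri R i l j w v \<psi> + tri R i l j w' v \<psi>"
    by (rule has_sum_unique)
  have "tri_term R i l j (\<alpha> *\<^sub>C w) v \<psi> = (\<lambda>p. cnj \<alpha> * tri_term R i l j w v \<psi> p)"
    by (auto simp: tri_term_def cinner_scaleC_right)
  from tri_has_sum[OF R, of i l j "\<alpha> *\<^sub>C w" v \<psi>, unfolded this] has_sum_cmult_right[OF tri_has_sum[OF R]]
  show "tri R i l j (\<alpha> *\<^sub>C w) v \<psi> = cnj \<alpha> * tri R i l j w v \<psi>"
    by (rule has_sum_unique)
qed

lemma cinner_tens_append_replicate: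
  "length I = i \<Longrightarrow> length L = l \<Longrightarrow> cinner (tens (I @ L)) (tens (replicate i h @ replicate l g))
    = (\<Prod>x\<in>#mset I. cinner x h) * (\<Prod>x\<in>#mset L. cinner x g)"
proof (induction I arbitrary: i)
  case Nil
  then show ?case by (simp add: cinner_tens_replicate)
next
  case (Cons x I)
  then show ?case by (cases i) (simp_all add: cinner_tensor)
qed

text \<open>Everything factorises over the words. The sum over \<open>J\<close> is Parseval for
  \<open>h\<close> and \<open>f\<close>; in the contraction a real basis vector satisfies <r, f> =
  cnj <r, c f>, which moves \<open>f\<close> to the left side of the pairing with \<open>v\<close>
  as \<open>c f\<close>.\<close>

lemma tri_expv:
  assumes c: "conjugation c" and RB: "real_basis c R"
  shows "tri R i l j (fock_of (expv h)) v (fock_of (expv f)) =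
    cinner h f ^ j * cinner (tens (replicate i h @ replicate l (c f))) v
      / (complex_of_real (sqrt (fact (i + j))) * complex_of_real (sqrt (fact (l + j))))"
proof -
  have R: "orthonormal_basis R" and Rc: "\<And>r. r \<in> R \<Longrightarrow> c r = r" using RB by (auto simp: real_basis_def)
  let ?pr = "\<lambda>I g. \<Prod>x\<in>#mset I. cinner x g"
  let ?K = "complex_of_real (sqrt (fact (i + j))) * complex_of_real (sqrt (fact (l + j)))"
  let ?X = "\<lambda>(I, L). cnj (?pr I h * ?pr L (c f)) * cinner (tens (I @ L)) v"
  let ?Y = "\<lambda>J. cnj (?pr J h) * ?pr J f"
  have real: "?pr L f = cnj (?pr L (c f))" if L: "set L \<subseteq> R" for L
    using L
  proof (induction L)
    case (Cons x L)
    have "cinner x f = cnj (cinner x (c f))"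
      using conjugation_cinner[OF c, of x f] Rc[of x] Cons.prems by simp
    then show ?case using Cons by simp
  qed simp
  have tt: "tri_term R i l j (fock_of (expv h)) v (fock_of (expv f)) (p, J) = ?X p * ?Y J / ?K"
    if "p \<in> words R i \<times> words R l" "J \<in> words R j" for p J
    using that real[of "snd p"]
    by (cases p) (simp add: tri_term_def cinner_tens_expv words_def mult_ac)
  have Y: "(?Y has_sum cinner h f ^ j) (words R j)"
  proof -
    have "((\<lambda>J. cnj (cinner (tens J) (tens (replicate j h))) * cinner (tens J) (tens (replicate j f)))
       has_sum cinner (fock_comp j (tens (replicate j h))) (tens (replicate j f))) (words R j)"
      by (rule parseval_words[OF R])
    moreover have "cinner (fock_comp j (tens (replicate j h))) (tens (replicate j f)) = cinner h f ^ j"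
      by (simp add: fock_comp_tens cinner_tens_replicate)
    ultimately show ?thesis
      by (subst has_sum_cong[where g="\<lambda>J. cnj (cinner (tens J) (tens (replicate j h))) * cinner (tens J) (tens (replicate j f))"])
        (auto simp: words_def cinner_tens_replicate)
  qed
  have X: "(?X has_sum cinner (tens (replicate i h @ replicate l (c f))) v) (words R i \<times> words R l)"
  proof -
    let ?t = "tens (replicate i h @ replicate l (c f))"
    have "fock_comp (i + l) ?t = ?t" by (simp add: fock_comp_tens)
    then have "((\<lambda>(I, J). cnj (cinner (tens (I @ J)) ?t) * cinner (tens (I @ J)) v)
       has_sum cinner ?t v) (words R i \<times> words R l)"
      using parseval_words_append[OF R, of ?t v i l] by simp
    moreover have "(\<lambda>(I, J). cnj (cinner (tens (I @ J)) ?t) * cinner (tens (I @ J)) v) p = ?X p"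
      if "p \<in> words R i \<times> words R l" for p
      using that by (auto simp: words_def cinner_tens_append_replicate)
    ultimately show ?thesis using has_sum_cong[of "words R i \<times> words R l" _ ?X] by blast
  qed
  have "((\<lambda>p. ?X p * cinner h f ^ j / ?K) has_sum tri R i l j (fock_of (expv h)) v (fock_of (expv f))) (words R i \<times> words R l)"
  proof (rule has_sum_SigmaD[OF tri_has_sum[OF R]])
    fix p assume p: "p \<in> words R i \<times> words R l"
    have "((\<lambda>J. ?X p * ?Y J / ?K) has_sum ?X p * cinner h f ^ j / ?K) (words R j)"
      using has_sum_cmult_right[OF Y, of "?X p / ?K"] by simp
    then show "((\<lambda>J. tri_term R i l j (fock_of (expv h)) v (fock_of (expv f)) (p, J)) has_sum ?X p * cinner h f ^ j / ?K) (words R j)"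
      by (rule has_sum_cong[THEN iffD2, rotated]) (rule tt[OF p])
  qed
  moreover have "((\<lambda>p. ?X p * cinner h f ^ j / ?K) has_sum
      cinner (tens (replicate i h @ replicate l (c f))) v * (cinner h f ^ j / ?K)) (words R i \<times> words R l)"
    using has_sum_cmult_left[OF X, of "cinner h f ^ j / ?K"] by simp
  ultimately show ?thesis using has_sum_unique by fastforce
qed

text \<open>With p = n - l and q = m - l the first binomial is at most (q + 1)^p \<le> (2 m)^p, the
  last at most m^l, and the binomial theorem sums the rest to (m + 2 m)^n. For m = 0 the middle
  estimate fails, so degree 0 has to be treated apart.\<close>

lemma choose_sum_le:
  assumes m: "1 \<le> (m::nat)"
  shows "(\<Sum>l\<le>min m n. (n + m - 2 * l choose (n - l)) * (n choose l) * (m choose l)) \<le> (3 * m) ^ n"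
proof -
  have 1: "(a + b choose b) \<le> (a + 1) ^ b" for a b :: nat
  proof (induction b)
    case (Suc b)
    have "Suc b * (a + Suc b choose Suc b) = Suc (a + b) * (a + b choose b)"
      using Suc_times_binomial_eq[of "a + b" b] by (simp add: mult.commute)
    also have "\<dots> \<le> (Suc b * (a + 1)) * (a + 1) ^ b"
      by (intro mult_mono Suc.IH) auto
    finally have "Suc b * (a + Suc b choose Suc b) \<le> Suc b * (a + 1) ^ Suc b" by (simp only: mult.assoc power_Suc)
    then show ?case by (simp only: Suc_mult_le_cancel1)
  qed simp
  have "(\<Sum>l\<le>min m n. (n + m - 2 * l choose (n - l)) * (n choose l) * (m choose l))
     \<le> (\<Sum>l\<le>min m n. (2 * m) ^ (n - l) * (n choose l) * m ^ l)"
  proof (intro sum_mono mult_mono)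
    fix l assume l: "l \<in> {..min m n}"
    have "(n + m - 2 * l choose (n - l)) = ((m - l) + (n - l) choose (n - l))"
      using l by (intro arg_cong2[of _ _ _ _ binomial]) auto
    also have "\<dots> \<le> (m - l + 1) ^ (n - l)" by (rule 1)
    also have "\<dots> \<le> (2 * m) ^ (n - l)" using m by (intro power_mono) auto
    finally show "(n + m - 2 * l choose (n - l)) \<le> (2 * m) ^ (n - l)" .
    show "m choose l \<le> m ^ l" using l by (intro binomial_le_pow) auto
  qed auto
  also have "\<dots> \<le> (\<Sum>l\<le>n. (2 * m) ^ (n - l) * (n choose l) * m ^ l)"
    by (rule sum_mono2) auto
  also have "\<dots> = (\<Sum>l\<le>n. (n choose l) * m ^ l * (2 * m) ^ (n - l))"
    by (intro sum.cong refl) (simp only: mult_ac)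
  also have "\<dots> = (m + 2 * m) ^ n" using binomial[of m "2 * m" n] by simp
  finally show ?thesis by (simp add: numeral_3_eq_3)
qed

text \<open>With n = i + l and m = l + j this is the product formula coefficient l! (n choose l) (m
  choose l), rescaled by sqrt((i + j)! / (n! m!)) because components carry Fock norms, without the
  factorials of Wiener chaos norms. Equivalently, sqrt((i + j)! (i + l)! (l + j)!) / (i! l!
  j!).\<close>

definition wick_coeff :: "nat \<Rightarrow> nat \<Rightarrow> nat \<Rightarrow> real" where
  "wick_coeff i l j = sqrt (real ((i + j choose i) * (i + l choose i) * (l + j choose l)))"

lemma wick_coeff_nonneg: "0 \<le> wick_coeff i l j"
  by (simp add: wick_coeff_def)

lemma wick_coeff_le: "wick_coeff i l j \<le> 2 ^ (i + l + j)"
proof -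
  have "(i + j choose i) * (i + l choose i) * (l + j choose l) \<le> 2 ^ (i + j) * 2 ^ (i + l) * 2 ^ (l + j)"
    by (intro mult_mono binomial_le_pow2) auto
  also have "\<dots> = (2 ^ (i + l + j))\<^sup>2"
    by (simp add: power_add power2_eq_square mult_ac)
  finally have "real ((i + j choose i) * (i + l choose i) * (l + j choose l)) \<le> (2 ^ (i + l + j))\<^sup>2"
    by (metis of_nat_le_iff of_nat_numeral of_nat_power)
  then show ?thesis unfolding wick_coeff_def by (intro real_le_lsqrt) auto
qed

text \<open>\<open>wick_form R w v \<psi>\<close> is \<open>\<langle>w, v \<psi>\<rangle>\<close> in the Wiener chaos picture: \<open>l\<close> counts the
  contractions between \<open>v\<close> and \<open>\<psi>\<close>, and \<open>i\<close> and \<open>j\<close> the uncontracted variables of \<open>v\<close> and \<open>\<psi>\<close>.\<close>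

definition wick_term :: "'a::complex_hilbert set \<Rightarrow> 'a sfock \<Rightarrow> 'a sfock \<Rightarrow> 'a sfock \<Rightarrow> (nat \<times> nat) \<times> nat \<Rightarrow> complex" where
  "wick_term R w v \<psi> = (\<lambda>((i, l), j).
    complex_of_real (wick_coeff i l j) * tri R i l j (fock_of w) (fock_of v) (fock_of \<psi>))"

definition wick_form :: "'a::complex_hilbert set \<Rightarrow> 'a sfock \<Rightarrow> 'a sfock \<Rightarrow> 'a sfock \<Rightarrow> complex" where
  "wick_form R w v \<psi> = (\<Sum>\<^sub>\<infinity>p. wick_term R w v \<psi> p)"

lemma wick_term_le:
  assumes "orthonormal_basis R"
  shows "cmod (wick_term R w v \<psi> ((i, l), j)) \<le> wick_coeff i l j *
    (norm (sfock_comp (i + j) w) * norm (sfock_comp (i + l) v) * norm (sfock_comp (l + j) \<psi>))"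
  unfolding wick_term_def using tri_bound[OF assms, of i l j "fock_of w" "fock_of v" "fock_of \<psi>"]
  by (simp add: norm_mult wick_coeff_nonneg mult_left_mono)

section \<open>Absolute convergence of the trilinear form\<close>

definition decay_bound :: "'a::complex_hilbert sfock \<Rightarrow> real \<Rightarrow> bool" where
  "decay_bound \<psi> K \<longleftrightarrow> (\<forall>n. 8 ^ n * norm (sfock_comp n \<psi>) \<le> K)"

definition decaying :: "'a::complex_hilbert sfock set" where
  "decaying = {\<psi>. \<exists>K. decay_bound \<psi> K}"

lemma decay_bound_nonneg: "decay_bound \<psi> K \<Longrightarrow> 0 \<le> K"
proof -
  assume "decay_bound \<psi> K"
  then have "8 ^ 0 * norm (sfock_comp 0 \<psi>) \<le> K" unfolding decay_bound_def by (rule spec)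
  then show "0 \<le> K" using order_trans[OF norm_ge_zero, of "sfock_comp 0 \<psi>" K] by simp
qed

lemma csubspace_decaying: "csubspace decaying"
  unfolding csubspace_def
proof (intro conjI ballI allI)
  show "0 \<in> decaying" by (auto simp: decaying_def decay_bound_def sfock_comp_simps)
next
  fix x y :: "'a sfock" assume "x \<in> decaying" "y \<in> decaying"
  then obtain K L where KL: "decay_bound x K" "decay_bound y L" by (auto simp: decaying_def)
  have "decay_bound (x + y) (K + L)"
    unfolding decay_bound_def
  proof
    fix n
    have "8 ^ n * norm (sfock_comp n (x + y)) \<le> 8 ^ n * (norm (sfock_comp n x) + norm (sfock_comp n y))"
      unfolding sfock_comp_simps by (intro mult_left_mono norm_triangle_ineq) auto
    also have "\<dots> \<le> K + L"
      using KL unfolding decay_bound_def by (simp add: distrib_left add_mono)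
    finally show "8 ^ n * norm (sfock_comp n (x + y)) \<le> K + L" .
  qed
  then show "x + y \<in> decaying" by (auto simp: decaying_def)
next
  fix \<alpha> and x :: "'a sfock" assume "x \<in> decaying"
  then obtain K where K: "decay_bound x K" by (auto simp: decaying_def)
  have "decay_bound (\<alpha> *\<^sub>C x) (cmod \<alpha> * K)"
    unfolding decay_bound_def sfock_comp_simps norm_scaleC
    using K unfolding decay_bound_def by (simp add: mult.left_commute mult_left_mono)
  then show "\<alpha> *\<^sub>C x \<in> decaying" by (auto simp: decaying_def)
qed

lemma sfock_comp_expv_scaleR: "sfock_comp n (expv (r *\<^sub>R g)) = complex_of_real (r ^ n) *\<^sub>C sfock_comp n (expv g)"
  using tens_scaleC_replicate[of n "complex_of_real r" g "[]"]
  by (simp add: sfock_comp_expv scaleR_scaleC scaleC_scaleC mult.commute)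

lemma decay_bound_expv: "decay_bound (expv g) (norm (expv (8 *\<^sub>R g)))"
  unfolding decay_bound_def
proof
  show "8 ^ n * norm (sfock_comp n (expv g)) \<le> norm (expv (8 *\<^sub>R g))" for n
    using norm_sfock_comp_le[of n "expv (8 *\<^sub>R g)"]
    by (simp add: sfock_comp_expv_scaleR norm_scaleC norm_power)
qed

lemma expv_decaying: "expv g \<in> decaying"
  using decay_bound_expv by (auto simp: decaying_def)

lemma lincomb_expv_decaying: "lincomb expv I \<subseteq> decaying"
  by (rule lincomb_subset[OF csubspace_decaying expv_decaying])

definition geom3 :: "(nat \<times> nat) \<times> nat \<Rightarrow> real" where
  "geom3 p = (1/4) ^ (fst (fst p) + snd (fst p) + snd p)"

lemma geometric_triple: "geom3 summable_on UNIV"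
proof -
  have g: "((\<lambda>n. (1/4::real) ^ n) has_sum (4/3)) UNIV"
    using sums_nonneg_imp_has_sum[OF geometric_sums[of "1/4::real"]] by simp
  have "(\<lambda>(i, l). (1/4::real) ^ (i + l)) summable_on UNIV \<times> UNIV"
  proof (rule summable_on_SigmaI)
    show "((\<lambda>l. (\<lambda>(i, l). (1/4::real) ^ (i + l)) (i, l)) has_sum (1/4) ^ i * (4/3)) UNIV" for i
      using has_sum_cmult_right[OF g, of "(1/4) ^ i"] by (simp add: power_add)
    show "(\<lambda>i. (1/4::real) ^ i * (4/3)) summable_on UNIV"
      using has_sum_cmult_left[OF g] by (rule has_sum_imp_summable)
  qed auto
  then have s2: "(\<lambda>p. (case p of (i, l) \<Rightarrow> (1/4::real) ^ (i + l)) * (4/3)) summable_on UNIV"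
    by (intro summable_on_cmult_left) simp
  have "geom3 summable_on UNIV \<times> UNIV"
  proof (rule summable_on_SigmaI[OF _ s2])
    show "((\<lambda>j. geom3 (p, j)) has_sum (case p of (i, l) \<Rightarrow> (1/4) ^ (i + l)) * (4/3)) UNIV" for p
      using has_sum_cmult_right[OF g, of "case p of (i, l) \<Rightarrow> (1/4) ^ (i + l)"]
      by (simp add: geom3_def power_add case_prod_unfold)
  qed (auto simp: geom3_def)
  then show ?thesis by simp
qed

text \<open>Origin of the 8: a factor 2 per index is spent on \<open>wick_coeff\<close>, and a
  factor 4 is left for \<open>geom3\<close>. The index \<open>p\<close> is common to the two
  decaying arguments and is counted twice; the surplus 8^p is dropped.\<close>

lemma weight_bound:
  fixes x y z :: real
  assumes "0 \<le> x" "0 \<le> y" "0 \<le> z" "8 ^ (p + q) * x \<le> X" "8 ^ (p + r) * y \<le> Y" "z \<le> Z"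
    and k: "0 \<le> k" "k \<le> 2 ^ (p + q + r)"
  shows "k * (x * y * z) \<le> (1/4) ^ (p + q + r) * (X * Y * Z)"
proof -
  have "8 ^ (p + q + r) * (x * y * z) \<le> 8 ^ p * (8 ^ (p + q + r) * (x * y * z))"
    using mult_right_mono[of 1 "8 ^ p" "8 ^ (p + q + r) * (x * y * z)"] assms by simp
  also have "\<dots> = (8 ^ (p + q) * x) * (8 ^ (p + r) * y) * z" by (simp add: power_add mult_ac)
  also have "\<dots> \<le> X * Y * Z"
  proof -
    have "0 \<le> X" "0 \<le> Y" "0 \<le> Z"
      using assms order_trans[of 0 "8 ^ (p + q) * x" X] order_trans[of 0 "8 ^ (p + r) * y" Y] by auto
    then show ?thesis using assms by (intro mult_mono mult_nonneg_nonneg) auto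
  qed
  finally have 1: "8 ^ (p + q + r) * (x * y * z) \<le> X * Y * Z" .
  have "k * (x * y * z) \<le> 2 ^ (p + q + r) * (x * y * z)"
    using assms by (intro mult_right_mono) auto
  also have "\<dots> = (1/4) ^ (p + q + r) * (8 ^ (p + q + r) * (x * y * z))"
    by (simp add: mult.assoc[symmetric] power_mult_distrib[symmetric])
  also have "\<dots> \<le> (1/4) ^ (p + q + r) * (X * Y * Z)"
    by (intro mult_left_mono 1) auto
  finally show ?thesis .
qed

text \<open>For closability, where the bound has to be in terms of the norm of
  \<open>\<psi>\<close>; the index common to the decaying arguments is \<open>i\<close>.\<close>

lemma wick_term_decay1:
  assumes R: "orthonormal_basis R" and "decay_bound w K" "decay_bound v L"
  shows "cmod (wick_term R w v \<psi> p) \<le> geom3 p * (K * L * norm \<psi>)"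
proof -
  obtain i l j where p: "p = ((i, l), j)" by (metis surj_pair)
  have "cmod (wick_term R w v \<psi> p) \<le> wick_coeff i l j *
    (norm (sfock_comp (i + j) w) * norm (sfock_comp (i + l) v) * norm (sfock_comp (l + j) \<psi>))"
    unfolding p by (rule wick_term_le[OF R])
  also have "\<dots> \<le> (1/4) ^ (i + j + l) * (K * L * norm \<psi>)"
    using assms(2,3) wick_coeff_le[of i l j] wick_coeff_nonneg[of i l j]
    by (intro weight_bound norm_sfock_comp_le) (auto simp: decay_bound_def add_ac)
  finally show ?thesis by (simp add: p geom3_def add_ac)
qed

text \<open>For the domain of the closure, where the bound has to be in terms of the norm of
  \<open>w\<close>; the common index is \<open>l\<close>.\<close>

lemma wick_term_decay2:
  assumes R: "orthonormal_basis R" and "decay_bound v L" "decay_bound \<psi> K"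
  shows "cmod (wick_term R w v \<psi> p) \<le> geom3 p * (L * K * norm w)"
proof -
  obtain i l j where p: "p = ((i, l), j)" by (metis surj_pair)
  have "cmod (wick_term R w v \<psi> p) \<le> wick_coeff i l j *
    (norm (sfock_comp (l + i) v) * norm (sfock_comp (l + j) \<psi>) * norm (sfock_comp (i + j) w))"
    unfolding p using wick_term_le[OF R, of w v \<psi> i l j] by (simp add: mult_ac add_ac)
  also have "\<dots> \<le> (1/4) ^ (l + i + j) * (L * K * norm w)"
    using assms(2,3) wick_coeff_le[of i l j] wick_coeff_nonneg[of i l j]
    by (intro weight_bound norm_sfock_comp_le) (auto simp: decay_bound_def add_ac)
  finally show ?thesis by (simp add: p geom3_def add_ac)
qed

definition geom_const :: real where
  "geom_const = (\<Sum>\<^sub>\<infinity>p. geom3 p)"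

lemma geom_const_nonneg: "0 \<le> geom_const"
  unfolding geom_const_def by (rule infsum_nonneg) (simp add: geom3_def)

lemma abs_summable_geom:
  fixes f :: "_ \<Rightarrow> complex"
  assumes "\<And>p. cmod (f p) \<le> geom3 p * K"
  shows "(\<lambda>p. cmod (f p)) summable_on UNIV" and "cmod (\<Sum>\<^sub>\<infinity>p. f p) \<le> geom_const * K"
proof -
  have s: "(\<lambda>p. geom3 p * K) summable_on UNIV"
    by (rule summable_on_cmult_left[OF geometric_triple])
  show 1: "(\<lambda>p. cmod (f p)) summable_on UNIV"
    by (rule summable_on_comparison_test[OF s]) (use assms in auto)
  have "cmod (\<Sum>\<^sub>\<infinity>p. f p) \<le> (\<Sum>\<^sub>\<infinity>p. cmod (f p))" by (rule norm_infsum_bound[OF 1])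
  also have "\<dots> \<le> (\<Sum>\<^sub>\<infinity>p. geom3 p * K)"
    by (rule infsum_mono[OF 1 s]) (use assms in auto)
  also have "\<dots> = geom_const * K" unfolding geom_const_def by (rule infsum_cmult_left[OF geometric_triple])
  finally show "cmod (\<Sum>\<^sub>\<infinity>p. f p) \<le> geom_const * K" .
qed

lemma wick_form_abs_summable:
  assumes R: "orthonormal_basis R" and "w \<in> decaying" "v \<in> decaying"
  shows "(\<lambda>p. cmod (wick_term R w v \<psi> p)) summable_on UNIV"
  using assms abs_summable_geom(1)[OF wick_term_decay1[OF R]] by (auto simp: decaying_def)

lemma wick_form_has_sum:
  assumes R: "orthonormal_basis R" and "w \<in> decaying" "v \<in> decaying"
  shows "(wick_term R w v \<psi> has_sum wick_form R w v \<psi>) UNIV"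
  unfolding wick_form_def
  by (rule has_sum_infsum[OF abs_summable_summable[OF wick_form_abs_summable[OF assms]]])

lemma wick_form_bounded:
  assumes R: "orthonormal_basis R" and "w \<in> decaying" "v \<in> decaying"
  shows "\<exists>K. \<forall>\<psi>. cmod (wick_form R w v \<psi>) \<le> K * norm \<psi>"
proof -
  obtain K L where KL: "decay_bound w K" "decay_bound v L" using assms by (auto simp: decaying_def)
  have "cmod (wick_form R w v \<psi>) \<le> (geom_const * (K * L)) * norm \<psi>" for \<psi>
    unfolding wick_form_def
    using abs_summable_geom(2)[OF wick_term_decay1[OF R KL, of \<psi>]] by (simp add: mult.assoc)
  then show ?thesis by blast
qed

lemma wick_form_bound_decay:
  assumes R: "orthonormal_basis R" and "decay_bound v L" "decay_bound \<psi> K"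
  shows "cmod (wick_form R w v \<psi>) \<le> geom_const * (L * K * norm w)"
  unfolding wick_form_def by (rule abs_summable_geom(2)[OF wick_term_decay2[OF assms]])

lemma wick_form_linear:
  assumes R: "orthonormal_basis R" and v: "v \<in> decaying" and w: "w \<in> decaying"
  shows wick_form_add_right: "wick_form R w v (\<psi> + \<phi>) = wick_form R w v \<psi> + wick_form R w v \<phi>"
    and wick_form_scaleC_right: "wick_form R w v (\<alpha> *\<^sub>C \<psi>) = \<alpha> * wick_form R w v \<psi>"
    and wick_form_add_left: "w' \<in> decaying \<Longrightarrow> wick_form R (w + w') v \<psi> = wick_form R w v \<psi> + wick_form R w' v \<psi>"
    and wick_form_scaleC_left: "wick_form R (\<alpha> *\<^sub>C w) v \<psi> = cnj \<alpha> * wick_form R w v \<psi>"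
proof -
  note hs = wick_form_has_sum[OF R _ v]
  have "wick_term R w v (\<psi> + \<phi>) = (\<lambda>p. wick_term R w v \<psi> p + wick_term R w v \<phi> p)"
    by (auto simp: wick_term_def plus_sfock.rep_eq tri_add_right[OF R] distrib_left)
  from hs[OF w, of "\<psi> + \<phi>", unfolded this] has_sum_add[OF hs[OF w] hs[OF w]]
  show "wick_form R w v (\<psi> + \<phi>) = wick_form R w v \<psi> + wick_form R w v \<phi>" by (rule has_sum_unique)
  have "wick_term R w v (\<alpha> *\<^sub>C \<psi>) = (\<lambda>p. \<alpha> * wick_term R w v \<psi> p)"
    by (auto simp: wick_term_def scaleC_sfock.rep_eq tri_scaleC_right[OF R])
  from hs[OF w, of "\<alpha> *\<^sub>C \<psi>", unfolded this] has_sum_cmult_right[OF hs[OF w]]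
  show "wick_form R w v (\<alpha> *\<^sub>C \<psi>) = \<alpha> * wick_form R w v \<psi>" by (rule has_sum_unique)
  have aw: "\<alpha> *\<^sub>C w \<in> decaying" using w csubspace_decaying by (auto simp: csubspace_def)
  have "wick_term R (\<alpha> *\<^sub>C w) v \<psi> = (\<lambda>p. cnj \<alpha> * wick_term R w v \<psi> p)"
    by (auto simp: wick_term_def scaleC_sfock.rep_eq tri_scaleC_left[OF R])
  from hs[OF aw, of \<psi>, unfolded this] has_sum_cmult_right[OF hs[OF w]]
  show "wick_form R (\<alpha> *\<^sub>C w) v \<psi> = cnj \<alpha> * wick_form R w v \<psi>" by (rule has_sum_unique)
  assume w': "w' \<in> decaying"
  have ww: "w + w' \<in> decaying" using w w' csubspace_decaying by (auto simp: csubspace_def)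
  have "wick_term R (w + w') v \<psi> = (\<lambda>p. wick_term R w v \<psi> p + wick_term R w' v \<psi> p)"
    by (auto simp: wick_term_def plus_sfock.rep_eq tri_add_left[OF R] distrib_left)
  from hs[OF ww, of \<psi>, unfolded this] has_sum_add[OF hs[OF w] hs[OF w']]
  show "wick_form R (w + w') v \<psi> = wick_form R w v \<psi> + wick_form R w' v \<psi>" by (rule has_sum_unique)
qed

text \<open>Dividing by the factorial roots of the two exponential vectors leaves 1 / j! for the
  exponential series and, up to the root of (i + l)!, the binomial weights of degree i + l.\<close>

lemma wick_coeff_fact:
  "wick_coeff i l j / (sqrt (fact (i + j)) * sqrt (fact (l + j))) = sqrt (fact (i + l)) / (fact i * fact l * fact j)"
proof -
  have b: "real (i + j choose i) = fact (i + j) / (fact i * fact j)"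
    "real (i + l choose i) = fact (i + l) / (fact i * fact l)"
    "real (l + j choose l) = fact (l + j) / (fact l * fact j)"
    by (simp_all add: binomial_fact)
  have "sqrt (fact i) * sqrt (fact i) = (fact i :: real)" for i by simp
  then show ?thesis
    unfolding wick_coeff_def of_nat_mult b real_sqrt_mult real_sqrt_divide
    by (simp add: field_simps)
qed

text \<open>Multiplication by the Wick exponential of \<open>f\<close> is \<open>exp (a\<^sup>*(f)) exp (a(c f))\<close>, whose adjoint maps
  \<open>expv h\<close> to a multiple of \<open>expv (h + c f)\<close>.\<close>

lemma wick_form_expv:
  assumes c: "conjugation c" and RB: "real_basis c R" and v: "v \<in> decaying"
  shows "wick_form R (expv h) v (expv f) = exp (cinner h f) * cinner (expv (h + c f)) v"
proof -
  have R: "orthonormal_basis R" using RB by (simp add: real_basis_def)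
  let ?V = "fock_of v"
  let ?t = "\<lambda>i l. cinner (tens (replicate i h @ replicate l (c f))) ?V"
  let ?q = "\<lambda>i l. complex_of_real (sqrt (fact (i + l)) / (fact i * fact l)) * ?t i l"
  have tm: "wick_term R (expv h) v (expv f) ((i, l), j) = ?q i l * (cinner h f ^ j /\<^sub>R fact j)" for i l j
  proof -
    have "wick_term R (expv h) v (expv f) ((i, l), j)
      = complex_of_real (wick_coeff i l j / (sqrt (fact (i + j)) * sqrt (fact (l + j)))) * (cinner h f ^ j * ?t i l)"
      by (simp add: wick_term_def tri_expv[OF c RB])
    then show ?thesis unfolding wick_coeff_fact
      by (simp add: scaleR_conv_of_real divide_inverse mult_ac)
  qed
  have ex: "((\<lambda>j. cinner h f ^ j /\<^sub>R fact j) has_sum exp (cinner h f)) UNIV"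
    by (rule norm_summable_imp_has_sum[OF summable_norm_exp exp_converges])
  have "(wick_term R (expv h) v (expv f) has_sum wick_form R (expv h) v (expv f)) (UNIV \<times> UNIV)"
    using wick_form_has_sum[OF R expv_decaying v] by simp
  \<comment> \<open>Summing over j first: the uncontracted part of \<open>expv f\<close> gives the
    scalar exp <h, f>.\<close>
  then have "((\<lambda>(i, l). ?q i l * exp (cinner h f)) has_sum wick_form R (expv h) v (expv f)) UNIV"
  proof (rule has_sum_SigmaD)
    fix p :: "nat \<times> nat"
    show "((\<lambda>j. wick_term R (expv h) v (expv f) (p, j)) has_sum (case p of (i, l) \<Rightarrow> ?q i l * exp (cinner h f))) UNIV"
      using has_sum_cmult_right[OF ex] by (cases p) (simp only: tm prod.case)
  qed
  \<comment> \<open>Regrouping by the degree n = i + l of \<open>v\<close>, so that the binomial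
    formula assembles the tensor power of h + c f.\<close>
  then have "((\<lambda>(n, i). ?q i (n - i) * exp (cinner h f)) has_sum wick_form R (expv h) v (expv f)) (Sigma UNIV (\<lambda>n. {..n}))"
    by (rule has_sum_reindex_bij_witness[where i="\<lambda>(n, i). (i, n - i)" and j="\<lambda>(i, l). (i + l, i)", THEN iffD1, rotated -1])
      auto
  then have "((\<lambda>n. (cinner (tens (replicate n (h + c f))) ?V / complex_of_real (sqrt (fact n))) * exp (cinner h f))
     has_sum wick_form R (expv h) v (expv f)) UNIV"
  proof (rule has_sum_SigmaD)
    fix n :: nat
    have "complex_of_real (sqrt (fact (i + (n - i))) / (fact i * fact (n - i))) = of_nat (n choose i) / complex_of_real (sqrt (fact n))"
      if "i \<le> n" for i
    proof -
      have "sqrt (fact n) / (fact i * fact (n - i)) = real (n choose i) / sqrt (fact n)"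
        using that by (simp add: binomial_fact field_simps)
      then have "complex_of_real (sqrt (fact n) / (fact i * fact (n - i))) = complex_of_real (real (n choose i) / sqrt (fact n))"
        by (rule arg_cong)
      also have "\<dots> = of_nat (n choose i) / complex_of_real (sqrt (fact n))"
        unfolding of_real_divide of_real_of_nat_eq ..
      finally show ?thesis unfolding le_add_diff_inverse[OF that] .
    qed
    then have "(\<Sum>i\<le>n. ?q i (n - i) * exp (cinner h f))
      = (\<Sum>i\<le>n. of_nat (n choose i) * ?t i (n - i)) / complex_of_real (sqrt (fact n)) * exp (cinner h f)"
      unfolding sum_divide_distrib sum_distrib_right by (intro sum.cong refl) simp
    also have "(\<Sum>i\<le>n. of_nat (n choose i) * ?t i (n - i)) = cinner (tens (replicate n (h + c f))) ?V"
      using cinner_tens_replicate_add[OF symmetric_fock_of, of n h "c f" "[]" v] by simp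
    finally show "((\<lambda>i. (\<lambda>(n, i). ?q i (n - i) * exp (cinner h f)) (n, i)) has_sum
       (cinner (tens (replicate n (h + c f))) ?V / complex_of_real (sqrt (fact n))) * exp (cinner h f)) {..n}"
      using has_sum_finite[of "{..n}" "\<lambda>i. ?q i (n - i) * exp (cinner h f)"] by simp
  qed
  moreover have "((\<lambda>n. (cinner (tens (replicate n (h + c f))) ?V / complex_of_real (sqrt (fact n))) * exp (cinner h f))
     has_sum cinner (expv (h + c f)) v * exp (cinner h f)) UNIV"
    by (rule has_sum_cmult_left[OF cinner_expv_has_sum])
  ultimately have "wick_form R (expv h) v (expv f) = cinner (expv (h + c f)) v * exp (cinner h f)"
    by (rule has_sum_unique)
  then show ?thesis by (simp add: mult.commute)
qed

section \<open>The number bound\<close>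

text \<open>For fixed degrees \<open>m\<close> and \<open>n\<close>, different numbers
  \<open>l\<close> of contractions meet different components of \<open>w\<close>. Cauchy-Schwarz in
  \<open>l\<close> therefore costs only |w|, and the squared coefficients form the sum in
  \<open>choose_sum_le\<close>.\<close>

lemma wick_coeff_sum_le:
  assumes m: "1 \<le> m"
  shows "(\<Sum>l\<le>min m n. wick_coeff (n - l) l (m - l) * norm (sfock_comp (n + m - 2 * l) w)) \<le> sqrt (real ((3 * m) ^ n)) * norm w"
proof -
  have "(\<Sum>l\<le>min m n. wick_coeff (n - l) l (m - l) * norm (sfock_comp (n + m - 2 * l) w))
    \<le> sqrt (\<Sum>l\<le>min m n. (wick_coeff (n - l) l (m - l))\<^sup>2) * sqrt (\<Sum>l\<le>min m n. (norm (sfock_comp (n + m - 2 * l) w))\<^sup>2)"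
    unfolding real_sqrt_mult[symmetric] by (rule real_le_rsqrt[OF Cauchy_Schwarz_ineq_sum])
  also have "\<dots> \<le> sqrt (real ((3 * m) ^ n)) * sqrt ((norm w)\<^sup>2)"
  proof (intro mult_mono real_sqrt_le_mono real_sqrt_ge_zero sum_nonneg)
    have "(\<Sum>l\<le>min m n. (wick_coeff (n - l) l (m - l))\<^sup>2)
      = real (\<Sum>l\<le>min m n. (n + m - 2 * l choose (n - l)) * (n choose l) * (m choose l))"
      unfolding of_nat_sum
    proof (intro sum.cong refl)
      fix l assume l: "l \<in> {..min m n}"
      then have "n - l + (m - l) = n + m - 2 * l" "n - l + l = n" "l + (m - l) = m" "n choose (n - l) = n choose l"
        using binomial_symmetric[of l n] by auto
      then show "(wick_coeff (n - l) l (m - l))\<^sup>2 = real ((n + m - 2 * l choose (n - l)) * (n choose l) * (m choose l))"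
        unfolding wick_coeff_def by (simp only: real_sqrt_pow2 of_nat_0_le_iff)
    qed
    then show "(\<Sum>l\<le>min m n. (wick_coeff (n - l) l (m - l))\<^sup>2) \<le> real ((3 * m) ^ n)"
      using choose_sum_le[OF m, of n] by (simp only: of_nat_le_iff)
    have inj: "inj_on (\<lambda>l. n + m - 2 * l) {..min m n}" by (auto simp: inj_on_def)
    have "(\<Sum>l\<le>min m n. (norm (sfock_comp (n + m - 2 * l) w))\<^sup>2) = (\<Sum>k\<in>(\<lambda>l. n + m - 2 * l) ` {..min m n}. (norm (sfock_comp k w))\<^sup>2)"
      by (simp add: sum.reindex[OF inj])
    also have "\<dots> \<le> (norm w)\<^sup>2"
      by (rule finite_sum_le_has_sum[OF sums_nonneg_imp_has_sum[OF norm_sfock_sums]]) auto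
    finally show "(\<Sum>l\<le>min m n. (norm (sfock_comp (n + m - 2 * l) w))\<^sup>2) \<le> (norm w)\<^sup>2" .
  qed auto
  finally show ?thesis by simp
qed

text \<open>Hypothesis \<open>B\<close> speaks of finite boxes only: every finite set of index
  triples lies in one, so the bound on the infinite sum follows from its finite partial
  sums.\<close>

lemma wick_form_le:
  assumes R: "orthonormal_basis R" and wv: "w \<in> decaying" "v \<in> decaying"
    and B: "\<And>N. (\<Sum>m\<in>{1..N}. norm (sfock_comp m \<psi>) * (\<Sum>n\<le>N. norm (sfock_comp n v) * sqrt (real ((3 * m) ^ n)))) \<le> B"
  shows "cmod (wick_form R w v \<psi>) \<le> norm w * (norm v * norm \<psi> + B)"
proof -
  let ?x = "\<lambda>n. norm (sfock_comp n w)" and ?y = "\<lambda>n. norm (sfock_comp n v)" and ?z = "\<lambda>n. norm (sfock_comp n \<psi>)"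
  \<comment> \<open>\<open>h\<close> passes to the degree m = l + j of \<open>\<psi>\<close>, the
    degree n = i + l of \<open>v\<close> and the number \<open>l\<close> of contractions; the degree
    of \<open>w\<close> is then n + m - 2 l.\<close>
  define h :: "(nat \<times> nat) \<times> nat \<Rightarrow> (nat \<times> nat) \<times> nat" where "h = (\<lambda>((i, l), j). ((l + j, i + l), l))"
  define G where "G m n l = ?z m * ?y n * (wick_coeff (n - l) l (m - l) * ?x (n + m - 2 * l))" for m n l
  have injh: "inj h" by (auto simp: inj_on_def h_def)
  have fin: "(\<Sum>p\<in>F. cmod (wick_term R w v \<psi> p)) \<le> norm w * (norm v * norm \<psi> + B)" if F: "finite F" for F
  proof -
    have "finite ((\<lambda>((i, l), j). i + l + j) ` F)" using F by simp
    then obtain N where N: "\<And>i l j. ((i, l), j) \<in> F \<Longrightarrow> i + l + j \<le> N"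
      unfolding finite_nat_set_iff_bounded_le by fastforce
    let ?I = "Sigma ({..N} \<times> {..N}) (\<lambda>(m, n). {..min m n})"
    have "(\<Sum>p\<in>F. cmod (wick_term R w v \<psi> p)) \<le> (\<Sum>p\<in>F. (\<lambda>((m, n), l). G m n l) (h p))"
    proof (rule sum_mono)
      fix p assume "p \<in> F"
      obtain i l j where p: "p = ((i, l), j)" by (metis surj_pair)
      have "i + l + (l + j) - 2 * l = i + j" by simp
      then have "(\<lambda>((m, n), l). G m n l) (h p) = wick_coeff i l j * (?x (i + j) * ?y (i + l) * ?z (l + j))"
        by (simp add: p h_def G_def)
      then show "cmod (wick_term R w v \<psi> p) \<le> (\<lambda>((m, n), l). G m n l) (h p)"
        using wick_term_le[OF R, of w v \<psi> i l j] by (simp add: p)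
    qed
    also have "\<dots> = (\<Sum>q\<in>h ` F. (\<lambda>((m, n), l). G m n l) q)"
      by (subst sum.reindex) (auto intro: inj_on_subset[OF injh])
    also have "\<dots> \<le> (\<Sum>q\<in>?I. (\<lambda>((m, n), l). G m n l) q)"
    proof (rule sum_mono2)
      show "h ` F \<subseteq> ?I" using N by (fastforce simp: h_def)
      show "0 \<le> (\<lambda>((m, n), l). G m n l) q" for q
        by (auto simp: G_def wick_coeff_nonneg split: prod.split)
    qed auto
    also have "\<dots> = (\<Sum>(m, n)\<in>{..N} \<times> {..N}. \<Sum>l\<le>min m n. G m n l)"
      by (subst sum.Sigma[symmetric]) (auto simp: case_prod_unfold)
    also have "\<dots> = (\<Sum>m\<le>N. \<Sum>n\<le>N. \<Sum>l\<le>min m n. G m n l)"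
      by (simp add: sum.cartesian_product)
    also have "\<dots> = (\<Sum>n\<le>N. \<Sum>l\<le>min 0 n. G 0 n l) + (\<Sum>m\<in>{1..N}. \<Sum>n\<le>N. \<Sum>l\<le>min m n. G m n l)"
    proof -
      have eq: "{..N} = insert 0 {1..N}" by auto
      have "(\<Sum>m\<le>N. K m) = K 0 + (\<Sum>m\<in>{1..N}. K m)" for K :: "nat \<Rightarrow> real"
        unfolding eq by (rule sum.insert) auto
      then show ?thesis .
    qed
    also have "\<dots> \<le> norm w * (norm v * norm \<psi>) + norm w * B"
    proof (rule add_mono)
      \<comment> \<open>For m = 0 only l = 0 occurs, with coefficient 1: a scalar multiple of
        \<open>v\<close> is paired with \<open>w\<close>.\<close>
      have "(\<Sum>n\<le>N. \<Sum>l\<le>min 0 n. G 0 n l) = ?z 0 * (\<Sum>n\<le>N. ?x n * ?y n)"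
        by (simp add: G_def wick_coeff_def sum_distrib_left mult_ac)
      also have "\<dots> \<le> norm \<psi> * (norm w * norm v)"
      proof (intro mult_mono norm_sfock_comp_le)
        have "(\<Sum>n\<le>N. ?x n * ?y n) \<le> sqrt (\<Sum>n\<le>N. (?x n)\<^sup>2) * sqrt (\<Sum>n\<le>N. (?y n)\<^sup>2)"
          unfolding real_sqrt_mult[symmetric] by (rule real_le_rsqrt[OF Cauchy_Schwarz_ineq_sum])
        also have "\<dots> \<le> sqrt ((norm w)\<^sup>2) * sqrt ((norm v)\<^sup>2)"
          by (intro mult_mono real_sqrt_le_mono real_sqrt_ge_zero sum_nonneg
              finite_sum_le_has_sum[OF sums_nonneg_imp_has_sum[OF norm_sfock_sums]]) auto
        finally show "(\<Sum>n\<le>N. ?x n * ?y n) \<le> norm w * norm v" by simp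
      qed (auto intro: sum_nonneg)
      finally show "(\<Sum>n\<le>N. \<Sum>l\<le>min 0 n. G 0 n l) \<le> norm w * (norm v * norm \<psi>)" by (simp add: mult_ac)
      have "(\<Sum>m\<in>{1..N}. \<Sum>n\<le>N. \<Sum>l\<le>min m n. G m n l)
        \<le> (\<Sum>m\<in>{1..N}. \<Sum>n\<le>N. ?z m * ?y n * (sqrt (real ((3 * m) ^ n)) * norm w))"
        unfolding G_def sum_distrib_left[symmetric]
        by (intro sum_mono mult_left_mono wick_coeff_sum_le) auto
      also have "\<dots> = norm w * (\<Sum>m\<in>{1..N}. ?z m * (\<Sum>n\<le>N. ?y n * sqrt (real ((3 * m) ^ n))))"
        by (simp add: sum_distrib_left mult_ac)
      also have "\<dots> \<le> norm w * B" by (rule mult_left_mono[OF B]) simp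
      finally show "(\<Sum>m\<in>{1..N}. \<Sum>n\<le>N. \<Sum>l\<le>min m n. G m n l) \<le> norm w * B" .
    qed
    finally show ?thesis by (simp add: distrib_left)
  qed
  have "cmod (wick_form R w v \<psi>) \<le> (\<Sum>\<^sub>\<infinity>p. cmod (wick_term R w v \<psi> p))"
    unfolding wick_form_def by (rule norm_infsum_bound[OF wick_form_abs_summable[OF R wv]])
  also have "\<dots> \<le> norm w * (norm v * norm \<psi> + B)"
    by (rule infsum_le_finite_sums[OF wick_form_abs_summable[OF R wv] fin])
  finally show ?thesis .
qed

lemma sum_inverse_squares_le: "(\<Sum>m\<in>{1..N}. 1 / (real m)\<^sup>2) \<le> 2"
proof -
  have "(\<Sum>m\<in>{1..Suc N}. 1 / (real m)\<^sup>2) \<le> 2 - 1 / real (Suc N)" for N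
  proof (induction N)
    case (Suc N)
    have "1 / (real (Suc (Suc N)))\<^sup>2 \<le> 1 / (real (Suc N) * real (Suc (Suc N)))"
      by (intro divide_left_mono) (auto simp: power2_eq_square)
    also have "\<dots> = 1 / real (Suc N) - 1 / real (Suc (Suc N))" by (simp add: field_simps)
    finally have "1 / (real (Suc (Suc N)))\<^sup>2 \<le> 1 / real (Suc N) - 1 / real (Suc (Suc N))" .
    then show ?case using Suc by simp
  qed simp
  from this[of "N - 1"] show ?thesis
    by (cases N) (auto intro: order_trans)
qed

text \<open>Inner sum: the weights are chosen so that the squared second factor is a (n + 2) m^n (3
  / r)^n, at most 1 / m^2 times a term of the series for \<open>Sr m\<close>. Outer sum: sqrt
  (\<open>Sr m\<close>) times \<open>z m\<close> against 1 / m.\<close>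

lemma weight_sum_le:
  fixes a y z Sr :: "nat \<Rightarrow> real"
  assumes a: "\<And>k. a k > 0" and r: "3 \<le> r"
    and S: "\<And>m. (\<lambda>k. a k * real m ^ k) sums Sr m"
    and y: "\<And>n. 0 \<le> y n" and z: "\<And>n. 0 \<le> z n"
    and A: "(\<lambda>n. r ^ n / a (n + 2) * (y n)\<^sup>2) sums A" and B: "(\<lambda>m. Sr m * (z m)\<^sup>2) sums B"
  shows "(\<Sum>m\<in>{1..N}. z m * (\<Sum>n\<le>N. y n * sqrt (real ((3 * m) ^ n)))) \<le> 2 * sqrt A * sqrt B"
proof -
  have a0: "0 \<le> a k" "a k \<noteq> 0" for k using a[of k] by auto
  have r0: "0 < r" using r by simp
  have S0: "0 \<le> Sr m" for m by (rule sums_le[OF _ sums_zero S]) (use a0 in auto)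
  have Af: "(\<Sum>n\<le>N. r ^ n / a (n + 2) * (y n)\<^sup>2) \<le> A" for N
    unfolding sums_unique[OF A] by (rule sum_le_suminf[OF sums_summable[OF A]]) (use a0 r0 in auto)
  have Bf: "(\<Sum>m\<in>{1..N}. Sr m * (z m)\<^sup>2) \<le> B" for N
    unfolding sums_unique[OF B] by (rule sum_le_suminf[OF sums_summable[OF B]]) (use S0 in auto)
  have A0: "0 \<le> A" by (rule order_trans[OF sum_nonneg Af[of 0]]) (use a0 r0 in auto)
  have step: "(\<Sum>n\<le>N. y n * sqrt (real ((3 * m) ^ n))) \<le> sqrt A * (sqrt (Sr m) / real m)" if m: "1 \<le> m" for m N
  proof -
    let ?f = "\<lambda>n. sqrt (r ^ n / a (n + 2)) * y n" and ?g = "\<lambda>n. sqrt (a (n + 2) * real ((3 * m) ^ n) / r ^ n)"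
    have "y n * sqrt (real ((3 * m) ^ n)) = ?f n * ?g n" for n
      using a0[of "n + 2"] r0 by (simp add: real_sqrt_mult real_sqrt_divide)
    then have "(\<Sum>n\<le>N. y n * sqrt (real ((3 * m) ^ n))) = (\<Sum>n\<le>N. ?f n * ?g n)" by (simp only:)
    also have "\<dots> \<le> sqrt (\<Sum>n\<le>N. (?f n)\<^sup>2) * sqrt (\<Sum>n\<le>N. (?g n)\<^sup>2)"
      unfolding real_sqrt_mult[symmetric] by (rule real_le_rsqrt[OF Cauchy_Schwarz_ineq_sum])
    also have "\<dots> \<le> sqrt A * sqrt (Sr m / (real m)\<^sup>2)"
    proof (intro mult_mono real_sqrt_le_mono real_sqrt_ge_zero sum_nonneg)
      have "(?f n)\<^sup>2 = r ^ n / a (n + 2) * (y n)\<^sup>2" for n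
        using a0[of "n + 2"] r0 by (simp add: power_mult_distrib)
      then show "(\<Sum>n\<le>N. (?f n)\<^sup>2) \<le> A" using Af[of N] by simp
      have gn: "(?g n)\<^sup>2 \<le> a (n + 2) * real m ^ (n + 2) / (real m)\<^sup>2" for n
      proof -
        have "(?g n)\<^sup>2 = a (n + 2) * real m ^ n * (3 / r) ^ n"
          using a0[of "n + 2"] r0 by (simp add: power_mult_distrib power_divide)
        also have "\<dots> \<le> a (n + 2) * real m ^ n * 1"
          using a0 r by (intro mult_left_mono power_le_one) auto
        also have "\<dots> = a (n + 2) * real m ^ (n + 2) / (real m)\<^sup>2"
          using m by (simp add: power_add power2_eq_square)
        finally show ?thesis .
      qed
      have "(\<Sum>n\<le>N. (?g n)\<^sup>2) \<le> (\<Sum>n\<le>N. a (n + 2) * real m ^ (n + 2)) / (real m)\<^sup>2"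
        unfolding sum_divide_distrib by (rule sum_mono[OF gn])
      also have "(\<Sum>n\<le>N. a (n + 2) * real m ^ (n + 2)) = (\<Sum>k\<in>(\<lambda>n. n + 2) ` {..N}. a k * real m ^ k)"
        by (subst sum.reindex) (auto simp: inj_on_def)
      also have "\<dots> \<le> Sr m"
        unfolding sums_unique[OF S] by (rule sum_le_suminf[OF sums_summable[OF S]]) (use a0 in auto)
      finally show "(\<Sum>n\<le>N. (?g n)\<^sup>2) \<le> Sr m / (real m)\<^sup>2" by (simp add: divide_right_mono)
    qed (use A0 in auto)
    finally show ?thesis by (simp add: real_sqrt_divide)
  qed
  have "(\<Sum>m\<in>{1..N}. z m * (\<Sum>n\<le>N. y n * sqrt (real ((3 * m) ^ n))))
    \<le> (\<Sum>m\<in>{1..N}. z m * (sqrt A * (sqrt (Sr m) / real m)))"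
    by (intro sum_mono mult_left_mono step z) auto
  also have "\<dots> = sqrt A * (\<Sum>m\<in>{1..N}. (sqrt (Sr m) * z m) * (1 / real m))"
    by (simp add: sum_distrib_left mult_ac)
  also have "\<dots> \<le> sqrt A * (sqrt (\<Sum>m\<in>{1..N}. (sqrt (Sr m) * z m)\<^sup>2) * sqrt (\<Sum>m\<in>{1..N}. (1 / real m)\<^sup>2))"
    unfolding real_sqrt_mult[symmetric, of "sum _ _"]
    by (intro mult_left_mono real_le_rsqrt[OF Cauchy_Schwarz_ineq_sum]) (use A0 in simp)
  also have "\<dots> \<le> sqrt A * (sqrt B * 2)"
  proof (intro mult_left_mono mult_mono)
    show "sqrt (\<Sum>m\<in>{1..N}. (sqrt (Sr m) * z m)\<^sup>2) \<le> sqrt B"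
      using Bf[of N] S0 by (simp add: power_mult_distrib)
    have "(\<Sum>m\<in>{1..N}. (1 / real m)\<^sup>2) \<le> 2\<^sup>2"
      using sum_inverse_squares_le[of N] by (simp add: power_divide)
    then show "sqrt (\<Sum>m\<in>{1..N}. (1 / real m)\<^sup>2) \<le> 2" by (intro real_le_lsqrt) (auto intro: sum_nonneg)
    show "0 \<le> sqrt B" using order_trans[OF sum_nonneg Bf[of 0]] S0 by simp
  qed (use A0 in \<open>auto intro: sum_nonneg\<close>)
  finally show ?thesis by simp
qed

section \<open>The closure of the Wick operator\<close>

lemma Cauchy_of_bound:
  fixes z :: "nat \<Rightarrow> 'a::real_normed_vector" and p :: "nat \<Rightarrow> 'b::real_normed_vector" and q :: "nat \<Rightarrow> 'c::real_normed_vector"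
  assumes p: "Cauchy p" and q: "Cauchy q" and K: "0 \<le> K" "0 \<le> L"
    and le: "\<And>m n. norm (z m - z n) \<le> K * norm (p m - p n) + L * norm (q m - q n)"
  shows "Cauchy z"
proof (rule CauchyI)
  fix e :: real assume e: "0 < e"
  define d where "d = e / (K + L + 1)"
  have d: "0 < d" "(K + L) * d < e" using e K by (simp_all add: d_def field_simps)
  obtain M where M: "\<And>m n. M \<le> m \<Longrightarrow> M \<le> n \<Longrightarrow> norm (p m - p n) < d" using CauchyD[OF p d(1)] by blast
  obtain M' where M': "\<And>m n. M' \<le> m \<Longrightarrow> M' \<le> n \<Longrightarrow> norm (q m - q n) < d" using CauchyD[OF q d(1)] by blast
  have "norm (z m - z n) < e" if "max M M' \<le> m" "max M M' \<le> n" for m n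
  proof -
    have "K * norm (p m - p n) \<le> K * d" "L * norm (q m - q n) \<le> L * d"
      using M[of m n] M'[of m n] that K by (auto intro!: mult_left_mono intro: less_imp_le)
    then show ?thesis using le[of m n] d(2) by (simp add: distrib_right)
  qed
  then show "\<exists>M. \<forall>m\<ge>M. \<forall>n\<ge>M. norm (z m - z n) < e" by blast
qed

definition weyl_graph :: "real \<Rightarrow> ('a::complex_hilbert \<Rightarrow> 'a) \<Rightarrow> 'a sfock \<Rightarrow> 'a sfock operator" where
  "weyl_graph \<epsilon> c v = lin_graph (\<lambda>\<phi>. weyl \<epsilon> \<phi> vacuum) (\<lambda>\<phi>. weyl \<epsilon> \<phi> v) {\<phi>. c \<phi> = \<phi>}"

lemma F_Wick_eq: "F_Wick \<epsilon> c V = closure (weyl_graph \<epsilon> c (app (Gamma_op (sqrt \<epsilon>)) V))"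
  unfolding F_Wick_def weyl_graph_def lin_graph_def ..

lemma weyl_vacuum:
  assumes "0 \<le> \<epsilon>" and u: "u = (\<i> * complex_of_real (sqrt (\<epsilon> / 2))) *\<^sub>C \<phi>"
  shows "weyl \<epsilon> \<phi> vacuum = exp (- of_real ((norm u)\<^sup>2 / 2)) *\<^sub>C expv u"
  unfolding weyl_eq_displace[OF assms(1)] u[symmetric] vacuum_eq_expv displace_expv by simp

text \<open>The link between the trilinear form and the definition of the operator: both sides are
  the same Gaussian prefactor times the matrix element of \<open>v\<close> with expv (h -
  u).\<close>

lemma wick_form_weyl:
  assumes c: "conjugation c" and RB: "real_basis c R" and v: "v \<in> decaying" and \<epsilon>: "0 \<le> \<epsilon>"
    and \<phi>: "c \<phi> = \<phi>"
  shows "cinner (expv h) (weyl \<epsilon> \<phi> v) = wick_form R (expv h) v (weyl \<epsilon> \<phi> vacuum)"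
proof -
  have R: "orthonormal_basis R" using RB by (simp add: real_basis_def)
  define u where "u = (\<i> * complex_of_real (sqrt (\<epsilon> / 2))) *\<^sub>C \<phi>"
  have "c u = cnj (\<i> * complex_of_real (sqrt (\<epsilon> / 2))) *\<^sub>C c \<phi>"
    using c unfolding u_def conjugation_def by blast
  then have cu: "c u = - u" by (simp add: u_def \<phi> scaleC_minus_left)
  have nu: "complex_of_real ((norm u)\<^sup>2 / 2) = cinner u u / 2" by (simp add: cinner_self)
  have "wick_form R (expv h) v (weyl \<epsilon> \<phi> vacuum)
    = exp (- cinner u u / 2) * (exp (cinner h u) * cinner (expv (h - u)) v)"
    unfolding weyl_vacuum[OF \<epsilon> u_def] wick_form_scaleC_right[OF R v expv_decaying] wick_form_expv[OF c RB v] cu nu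
    by simp
  also have "\<dots> = exp (- cinner u u / 2 + cinner h u) * cinner (expv (h - u)) v"
    unfolding exp_add by (rule mult.assoc[symmetric])
  also have "\<dots> = cinner (expv h) (weyl \<epsilon> \<phi> v)"
    unfolding weyl_eq_displace[OF \<epsilon>] u_def[symmetric]
    using cinner_expv_displace[of h 1 u v] by simp
  finally show ?thesis ..
qed

lemma wick_form_zero:
  assumes R: "orthonormal_basis R" and v: "v \<in> decaying" and w: "w \<in> decaying"
  shows "wick_form R w v 0 = 0" "wick_form R 0 v \<psi> = 0"
  using wick_form_scaleC_right[OF R v w, of 0 0] wick_form_scaleC_left[OF R v w, of 0 \<psi>] by simp_all

lemma wick_form_diff_right:
  assumes R: "orthonormal_basis R" and v: "v \<in> decaying" and w: "w \<in> decaying"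
  shows "wick_form R w v (x - y) = wick_form R w v x - wick_form R w v y"
  using wick_form_add_right[OF R v w, of "x - y" y] by simp

lemma wick_form_sum_right:
  assumes R: "orthonormal_basis R" and v: "v \<in> decaying" and w: "w \<in> decaying"
  shows "wick_form R w v (\<Sum>i\<in>A. \<alpha> i *\<^sub>C x i) = (\<Sum>i\<in>A. \<alpha> i * wick_form R w v (x i))"
  by (induction A rule: infinite_finite_induct)
    (simp_all add: wick_form_zero[OF R v w] wick_form_add_right[OF R v w] wick_form_scaleC_right[OF R v w])

lemma weyl_graph_wick_form:
  fixes c :: "'a::complex_hilbert \<Rightarrow> 'a"
  assumes c: "conjugation c" and RB: "real_basis c R" and v: "v \<in> decaying" and \<epsilon>: "0 \<le> \<epsilon>"
    and xy: "(x, y) \<in> weyl_graph \<epsilon> c v" and w: "w \<in> lincomb expv UNIV"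
  shows "cinner w y = wick_form R w v x"
proof -
  have R: "orthonormal_basis R" using RB by (simp add: real_basis_def)
  obtain A \<alpha> where A: "A \<subseteq> {\<phi>. c \<phi> = \<phi>}"
    "x = (\<Sum>\<phi>\<in>A. \<alpha> \<phi> *\<^sub>C weyl \<epsilon> \<phi> vacuum)" "y = (\<Sum>\<phi>\<in>A. \<alpha> \<phi> *\<^sub>C weyl \<epsilon> \<phi> v)"
    using xy unfolding weyl_graph_def lin_graph_def by blast
  \<comment> \<open>Membership in \<open>decaying\<close> is part of the set because additivity of
    the form in \<open>w\<close> requires it.\<close>
  let ?M = "{w \<in> decaying. cinner w y = wick_form R w v x}"
  have "csubspace ?M"
    using csubspace_decaying unfolding csubspace_def
    by (auto simp: wick_form_zero[OF R v] cinner_add_left cinner_scaleC_left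
        wick_form_add_left[OF R v] wick_form_scaleC_left[OF R v])
  then have "lincomb expv UNIV \<subseteq> ?M"
  proof (rule lincomb_subset)
    fix h :: 'a
    have "cinner (expv h) y = wick_form R (expv h) v x"
      unfolding A(2,3) wick_form_sum_right[OF R v expv_decaying] cinner_sum_right cinner_scaleC_right
      using A(1) by (intro sum.cong refl arg_cong2[of _ _ _ _ "(*)"] wick_form_weyl[OF c RB v \<epsilon>]) auto
    then show "expv h \<in> ?M" using expv_decaying by simp
  qed
  then show ?thesis using w by blast
qed

text \<open>At fixed \<open>w\<close> the form is bounded in its last argument, so the identity
  passes to limits of graph points. The value \<open>y\<close> is then weakly determined by
  \<open>x\<close>, which is closability.\<close>

lemma weyl_graph_closure_wick_form:
  assumes c: "conjugation c" and RB: "real_basis c R" and v: "v \<in> decaying" and \<epsilon>: "0 \<le> \<epsilon>"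
    and xy: "(x, y) \<in> closure (weyl_graph \<epsilon> c v)" and w: "w \<in> lincomb expv UNIV"
  shows "cinner w y = wick_form R w v x"
proof -
  have R: "orthonormal_basis R" using RB by (simp add: real_basis_def)
  have wd: "w \<in> decaying" using w lincomb_expv_decaying by blast
  obtain f g where fg: "\<forall>n. (f n, g n) \<in> weyl_graph \<epsilon> c v" "f \<longlonglongrightarrow> x" "g \<longlonglongrightarrow> y"
    using xy unfolding closure_pair_sequential by blast
  obtain K where K: "\<And>\<psi>. cmod (wick_form R w v \<psi>) \<le> K * norm \<psi>"
    using wick_form_bounded[OF R wd v] by blast
  have "(\<lambda>n. K * norm (f n - x)) \<longlonglongrightarrow> K * norm (x - x)" by (intro tendsto_intros fg)
  then have "(\<lambda>n. K * norm (f n - x)) \<longlonglongrightarrow> 0" by simp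
  then have "(\<lambda>n. wick_form R w v (f n) - wick_form R w v x) \<longlonglongrightarrow> 0"
    by (rule Lim_null_comparison[rotated])
      (auto simp: K simp flip: wick_form_diff_right[OF R v wd])
  then have 1: "(\<lambda>n. wick_form R w v (f n)) \<longlonglongrightarrow> wick_form R w v x" by (rule LIM_zero_cancel)
  have "cinner w (g n) = wick_form R w v (f n)" for n
    using weyl_graph_wick_form[OF c RB v \<epsilon> _ w] fg(1) by blast
  then have "(\<lambda>n. wick_form R w v (f n)) \<longlonglongrightarrow> cinner w y"
    using tendsto_cinner[OF tendsto_const[of w] fg(3)] by simp
  then show ?thesis using 1 by (rule LIMSEQ_unique)
qed

lemma weyl_graph_closure_diff:
  assumes "(x, y) \<in> closure (weyl_graph \<epsilon> c v)" "(x', y') \<in> closure (weyl_graph \<epsilon> c v)"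
  shows "(x - x', y - y') \<in> closure (weyl_graph \<epsilon> c v)"
  using lin_graph_closure_add[OF assms(1)[unfolded weyl_graph_def]
      lin_graph_closure_scaleC[OF assms(2)[unfolded weyl_graph_def], of "-1"]]
  unfolding weyl_graph_def by (simp add: scaleC_minus_one)

lemma weyl_graph_closure_unique:
  assumes c: "conjugation c" and v: "v \<in> decaying" and \<epsilon>: "0 \<le> \<epsilon>"
    and xy: "(x, y) \<in> closure (weyl_graph \<epsilon> c v)" "(x, y') \<in> closure (weyl_graph \<epsilon> c v)"
  shows "y = y'"
proof -
  obtain R where RB: "real_basis c R" using ex_real_basis[OF c] by blast
  have "norm (y - y') \<le> 0"
  proof (rule norm_le_dense[OF closure_lincomb_expv_UNIV])
    show "cmod (cinner w (y - y')) \<le> 0 * norm w" if "w \<in> lincomb expv UNIV" for w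
      using weyl_graph_closure_wick_form[OF c RB v \<epsilon> xy(1) that] weyl_graph_closure_wick_form[OF c RB v \<epsilon> xy(2) that]
      by (simp add: cinner_diff_right)
  qed simp
  then show ?thesis by simp
qed

text \<open>Up to scalars these exponential vectors are the W(\<phi>) \<Omega>, so this is density
  of the domain. The imaginary vectors form a real subspace whose complex span is everything, as
  \<open>expv_total\<close> requires.\<close>

lemma closure_lincomb_expv_imaginary:
  assumes c: "conjugation c"
  shows "closure (lincomb expv {f. c f = - f}) = UNIV"
proof (rule closure_lincomb_UNIV)
  fix x assume x: "\<And>i. i \<in> {f. c f = - f} \<Longrightarrow> cinner (expv i) x = 0"
  have ad: "c (x + y) = c x + c y" and sc: "c (\<alpha> *\<^sub>C x) = cnj \<alpha> *\<^sub>C c x" for x y \<alpha>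
    using c by (auto simp: conjugation_def)
  show "x = 0"
  proof (rule expv_total[OF _ _ _ x])
    show "t *\<^sub>R f + g \<in> {f. c f = - f}" if "f \<in> {f. c f = - f}" "g \<in> {f. c f = - f}" for f g and t :: real
      using that by (simp add: ad sc scaleR_scaleC scaleC_minus_right)
    show "0 \<in> {f. c f = - f}" using sc[of 0 0] by simp
    fix z
    let ?p = "(1/2) *\<^sub>C (z + c z)" and ?q = "(- \<i> / 2) *\<^sub>C (z - c z)"
    note d = real_decomposition[OF c, of z]
    \<comment> \<open>From z = p + \<i> q with p and q real: the two imaginary vectors are \<i> q
      and - \<i> p.\<close>
    have "z = \<i> *\<^sub>C ?q + \<i> *\<^sub>C ((- \<i>) *\<^sub>C ?p)"
      by (subst d(3)) (simp add: scaleC_scaleC add.commute)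
    moreover have "c (\<i> *\<^sub>C ?q) = - (\<i> *\<^sub>C ?q)" "c ((- \<i>) *\<^sub>C ?p) = - ((- \<i>) *\<^sub>C ?p)"
      unfolding sc[of \<i>] sc[of "- \<i>"] d(1,2) by (simp_all add: scaleC_minus_left)
    ultimately show "\<exists>x\<in>{f. c f = - f}. \<exists>y\<in>{f. c f = - f}. z = x + \<i> *\<^sub>C y" by blast
  qed
qed

lemma expv_mem_lincomb_weyl:
  assumes c: "conjugation c" and \<epsilon>: "0 < \<epsilon>" and f: "c f = - f"
  shows "expv f \<in> lincomb (\<lambda>\<phi>. weyl \<epsilon> \<phi> vacuum) {\<phi>. c \<phi> = \<phi>}"
proof -
  define \<alpha> where "\<alpha> = \<i> * complex_of_real (sqrt (\<epsilon> / 2))"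
  define \<phi> where "\<phi> = inverse \<alpha> *\<^sub>C f"
  have \<alpha>: "\<alpha> \<noteq> 0" "cnj \<alpha> = - \<alpha>" using \<epsilon> by (simp_all add: \<alpha>_def)
  have f\<phi>: "f = \<alpha> *\<^sub>C \<phi>" using \<alpha> by (simp add: \<phi>_def scaleC_scaleC)
  have "c \<phi> = cnj (inverse \<alpha>) *\<^sub>C c f" using c unfolding \<phi>_def conjugation_def by blast
  then have "c \<phi> = \<phi>" using \<alpha> by (simp add: f \<phi>_def scaleC_minus_left scaleC_minus_right)
  then have "weyl \<epsilon> \<phi> vacuum \<in> lincomb (\<lambda>\<phi>. weyl \<epsilon> \<phi> vacuum) {\<phi>. c \<phi> = \<phi>}"
    using lincomb_base[of \<phi> "{\<phi>. c \<phi> = \<phi>}" "\<lambda>\<phi>. weyl \<epsilon> \<phi> vacuum"] by simp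
  then have "exp (of_real ((norm f)\<^sup>2 / 2)) *\<^sub>C weyl \<epsilon> \<phi> vacuum \<in> lincomb (\<lambda>\<phi>. weyl \<epsilon> \<phi> vacuum) {\<phi>. c \<phi> = \<phi>}"
    using csubspace_lincomb[of "\<lambda>\<phi>. weyl \<epsilon> \<phi> vacuum" "{\<phi>. c \<phi> = \<phi>}"] unfolding csubspace_def by blast
  moreover have "exp (of_real ((norm f)\<^sup>2 / 2)) *\<^sub>C weyl \<epsilon> \<phi> vacuum = expv f"
    unfolding weyl_vacuum[OF less_imp_le[OF \<epsilon>] f\<phi>[unfolded \<alpha>_def]] scaleC_scaleC exp_add[symmetric] by simp
  ultimately show ?thesis by simp
qed

lemma norm_sfock_mono:
  assumes "\<And>n. norm (sfock_comp n x) \<le> norm (sfock_comp n y)"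
  shows "norm x \<le> norm y"
proof -
  have "(norm x)\<^sup>2 \<le> (norm y)\<^sup>2"
    by (rule sums_le[OF _ norm_sfock_sums norm_sfock_sums]) (use assms in \<open>simp add: power_mono\<close>)
  then show ?thesis by (simp add: power2_le_iff_abs_le)
qed

text \<open>The span of exponential vectors of imaginary arguments is invariant under \<open>\<Gamma>(8)\<close>, so approximating
  \<open>\<Gamma>(8) x\<close> in norm approximates \<open>x\<close> in a norm for which multiplication by \<open>v\<close> is bounded.\<close>

lemma weyl_graph_closure_finite:
  fixes c :: "'a::complex_hilbert \<Rightarrow> 'a"
  assumes c: "conjugation c" and v: "v \<in> decaying" and \<epsilon>: "0 < \<epsilon>"
  shows "\<exists>y. (truncate M \<psi>, y) \<in> closure (weyl_graph \<epsilon> c v)"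
proof -
  obtain R where RB: "real_basis c R" using ex_real_basis[OF c] by blast
  have R: "orthonormal_basis R" using RB by (simp add: real_basis_def)
  let ?x = "truncate M \<psi>" and ?X = "{f. c f = - f}"
  \<comment> \<open>\<open>x8\<close> is \<Gamma>(8) of the truncation; it exists since only
    finitely many components are nonzero.\<close>
  have "summable (\<lambda>n. (cmod (8 ^ n) * norm (sfock_comp n ?x))\<^sup>2)"
    by (rule summable_finite[of "{..M}"]) (auto simp: sfock_comp_truncate)
  from ex_sfock_weighted[OF this] obtain x8 where x8: "\<And>n. sfock_comp n x8 = 8 ^ n *\<^sub>C sfock_comp n ?x" by blast
  obtain q where q: "\<And>k. q k \<in> lincomb expv ?X" "q \<longlonglongrightarrow> x8"
    using closure_lincomb_expv_imaginary[OF c] closure_sequential[of x8 "lincomb expv ?X"] by auto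
  let ?L = "lincomb expv ?X"
  \<comment> \<open>Every vector of the span is \<Gamma>(8) of another one: expv f comes from expv
    (f / 8), and f / 8 is again imaginary.\<close>
  have "?L \<subseteq> {y. \<exists>x\<in>?L. \<forall>n. sfock_comp n y = 8 ^ n *\<^sub>C sfock_comp n x}" (is "_ \<subseteq> ?N")
  proof (rule lincomb_subset)
    have L: "csubspace ?L" by (rule csubspace_lincomb)
    show "csubspace ?N"
      unfolding csubspace_def
    proof (intro conjI ballI allI)
      show "0 \<in> ?N" using L by (auto simp: csubspace_def sfock_comp_simps intro!: bexI[of _ 0])
      show "y + y' \<in> ?N" if yy: "y \<in> ?N" "y' \<in> ?N" for y y'
      proof -
        obtain x x' where "x \<in> ?L" "x' \<in> ?L" "\<forall>n. sfock_comp n y = 8 ^ n *\<^sub>C sfock_comp n x"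
          "\<forall>n. sfock_comp n y' = 8 ^ n *\<^sub>C sfock_comp n x'" using yy by blast
        then show ?thesis using L
          by (auto simp: csubspace_def sfock_comp_simps scaleC_add_right intro!: bexI[of _ "x + x'"])
      qed
      show "\<alpha> *\<^sub>C y \<in> ?N" if yy: "y \<in> ?N" for \<alpha> y
      proof -
        obtain x where "x \<in> ?L" "\<forall>n. sfock_comp n y = 8 ^ n *\<^sub>C sfock_comp n x" using yy by blast
        then show ?thesis using L
          by (auto simp: csubspace_def sfock_comp_simps scaleC_scaleC mult.commute intro!: bexI[of _ "\<alpha> *\<^sub>C x"])
      qed
    qed
    fix f assume f: "f \<in> ?X"
    have "c ((1/8) *\<^sub>R f) = (1/8) *\<^sub>R c f"
      using c unfolding conjugation_def scaleR_scaleC by simp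
    then have "(1/8) *\<^sub>R f \<in> ?X" using f by simp
    then have "expv ((1/8) *\<^sub>R f) \<in> ?L" by (rule lincomb_base)
    moreover have "sfock_comp n (expv f) = 8 ^ n *\<^sub>C sfock_comp n (expv ((1/8) *\<^sub>R f))" for n
      using sfock_comp_expv_scaleR[of n 8 "(1/8) *\<^sub>R f"] by simp
    ultimately show "expv f \<in> ?N" by blast
  qed
  then have "\<forall>k. \<exists>x\<in>?L. \<forall>n. sfock_comp n (q k) = 8 ^ n *\<^sub>C sfock_comp n x" using q(1) by blast
  then obtain p where p: "\<And>k. p k \<in> ?L" "\<And>k n. sfock_comp n (q k) = 8 ^ n *\<^sub>C sfock_comp n (p k)" by metis
  have "?L \<subseteq> lincomb (\<lambda>\<phi>. weyl \<epsilon> \<phi> vacuum) {\<phi>. c \<phi> = \<phi>}"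
    by (rule lincomb_subset[OF csubspace_lincomb]) (simp add: expv_mem_lincomb_weyl[OF c \<epsilon>])
  then have "\<exists>y. (p k, y) \<in> weyl_graph \<epsilon> c v" for k
    unfolding weyl_graph_def mem_lincomb[where v="\<lambda>\<phi>. weyl \<epsilon> \<phi> v", symmetric] using p(1) by blast
  then obtain z where z: "\<And>k. (p k, z k) \<in> weyl_graph \<epsilon> c v" by metis
  \<comment> \<open>\<Gamma>(1/8) is a contraction, so convergence of \<open>q\<close> implies that
    of \<open>p\<close>.\<close>
  have "norm (p k - ?x) \<le> norm (q k - x8)" for k
  proof (rule norm_sfock_mono)
    fix n
    have "sfock_comp n (q k - x8) = 8 ^ n *\<^sub>C sfock_comp n (p k - ?x)"
      by (simp only: sfock_comp_simps p(2) x8 scaleC_diff_right)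
    then have "norm (sfock_comp n (q k - x8)) = 8 ^ n * norm (sfock_comp n (p k - ?x))"
      by (simp add: norm_scaleC norm_power)
    then show "norm (sfock_comp n (p k - ?x)) \<le> norm (sfock_comp n (q k - x8))"
      using mult_right_mono[of 1 "8 ^ n" "norm (sfock_comp n (p k - ?x))"] by simp
  qed
  moreover have "(\<lambda>k. norm (q k - x8)) \<longlonglongrightarrow> 0"
    using tendsto_norm[OF LIM_zero[OF q(2)]] by simp
  ultimately have "(\<lambda>k. p k - ?x) \<longlonglongrightarrow> 0"
    by (intro Lim_null_comparison[of "\<lambda>k. p k - ?x" "\<lambda>k. norm (q k - x8)"]) auto
  then have px: "p \<longlonglongrightarrow> ?x" by (rule LIM_zero_cancel)
  obtain L where L: "decay_bound v L" using v by (auto simp: decaying_def)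
  \<comment> \<open>The distance of \<open>q k\<close> and \<open>q m\<close> is a decay constant
    for \<open>p k - p m\<close>, so the bound in terms of \<open>w\<close> makes the images Cauchy.
    The summand 0 only fits the form of \<open>Cauchy_of_bound\<close>, which has two controlling
    sequences.\<close>
  have "norm (z k - z m) \<le> (geom_const * L) * norm (q k - q m) + 0 * norm (q k - q m)" for k m
  proof -
    have db: "decay_bound (p k - p m) (norm (q k - q m))"
      unfolding decay_bound_def
    proof
      fix n
      have "sfock_comp n (q k - q m) = 8 ^ n *\<^sub>C sfock_comp n (p k - p m)"
        by (simp only: sfock_comp_simps p(2) scaleC_diff_right)
      then show "8 ^ n * norm (sfock_comp n (p k - p m)) \<le> norm (q k - q m)"
        using norm_sfock_comp_le[of n "q k - q m"] by (simp add: norm_scaleC norm_power)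
    qed
    have "norm (z k - z m) \<le> geom_const * (L * norm (q k - q m))"
    proof (rule norm_le_dense[OF closure_lincomb_expv_UNIV])
      fix w :: "'a sfock" assume w: "w \<in> lincomb expv UNIV"
      have "(p k - p m, z k - z m) \<in> weyl_graph \<epsilon> c v"
        using z lin_graph_diff unfolding weyl_graph_def by blast
      then have "cinner w (z k - z m) = wick_form R w v (p k - p m)"
        by (rule weyl_graph_wick_form[OF c RB v less_imp_le[OF \<epsilon>] _ w])
      then show "cmod (cinner w (z k - z m)) \<le> geom_const * (L * norm (q k - q m)) * norm w"
        using wick_form_bound_decay[OF R L db, of w] by (simp add: mult.assoc)
    qed (use geom_const_nonneg decay_bound_nonneg[OF L] in auto)
    then show ?thesis by (simp add: mult.assoc)
  qed
  then have "Cauchy z"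
    by (rule Cauchy_of_bound[OF LIMSEQ_imp_Cauchy[OF q(2)] LIMSEQ_imp_Cauchy[OF q(2)], rotated 2])
      (simp_all add: geom_const_nonneg decay_bound_nonneg[OF L])
  then obtain y where "z \<longlonglongrightarrow> y" using Cauchy_convergent convergent_def by blast
  then show ?thesis unfolding closure_pair_sequential using z px by blast
qed

text \<open>Truncations of \<open>\<psi>\<close> lie in the domain of the closure. The a priori
  bound on differences of their images involves truncations of \<open>\<psi>\<close> and of
  \<open>\<phi>\<close>, both convergent, so the images converge and the closed graph contains the
  limit.\<close>

lemma weyl_graph_closure_extend:
  fixes c :: "'a::complex_hilbert \<Rightarrow> 'a"
  assumes c: "conjugation c" and v: "v \<in> decaying" and \<epsilon>: "0 < \<epsilon>"
    and K: "0 \<le> K" "0 \<le> L"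
    and wt: "\<And>n. sfock_comp n \<phi> = g n *\<^sub>C sfock_comp n \<psi>"
    and bound: "\<And>x x' y. (\<And>n. sfock_comp n x' = g n *\<^sub>C sfock_comp n x) \<Longrightarrow>
      (x, y) \<in> closure (weyl_graph \<epsilon> c v) \<Longrightarrow> norm y \<le> K * norm x + L * norm x'"
  shows "\<exists>y. (\<psi>, y) \<in> closure (weyl_graph \<epsilon> c v)"
proof -
  have "\<forall>M. \<exists>y. (truncate M \<psi>, y) \<in> closure (weyl_graph \<epsilon> c v)"
    using weyl_graph_closure_finite[OF c v \<epsilon>] by blast
  then obtain z where z: "\<And>M. (truncate M \<psi>, z M) \<in> closure (weyl_graph \<epsilon> c v)" by metis
  have "norm (z m - z n) \<le> K * norm (truncate m \<psi> - truncate n \<psi>) + L * norm (truncate m \<phi> - truncate n \<phi>)" for m n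
    by (rule bound[OF _ weyl_graph_closure_diff[OF z z]])
      (simp add: sfock_comp_simps sfock_comp_truncate wt scaleC_diff_right)
  then have "Cauchy z"
    by (intro Cauchy_of_bound[OF LIMSEQ_imp_Cauchy[OF truncate_tendsto] LIMSEQ_imp_Cauchy[OF truncate_tendsto] K])
  then obtain y where y: "z \<longlonglongrightarrow> y" using Cauchy_convergent convergent_def by blast
  have "(\<psi>, y) \<in> closure (closure (weyl_graph \<epsilon> c v))"
    unfolding closure_pair_sequential[of _ _ "closure _"]
    by (intro exI[of _ "\<lambda>M. truncate M \<psi>"] exI[of _ z]) (simp add: z y truncate_tendsto)
  then show ?thesis by auto
qed

theorem proposition3p17:
  fixes c :: "'z::complex_hilbert \<Rightarrow> 'z"
    and S :: "complex \<Rightarrow> complex" and a :: "nat \<Rightarrow> real" and l\<^sub>1 :: real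
  assumes separable: "\<exists>D::'z set. countable D \<and> closure D = UNIV"
    and conjugation: "conjugation c"
    and entire: "S holomorphic_on UNIV"
    and series: "\<And>z. (\<lambda>k. complex_of_real (a k) * z ^ k) sums S z"
    and a_pos: "\<And>k. a k > 0"
    and l\<^sub>1: "l\<^sub>1 > 8 * exp 1"
  shows "\<exists>C>0. \<forall>\<epsilon>::real. 0 < \<epsilon> \<and> \<epsilon> \<le> 1 \<longrightarrow> (\<forall>V \<Psi> :: 'z sfock.
    summable (\<lambda>n. (l\<^sub>1 * \<epsilon>) ^ n / a (n + 2) * (norm (sfock_comp n V))\<^sup>2) \<longrightarrow>
    \<Psi> \<in> Domain (number_fun \<epsilon> (\<lambda>x. csqrt (S (complex_of_real (x / \<epsilon>))))) \<longrightarrow>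
      \<Psi> \<in> Domain (F_Wick \<epsilon> c V) \<and>
      norm (app (F_Wick \<epsilon> c V) \<Psi>)
        \<le> 2 * norm (app (Gamma_op (sqrt \<epsilon>)) V) * norm \<Psi>
          + C * sqrt (\<Sum>n. (l\<^sub>1 * \<epsilon>) ^ n / a (n + 2) * (norm (sfock_comp n V))\<^sup>2)
              * norm (app (number_fun \<epsilon> (\<lambda>x. csqrt (S (complex_of_real (x / \<epsilon>))))) \<Psi>))"
\<comment> \<open>The constant 2 is that of \<open>weight_sum_le\<close>. It is independent of
  \<epsilon> because \<epsilon> disappears once V is replaced by \<Gamma>(sqrt \<epsilon>) V and S(N
  / \<epsilon>) is seen to act as S(n) in degree n.\<close>
proof (intro exI[of _ 2] conjI allI impI)
  show "(0::real) < 2" by simp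
next
  fix \<epsilon> :: real and V \<Psi> :: "'z sfock"
  let ?g = "\<lambda>x. csqrt (S (complex_of_real (x / \<epsilon>)))"
  let ?A = "\<Sum>n. (l\<^sub>1 * \<epsilon>) ^ n / a (n + 2) * (norm (sfock_comp n V))\<^sup>2"
  assume \<epsilon>: "0 < \<epsilon> \<and> \<epsilon> \<le> 1"
    and summ: "summable (\<lambda>n. (l\<^sub>1 * \<epsilon>) ^ n / a (n + 2) * (norm (sfock_comp n V))\<^sup>2)"
    and dom: "\<Psi> \<in> Domain (number_fun \<epsilon> ?g)"
  \<comment> \<open>The 3 of \<open>choose_sum_le\<close> has to be dominated by the base of the
    weights, as \<open>weight_sum_le\<close> asks.\<close>
  have "(1::real) \<le> exp 1" by simp
  then have l3: "3 \<le> l\<^sub>1" using l\<^sub>1 by linarith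
  have a0: "0 \<le> a k" "a k \<noteq> 0" for k using a_pos[of k] by auto

  \<comment> \<open>\<epsilon> \<le> 1 makes \<Gamma>(sqrt \<epsilon>) a contraction, so every
    \<open>V\<close> lies in its domain.\<close>
  have "(cmod (complex_of_real (sqrt \<epsilon> ^ n)) * norm (sfock_comp n V))\<^sup>2 \<le> (norm (sfock_comp n V))\<^sup>2" for n
    using \<epsilon> power_le_one[of "sqrt \<epsilon>" n]
    by (intro power_mono mult_left_le_one_le) (auto simp: norm_power)
  then have "summable (\<lambda>n. (cmod (complex_of_real (sqrt \<epsilon> ^ n)) * norm (sfock_comp n V))\<^sup>2)"
    by (intro summable_comparison_test'[OF sums_summable[OF norm_sfock_sums[of V]], of 0]) auto
  from ex_sfock_weighted[OF this] obtain v
    where vV: "\<And>n. sfock_comp n v = complex_of_real (sqrt \<epsilon> ^ n) *\<^sub>C sfock_comp n V" by blast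
  have v: "app (Gamma_op (sqrt \<epsilon>)) V = v" by (rule app_Gamma_op[OF vV])
  have "(norm (sfock_comp n v))\<^sup>2 = \<epsilon> ^ n * (norm (sfock_comp n V))\<^sup>2" for n
  proof -
    have "(sqrt \<epsilon> ^ n)\<^sup>2 = \<epsilon> ^ n" using \<epsilon> by (simp add: power_mult[symmetric] mult.commute[of n] power_mult)
    then show ?thesis unfolding vV norm_scaleC norm_of_real power_mult_distrib by simp
  qed
  \<comment> \<open>The power of \<epsilon> in the weight is exactly the one contained in the
    squared norms of \<open>v\<close>.\<close>
  then have termeq: "(\<lambda>n. (l\<^sub>1 * \<epsilon>) ^ n / a (n + 2) * (norm (sfock_comp n V))\<^sup>2)
      = (\<lambda>n. l\<^sub>1 ^ n / a (n + 2) * (norm (sfock_comp n v))\<^sup>2)"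
    by (simp add: power_mult_distrib mult_ac)
  have A: "(\<lambda>n. l\<^sub>1 ^ n / a (n + 2) * (norm (sfock_comp n v))\<^sup>2) sums ?A"
    using summable_sums[OF summ] unfolding termeq .
  have tnn: "0 \<le> l\<^sub>1 ^ n / a (n + 2) * (norm (sfock_comp n v))\<^sup>2" for n
    using a0[of "n + 2"] l3 by simp
  have A0: "0 \<le> ?A" by (rule sums_le[OF _ sums_zero A]) (rule tnn)

  \<comment> \<open>At real arguments S is real because its coefficients are, and at natural numbers
    it is nonnegative; hence the squared modulus of csqrt (S n) is S n.\<close>
  have rseries: "(\<lambda>k. a k * x ^ k) sums Re (S (of_real x))" for x
    using sums_Re[OF series[of "of_real x"]] by (simp flip: of_real_power of_real_mult)
  have iseries: "Im (S (of_real x)) = 0" for x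
    using sums_unique2[OF sums_Im[OF series[of "of_real x"]], of 0] by (simp flip: of_real_power of_real_mult)
  define Sr where "Sr m = Re (S (of_real (real m)))" for m :: nat
  have Sr: "(\<lambda>k. a k * real m ^ k) sums Sr m" for m unfolding Sr_def by (rule rseries)
  have Sr0: "0 \<le> Sr m" for m by (rule sums_le[OF _ sums_zero Sr]) (use a0 in auto)
  have gn: "(cmod (?g (\<epsilon> * real n)))\<^sup>2 = Sr n" for n
  proof -
    have "S (complex_of_real (\<epsilon> * real n / \<epsilon>)) = complex_of_real (Sr n)"
      using \<epsilon> iseries[of "real n"] by (simp add: Sr_def complex_eq_iff)
    then show ?thesis using Sr0[of n] by (simp add: norm_csqrt)
  qed

  \<comment> \<open>64 = 8^2, since the weights bound squared norms. The series converges at 64, so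
    a k 64^k is bounded and 1 / a (n + 2) grows at least like 64^n.\<close>
  have vd: "v \<in> decaying"
  proof -
    have "(\<lambda>k. a k * 64 ^ k) \<longlonglongrightarrow> 0" by (rule summable_LIMSEQ_zero[OF sums_summable[OF rseries]])
    then have "Bseq (\<lambda>k. a k * 64 ^ k)" by (rule convergent_imp_Bseq[OF convergentI])
    then obtain Q where Q: "\<And>k. norm (a k * 64 ^ k) \<le> Q" unfolding Bseq_def by blast
    have "64 ^ n * (norm (sfock_comp n v))\<^sup>2 \<le> Q * ?A" for n
    proof -
      have 1: "l\<^sub>1 ^ n / a (n + 2) * (norm (sfock_comp n v))\<^sup>2 \<le> ?A"
        using sum_le_suminf[OF sums_summable[OF A], of "{n}"] tnn sums_unique[OF A] by simp
      have "64 ^ n * (norm (sfock_comp n v))\<^sup>2 = (a (n + 2) * 64 ^ n) * (1 / a (n + 2) * (norm (sfock_comp n v))\<^sup>2)"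
        using a0[of "n + 2"] by simp
      also have "\<dots> \<le> (a (n + 2) * 64 ^ (n + 2)) * (l\<^sub>1 ^ n / a (n + 2) * (norm (sfock_comp n v))\<^sup>2)"
        using a0 l3 by (intro mult_mono mult_left_mono mult_right_mono divide_right_mono power_increasing one_le_power) auto
      also have "\<dots> \<le> Q * ?A"
        using Q[of "n + 2"] order_trans[OF norm_ge_zero Q[of 0]] tnn a0[of "n + 2"] by (intro mult_mono 1) auto
      finally show ?thesis .
    qed
    then have "8 ^ n * norm (sfock_comp n v) \<le> sqrt (Q * ?A)" for n
      by (intro real_le_rsqrt) (simp add: power_mult_distrib power_mult[symmetric] mult.commute[of n] power_mult)
    then show ?thesis by (auto simp: decaying_def decay_bound_def)
  qed

  obtain R where RB: "real_basis c R" using ex_real_basis[OF conjugation] by blast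
  have R: "orthonormal_basis R" using RB by (simp add: real_basis_def)
  \<comment> \<open>The a priori bound on the whole closed graph, obtained by testing against the
    span of exponential vectors, where the matrix elements of \<open>y\<close> are the trilinear
    form.\<close>
  have bound: "norm y \<le> norm v * norm x + 2 * sqrt ?A * norm x'"
    if x': "\<And>n. sfock_comp n x' = ?g (\<epsilon> * real n) *\<^sub>C sfock_comp n x"
      and xy: "(x, y) \<in> closure (weyl_graph \<epsilon> c v)" for x x' y
  proof (rule norm_le_dense[OF closure_lincomb_expv_UNIV])
    have "(norm (sfock_comp n x'))\<^sup>2 = Sr n * (norm (sfock_comp n x))\<^sup>2" for n
      unfolding x' norm_scaleC power_mult_distrib gn ..
    then have B: "(\<lambda>n. Sr n * (norm (sfock_comp n x))\<^sup>2) sums (norm x')\<^sup>2"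
      using norm_sfock_sums[of x'] by simp
    fix w :: "'z sfock" assume w: "w \<in> lincomb expv UNIV"
    have wd: "w \<in> decaying" using w lincomb_expv_decaying by blast
    have "cmod (wick_form R w v x) \<le> norm w * (norm v * norm x + 2 * sqrt ?A * sqrt ((norm x')\<^sup>2))"
      by (rule wick_form_le[OF R wd vd weight_sum_le[OF a_pos l3 Sr _ _ A B]]) auto
    then show "cmod (cinner w y) \<le> (norm v * norm x + 2 * sqrt ?A * norm x') * norm w"
      using weyl_graph_closure_wick_form[OF conjugation RB vd _ xy w] \<epsilon> by (simp add: mult.commute)
  qed (use A0 in auto)

  from dom obtain \<phi> where "(\<Psi>, \<phi>) \<in> number_fun \<epsilon> ?g" by (rule DomainE)
  then have \<phi>: "sfock_comp n \<phi> = ?g (\<epsilon> * real n) *\<^sub>C sfock_comp n \<Psi>" for n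
    unfolding number_fun_def by blast
  have app\<phi>: "app (number_fun \<epsilon> ?g) \<Psi> = \<phi>" by (rule app_number_fun[OF \<phi>])
  have "\<exists>y. (\<Psi>, y) \<in> closure (weyl_graph \<epsilon> c v)"
  proof (rule weyl_graph_closure_extend[OF conjugation vd _ _ _ \<phi>])
    show "0 < \<epsilon>" "0 \<le> norm v" "0 \<le> 2 * sqrt ?A" using \<epsilon> A0 by simp_all
  qed (rule bound)
  then obtain y where y: "(\<Psi>, y) \<in> closure (weyl_graph \<epsilon> c v)" ..
  show "\<Psi> \<in> Domain (F_Wick \<epsilon> c V)" unfolding F_Wick_eq v using y by blast
  have "app (F_Wick \<epsilon> c V) \<Psi> = y"
    unfolding F_Wick_eq v
    by (rule app_eqI[OF y]) (use weyl_graph_closure_unique[OF conjugation vd _ _ y] \<epsilon> in auto)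
  then have "norm (app (F_Wick \<epsilon> c V) \<Psi>) \<le> norm v * norm \<Psi> + 2 * sqrt ?A * norm \<phi>"
    using bound[OF \<phi> y] by simp
  also have "\<dots> \<le> 2 * norm v * norm \<Psi> + 2 * sqrt ?A * norm \<phi>" by simp
  finally show "norm (app (F_Wick \<epsilon> c V) \<Psi>)
        \<le> 2 * norm (app (Gamma_op (sqrt \<epsilon>)) V) * norm \<Psi> + 2 * sqrt ?A * norm (app (number_fun \<epsilon> ?g) \<Psi>)"
    unfolding v app\<phi> .
qed

end
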